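(* Suppose that (H3.0) $\{\tau\phi-\Theta\zeta:\phi\in\bar{\mathcal H}_2,\ \zeta\in\mathfrak h\}=\mathfrak h$; (H3.1) $\mathrm{Ran}(\tau^* )\cap\mathcal H_{-1}=\{0\}$; (H4.1.1) $\|C_1\phi\|_0\le c_1\|B\phi\|_0$ and $\|C_2\phi\|_0\le c_2\|B\phi\|_0$ for all $\phi\in\mathcal H_1$, with $c_1c_2<1$; (H4.2.1) $C_1(\mathcal H_2)\subseteq\mathcal H_1$, $C_2(\mathcal H_2)\subseteq\mathcal H_1$, and $C_1C_2\phi=C_2C_1\phi$, $BC_1\phi=C_1B\phi$, $BC_2\phi=C_2B\phi$ for all $\phi\in\mathcal H_2$; (H4.3.1) $\mathrm{Ran}(\bar C_j^*G_C(\lambda))\subseteq D(\bar\tau)$ for $j=1,2$ and real $\lambda\ne0$, where $\bar C_j^*=-\bar B_C^{-1}\bar C_j\bar B_C^{-1}$. Let $\lambda\in\mathbb R$, $\lambda\ne0$. Then the linear operator $\tilde W_\Theta:D(\tilde W_\Theta)\subseteq\mathcal H_C\oplus\mathfrak h_\Theta\to\mathcal H_C\oplus\mathfrak h_\Theta$ with $$D(\tilde W_\Theta):=\{(\phi_0,\psi_0,\zeta_\phi)\in\bar{\mathcal H}_1\times\mathcal H_0\times\mathfrak h_\Theta:\ \phi_0=\phi_\lambda+\bar B_C^{-1}(C_1+C_2)B_C^{-1}G_C(\lambda)\zeta_\psi,$$ $$\psi_0=\psi_\lambda+(1-\bar C_2\bar B_C^{-1}(C_1+C_2)B_C^{-1})G_C(\lambda)\zeta_\psi,\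 \phi_\lambda\in\bar{\mathcal H}_2,\ \psi_\lambda\in\mathcal H_1,\ \zeta_\psi\in\mathfrak h,\ \Theta\zeta_\phi=\bar\tau\phi_0\},$$ $$\tilde W_\Theta(\phi_0,\psi_0,\zeta_\phi):=\big(\bar C_2\phi_\lambda+\psi_\lambda-\lambda\bar B_C^{-1}(-(C_1+C_2)+\lambda)B_C^{-1}G_C(\lambda)\zeta_\psi,$$ $$C_1\psi_\lambda+\bar A\phi_\lambda+\lambda\bar C_2\bar B_C^{-1}(-(C_1+C_2)+\lambda)B_C^{-1}G_C(\lambda)\zeta_\psi,\ \zeta_\psi\big)$$ is a skew-adjoint extension of the restriction of $$\tilde W_g:\bar{\mathcal H}_2\times\mathcal H_1\times\mathfrak h_\Theta\subseteq\mathcal H_C\oplus\mathfrak h_\Theta\to\mathcal H_C\oplus\mathfrak h_\Theta,\qquad\tilde W_g(\phi,\psi,\zeta):=(\bar C_2\phi+\psi,C_1\psi+\bar A\phi,0),$$ to the dense set $\mathcal N_\Theta:=\{(\phi,\psi,\zeta)\in\bar{\mathcal H}_2\times\mathcal H_1\times\mathfrak h_\Theta:\tau\phi=\Theta\zeta\}$.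
   Context: $\mathsf B(X,Y)$ denotes the bounded everywhere defined linear operators from $X$ to $Y$. $\mathcal H_0$ is a Hilbert space with scalar product $\langle\cdot,\cdot\rangle_0$ and norm $\|\cdot\|_0$; $B:D(B)\subseteq\mathcal H_0\to\mathcal H_0$ is self-adjoint with $\mathrm{Ker}(B)=\{0\}$. For $k\ge1$, $\mathcal H_k:=D(B^k)$ with scalar product $\langle\phi_1,\phi_2\rangle_k:=\langle B^k\phi_1,B^k\phi_2\rangle_0+\langle\phi_1,\phi_2\rangle_0$. $\mathcal H_{-k}$ is the completion of $\mathcal H_0$ for $\langle(B^{2k}+1)^{-1/2}\phi_1,(B^{2k}+1)^{-1/2}\phi_2\rangle_0$, so $\mathcal H_{-1}\subseteq\mathcal H_{-2}$. $\bar{\mathcal H}_1$ is the completion of $D(B)$ for $[\phi_1,\phi_2]_1:=\langle B\phi_1,B\phi_2\rangle_0$ (so $\mathcal H_1\subseteq\bar{\mathcal H}_1$ densely). $\bar B\in\mathsf B(\bar{\mathcal H}_1,\mathcal H_0)$ is the bounded extension of $B:\mathcal H_1\subseteq\bar{\mathcal H}_1\to\mathcal H_0$; it is boundedly invertible. For $k\ge1$, $\bar{\mathcal H}_k:=\{\phi\in\bar{\mathcal H}_1:\bar B\phi\in\mathcal H_{k-1}\}$ with scalar product $[\phi_1,\phi_2]_k:=\langle\bar B\phi_1,\bar B\phi_2\rangle_{k-1}$. $\bar A:=-B\bar B:\bar{\mathcal H}_2\to\mathcal H_0$. $\mathfrak h$ is a Hilbert space, $\Theta$ a bounded, positive, injective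 self-adjoint operator on $\mathfrak h$; $\mathfrak h_\Theta$ denotes the Hilbert space given by $\mathfrak h$ endowed with $\langle\zeta_1,\zeta_2\rangle_\Theta:=\langle\Theta\zeta_1,\zeta_2\rangle_{\mathfrak h}$. $\tau\in\mathsf B(\bar{\mathcal H}_2,\mathfrak h)$; $\tau^*\in\mathsf B(\mathfrak h,\mathcal H_{-2})$ is defined by $\langle(B^4+1)^{-1/2}\tau^*\zeta,(B^4+1)^{1/2}\phi\rangle_0=\langle\zeta,\tau\phi\rangle_{\mathfrak h}$, $\zeta\in\mathfrak h$, $\phi\in\mathcal H_2$. $C_1,C_2:\mathcal H_1\subseteq\mathcal H_0\to\mathcal H_0$ are skew-adjoint operators. Under (H4.1.1)-(H4.2.1), $B^2+C_1C_2:\mathcal H_2\subseteq\mathcal H_0\to\mathcal H_0$ is self-adjoint, positive and injective; $B_C:=(B^2+C_1C_2)^{1/2}$ has domain $\mathcal H_1$, and the spaces $\mathcal H_k,\bar{\mathcal H}_k,\mathcal H_{-k}$ generated by $B_C$ coincide with those generated by $B$ up to equivalent norms. $\bar B_C\in\mathsf B(\bar{\mathcal H}_1,\mathcal H_0)$ is the bounded extension of $B_C$, with bounded inverse $\bar B_C^{-1}$; $B_C^{-1}$ is the inverse of $B_C$ on $\mathrm{Ran}(B_C)$. $\bar C_j\in\mathsf B(\bar{\mathcal H}_1,\mathcal H_0)$ is the bounded extension of $C_j:\mathcal H_1\subseteq\bar{\mathcal H}_1\to\mathcal H_0$; $\bar C_2$ maps $\bar{\mathcal H}_2$ into $\mathcal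 H_1$. $\mathcal H_C$ is the Hilbert space $\bar{\mathcal H}_1\times\mathcal H_0$ with scalar product $\langle\langle(\phi_1,\psi_1),(\phi_2,\psi_2)\rangle\rangle_C:=\langle\bar B_C\phi_1,\bar B_C\phi_2\rangle_0+\langle\psi_1+\bar C_2\phi_1,\psi_2+\bar C_2\phi_2\rangle_0$; on $\mathcal H_C\oplus\mathfrak h_\Theta$ the scalar product is $\langle\langle(\phi_1,\psi_1),(\phi_2,\psi_2)\rangle\rangle_C+\langle\zeta_1,\zeta_2\rangle_\Theta$. The operator $\tilde W_g$ is skew-adjoint on it. $J_\nu:\mathcal H_0\to\mathcal H_0$, $\nu>0$, is a fixed family of self-adjoint operators such that: (1) $J_\nu\in\mathsf B(\mathcal H_k,\mathcal H_{k+1})$ for all $k\ge0$; (2) $J_\nu B_C\phi=B_CJ_\nu\phi$ and $J_\nu(C_1+C_2)\phi=(C_1+C_2)J_\nu\phi$ for all $\phi\in\mathcal H_1$; (3) $\lim_{\nu\downarrow0}\|J_\nu\phi-\phi\|_0=0$ for all $\phi\in\mathcal H_0$. $\bar J_\nu\in\mathsf B(\bar{\mathcal H}_k,\bar{\mathcal H}_{k+1})$, $k\ge1$, is the bounded extension of $J_\nu$; $D(\bar\tau):=\{\phi\in\bar{\mathcal H}_1:\lim_{\nu\downarrow0}\tau\bar J_\nu\phi\text{ exists in }\mathfrak h\}$ and $\bar\tau\phi:=\lim_{\nu\downarrow0}\tau\bar J_\nu\phi$. For real $\lambda\ne0$: $\breve G_C(\lambda):=\tau(B^2+(-C_1+\lambda)(-C_2+\lambda))^{-1}\in\mathsf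 B(\mathcal H_0,\mathfrak h)$, $G_C(\lambda):=\breve G_C(-\lambda)^*\in\mathsf B(\mathfrak h,\mathcal H_0)$; one has $\mathrm{Ran}(G_C(\lambda))\subseteq\mathrm{Ran}(B_C)$. $1$ denotes the identity operator.
   Formalization: The formal theorem adds the hypothesis Ker(τ* ) = {0}; without it any nonzero ζ in Ker(τ* ) has G_C(λ)ζ = 0, so W̃_Θ would send (0,0,0) to both (0,0,0) and (0,0,ζ) (e.g. τ = 0, Θ = 1, C_1 = C_2 = 0, where N_Θ is also not dense). *)

theory Defs
  imports "HOL-Analysis.Analysis"
begin

(* Scalars: up to isomorphism, the only models of this class are the real and the complex numbers
   with their usual conjugation and real part, so statements over it cover real and complex Hilbert
   spaces at once. *)
class rc_field = real_normed_field +
  fixes kcnj :: "'a \<Rightarrow> 'a" and kre :: "'a \<Rightarrow> real"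
  assumes kcnj_add: "kcnj (a + b) = kcnj a + kcnj b"
    and kcnj_mult: "kcnj (a * b) = kcnj a * kcnj b"
    and kcnj_kcnj: "kcnj (kcnj a) = a"
    and kre: "kre a *\<^sub>R 1 = (a + kcnj a) / 2"
    and mult_kcnj: "a * kcnj a = (norm a)\<^sup>2 *\<^sub>R 1"

instantiation real :: rc_field
begin
definition "kcnj = (\<lambda>x::real. x)"
definition "kre = (\<lambda>x::real. x)"
instance by standard (auto simp: kcnj_real_def kre_real_def power2_eq_square)
end

instantiation complex :: rc_field
begin
definition "kcnj = cnj"
definition "kre = Re"
instance
proof
  fix a b :: complex
  show "kcnj (a + b) = kcnj a + kcnj b" "kcnj (a * b) = kcnj a * kcnj b" "kcnj (kcnj a) = a"
    by (simp_all add: kcnj_complex_def)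
  show "kre a *\<^sub>R 1 = (a + kcnj a) / 2"
    by (simp add: kcnj_complex_def kre_complex_def complex_eq_iff)
  show "a * kcnj a = (norm a)\<^sup>2 *\<^sub>R 1"
    by (simp add: kcnj_complex_def complex_norm_square [symmetric] scaleR_conv_of_real)
qed
end

(* A Hilbert space over the scalars. The norm and topology are those of the type class; the product
   is antilinear in its first argument, and its real part is the inner product of the type class,
   so that norm x = sqrt (ip x x). *)
locale hilbert_space = vector_space sc
  for sc :: "'k::rc_field \<Rightarrow> 'v::{real_inner,complete_space} \<Rightarrow> 'v" +
  fixes ip :: "'v \<Rightarrow> 'v \<Rightarrow> 'k"
  assumes scale_of_real: "sc (of_real r) x = r *\<^sub>R x"
    and ip_add_right: "ip x (y + z) = ip x y + ip x z"
    and ip_scale_right: "ip x (sc c y) = c * ip x y"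
    and ip_cnj: "ip y x = kcnj (ip x y)"
    and kre_ip: "kre (ip x y) = inner x y"

definition klinear_on ::
  "('k \<Rightarrow> 'a::plus \<Rightarrow> 'a) \<Rightarrow> ('k \<Rightarrow> 'b::plus \<Rightarrow> 'b) \<Rightarrow> 'a set \<Rightarrow> ('a \<Rightarrow> 'b) \<Rightarrow> bool"
  where "klinear_on s1 s2 X f \<longleftrightarrow>
    (\<forall>x\<in>X. \<forall>y\<in>X. f (x + y) = f x + f y) \<and> (\<forall>c. \<forall>x\<in>X. f (s1 c x) = s2 c (f x))"

(* f belongs to B(X,Y), where the subspaces X and Y carry the norms N1 and N2. *)
definition bounded_between ::
  "('k \<Rightarrow> 'a::plus \<Rightarrow> 'a) \<Rightarrow> 'a set \<Rightarrow> ('a \<Rightarrow> real) \<Rightarrow>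
   ('k \<Rightarrow> 'b::plus \<Rightarrow> 'b) \<Rightarrow> 'b set \<Rightarrow> ('b \<Rightarrow> real) \<Rightarrow> ('a \<Rightarrow> 'b) \<Rightarrow> bool"
  where "bounded_between s1 X N1 s2 Y N2 f \<longleftrightarrow>
    klinear_on s1 s2 X f \<and> f ` X \<subseteq> Y \<and> (\<exists>c. \<forall>x\<in>X. N2 (f x) \<le> c * N1 x)"

(* A partially defined operator is given by a domain and a function whose values outside the domain
   are irrelevant, or by its graph. *)
definition op_graph :: "'a set \<Rightarrow> ('a \<Rightarrow> 'b) \<Rightarrow> ('a \<times> 'b) set"
  where "op_graph D T = {(x, T x) | x. x \<in> D}"

definition linear_graph :: "('k \<Rightarrow> 'a::ab_group_add \<Rightarrow> 'a) \<Rightarrow> ('a \<times> 'a) set \<Rightarrow> bool"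
  where "linear_graph sc T \<longleftrightarrow> single_valued T \<and> (0, 0) \<in> T \<and>
    (\<forall>(x, y)\<in>T. \<forall>(x', y')\<in>T. (x + x', y + y') \<in> T) \<and>
    (\<forall>c. \<forall>(x, y)\<in>T. (sc c x, sc c y) \<in> T)"

definition ip_norm :: "('a \<Rightarrow> 'a \<Rightarrow> 'k::rc_field) \<Rightarrow> 'a \<Rightarrow> real"
  where "ip_norm ip x = sqrt (kre (ip x x))"

definition dense_wrt :: "('a::ab_group_add \<Rightarrow> 'a \<Rightarrow> 'k::rc_field) \<Rightarrow> 'a set \<Rightarrow> bool"
  where "dense_wrt ip S \<longleftrightarrow> (\<forall>x. \<forall>e>0. \<exists>y\<in>S. ip_norm ip (x - y) < e)"

definition adjoint_graph :: "('a \<Rightarrow> 'a \<Rightarrow> 'k) \<Rightarrow> ('a \<times> 'a) set \<Rightarrow> ('a \<times> 'a) set"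
  where "adjoint_graph ip T = {(x, y). \<forall>(u, v)\<in>T. ip x v = ip y u}"

definition self_adjoint ::
  "('k::rc_field \<Rightarrow> 'a::ab_group_add \<Rightarrow> 'a) \<Rightarrow> ('a \<Rightarrow> 'a \<Rightarrow> 'k) \<Rightarrow> ('a \<times> 'a) set \<Rightarrow> bool"
  where "self_adjoint sc ip T \<longleftrightarrow>
    linear_graph sc T \<and> dense_wrt ip (Domain T) \<and> adjoint_graph ip T = T"

definition skew_adjoint ::
  "('k::rc_field \<Rightarrow> 'a::ab_group_add \<Rightarrow> 'a) \<Rightarrow> ('a \<Rightarrow> 'a \<Rightarrow> 'k) \<Rightarrow> ('a \<times> 'a) set \<Rightarrow> bool"
  where "skew_adjoint sc ip T \<longleftrightarrow>
    linear_graph sc T \<and> dense_wrt ip (Domain T) \<and> adjoint_graph ip T = {(x, - y) | x y. (x, y) \<in> T}"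

(* The operator S with domain E is the positive self-adjoint square root of T with domain D. *)
definition positive_sqrt ::
  "('k::rc_field \<Rightarrow> 'a::ab_group_add \<Rightarrow> 'a) \<Rightarrow> ('a \<Rightarrow> 'a \<Rightarrow> 'k) \<Rightarrow>
   'a set \<Rightarrow> ('a \<Rightarrow> 'a) \<Rightarrow> 'a set \<Rightarrow> ('a \<Rightarrow> 'a) \<Rightarrow> bool"
  where "positive_sqrt sc ip D T E S \<longleftrightarrow>
    self_adjoint sc ip (op_graph E S) \<and> (\<forall>x\<in>E. 0 \<le> kre (ip x (S x))) \<and>
    op_graph E S O op_graph E S = op_graph D T"

(* The adjoint of an everywhere defined bounded F : X \<rightarrow> Y. *)
definition bounded_adjoint ::
  "('a \<Rightarrow> 'a \<Rightarrow> 'k) \<Rightarrow> ('b \<Rightarrow> 'b \<Rightarrow> 'k) \<Rightarrow> ('a \<Rightarrow> 'b) \<Rightarrow> 'b \<Rightarrow> 'a"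
  where "bounded_adjoint ipX ipY F y = (THE x. \<forall>u. ipX x u = ipY y (F u))"

(* D(B^k) *)
definition dom_pow :: "'a set \<Rightarrow> ('a \<Rightarrow> 'a) \<Rightarrow> nat \<Rightarrow> 'a set"
  where "dom_pow D B k = {x. \<forall>j<k. (B ^^ j) x \<in> D}"

(* The norm of D(B^k). *)
definition pow_norm :: "('a::real_normed_vector \<Rightarrow> 'a) \<Rightarrow> nat \<Rightarrow> 'a \<Rightarrow> real"
  where "pow_norm B k x = (if k = 0 then norm x else sqrt ((norm ((B ^^ k) x))\<^sup>2 + (norm x)\<^sup>2))"

(* The Hilbert space (sc', ip'), with canonical map i, is a completion of the space D with scalar
   product ipD. *)
definition hilbert_completion ::
  "('k::rc_field \<Rightarrow> 'a::plus \<Rightarrow> 'a) \<Rightarrow> 'a set \<Rightarrow> ('a \<Rightarrow> 'a \<Rightarrow> 'k) \<Rightarrow>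
   ('k \<Rightarrow> 'b::{real_inner,complete_space} \<Rightarrow> 'b) \<Rightarrow> ('b \<Rightarrow> 'b \<Rightarrow> 'k) \<Rightarrow> ('a \<Rightarrow> 'b) \<Rightarrow> bool"
  where "hilbert_completion sc D ipD sc' ip' i \<longleftrightarrow>
    hilbert_space sc' ip' \<and> klinear_on sc sc' D i \<and>
    (\<forall>x\<in>D. \<forall>y\<in>D. ip' (i x) (i y) = ipD x y) \<and> closure (i ` D) = UNIV"

(* The bounded extension of T : D \<rightarrow> Y to the space in which D is densely embedded by i. *)
definition bounded_ext ::
  "('a \<Rightarrow> 'b::real_normed_vector) \<Rightarrow> 'a set \<Rightarrow> ('a \<Rightarrow> 'c::real_normed_vector) \<Rightarrow> 'b \<Rightarrow> 'c"
  where "bounded_ext i D T = (THE F. bounded_linear F \<and> (\<forall>x\<in>D. F (i x) = T x))"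

end

theory Submission
  imports Defs
begin

text \<open>
  Write \<open>S\<close> for the square root \<open>B\<^sub>C\<close> of \<open>B\<^sup>2 + C1 C2\<close> and \<open>C = C1 + C2\<close>. In the coordinates
  \<open>u = Sbar \<phi>\<close>, \<open>v = \<psi> + C2bar \<phi>\<close> the energy product becomes the product of \<open>H\<^sub>0 \<times> H\<^sub>0\<close>, and the wave
  operator becomes \<open>(u, v) \<mapsto> (S v, C v - S u)\<close> on \<open>D(S) \<times> D(S)\<close>, where \<open>C\<close> is skew and commutes with
  \<open>S\<close>. The trace \<open>\<tau>\<close> becomes an operator \<open>T\<close> on \<open>D(S)\<close> that is bounded for the graph norm.

  The parameter \<open>\<lambda>\<close> in the definition of the extension is an artefact of the description: with
  \<open>q = (S\<^sup>2 - \<lambda> C + \<lambda>\<^sup>2)\<^sup>-\<^sup>1 T\<^sup>* z'\<close> one has \<open>G \<lambda> z' = S q\<close>, and the formulas of the theorem say exactly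
  that the operator maps \<open>(u, v, z)\<close> to \<open>(S v - T\<^sup>* z', C v - S u, z')\<close>, read in the dual space of \<open>D(S)\<close>,
  under the constraint that the regularised trace of \<open>u\<close> is \<open>\<Theta> z\<close> (\<open>coupled.W_explicit\<close> and
  \<open>wave_trace.extension_iff\<close>). In this form the proof has four steps.

  \<^item> The operator is skew-symmetric: after regularising the test vectors by \<open>J \<nu>\<close> all terms cancel
  identically except the trace terms, and these cancel in the limit by the constraint
  (\<open>coupled.W_skew\<close>).
  \<^item> For every real \<open>\<mu> \<noteq> 0\<close> the operator minus \<open>\<mu>\<close> is onto. Eliminating \<open>u\<close> and \<open>v\<close> leaves an equation
  for \<open>z'\<close> whose quadratic form is \<open>\<langle>\<Theta> z', z'\<rangle>\<close> plus a multiple of the energy of \<open>q\<close>. This form is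
  coercive because \<open>(w, z) \<mapsto> T w - \<Theta> z\<close> is onto the point space; uniform boundedness turns
  surjectivity into an estimate (\<open>coupled.range_coercive\<close>, \<open>coupled.point_equation\<close>). Skew-symmetry
  and the two surjectivities for \<open>\<mu> = 1\<close> and \<open>\<mu> = - 1\<close> identify the adjoint, and this argument is
  valid in the space with weight \<open>\<Theta>\<close>, whose norm may be incomplete (\<open>coupled.W_maximal\<close>).
  \<^item> The triples with \<open>u, v \<in> D(S)\<close> and \<open>T u = \<Theta> z\<close> are dense, since a functional that vanishes on them
  has the form \<open>\<langle>\<omega>, T u - \<Theta> z\<rangle>\<close>, and \<open>\<omega> \<circ> T\<close> is bounded for the norm of \<open>H\<^sub>0\<close> only if \<open>\<omega> = 0\<close>
  (\<open>coupled.dense_constraint\<close>). The same roughness of \<open>T\<close> makes the operator single-valued.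
  \<^item> The passage to coordinates needs that \<open>S\<close> has the domain of \<open>B\<close> and commutes with \<open>C1\<close> and \<open>C2\<close>,
  although only commutation with \<open>S\<^sup>2\<close> is given. This is a theorem about positive square roots
  (\<open>self_adj.positive_sqrt_commute\<close>), proved here without spectral theory.

  All operators commute with scalars, so identities between scalar products follow from their real
  parts, and the analysis takes place in real Hilbert spaces.
\<close>

section \<open>Representation and extension theorems in Hilbert spaces\<close>

text \<open>An operator is a total function together with the set on which its values count; linearity is
  required on that set only.\<close>

definition lin_on :: "'a::real_vector set \<Rightarrow> ('a \<Rightarrow> 'b::real_vector) \<Rightarrow> bool"
  where "lin_on X f \<longleftrightarrow> subspace X \<and> (\<forall>x\<in>X. \<forall>y\<in>X. f (x + y) = f x + f y) \<and>
    (\<forall>r. \<forall>x\<in>X. f (r *\<^sub>R x) = r *\<^sub>R f x)"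

lemma lin_onD:
  assumes "lin_on X f"
  shows "subspace X" "x \<in> X \<Longrightarrow> y \<in> X \<Longrightarrow> f (x + y) = f x + f y"
    "x \<in> X \<Longrightarrow> f (r *\<^sub>R x) = r *\<^sub>R f x" "x \<in> X \<Longrightarrow> f (- x) = - f x"
    "x \<in> X \<Longrightarrow> y \<in> X \<Longrightarrow> f (x - y) = f x - f y" "f 0 = 0"
proof -
  show sub: "subspace X" and add: "x \<in> X \<Longrightarrow> y \<in> X \<Longrightarrow> f (x + y) = f x + f y"
    and sc: "x \<in> X \<Longrightarrow> f (r *\<^sub>R x) = r *\<^sub>R f x" for x y r
    using assms by (auto simp: lin_on_def)
  show neg: "x \<in> X \<Longrightarrow> f (- x) = - f x" for x
    using sc[of x "- 1"] by simp
  show "x \<in> X \<Longrightarrow> y \<in> X \<Longrightarrow> f (x - y) = f x - f y"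
    using add[of x "- y"] neg[of y] subspace_neg[OF sub, of y] by simp
  show "f 0 = 0"
    using sc[of 0 0] subspace_0[OF sub] by simp
qed

lemma lin_onI:
  assumes "subspace X" "\<And>x y. x \<in> X \<Longrightarrow> y \<in> X \<Longrightarrow> f (x + y) = f x + f y"
    "\<And>x r. x \<in> X \<Longrightarrow> f (r *\<^sub>R x) = r *\<^sub>R f x"
  shows "lin_on X f"
  using assms by (auto simp: lin_on_def)

lemma linear_imp_lin_on: "linear f \<Longrightarrow> lin_on UNIV f"
  by (simp add: lin_on_def linear_add linear_scale)

lemma bounded_linearI_lin_on:
  assumes "lin_on UNIV f" "\<And>x. norm (f x) \<le> c * norm x"
  shows "bounded_linear f"
  using lin_onD[OF assms(1)] assms(2)
  by (intro bounded_linear_intro[of f c]) (auto simp: mult.commute)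

lemma inverse_Suc_mono: "m \<le> n \<Longrightarrow> inverse (real (Suc n)) \<le> inverse (real (Suc m))"
  by (simp add: field_simps)

text \<open>Nonnegative symmetric forms stand in for inner products where completeness fails: the form
  \<open>\<langle>\<Theta> x, y\<rangle>\<close> gives the point space a norm that is complete only if \<open>\<Theta>\<close> is invertible.\<close>

locale nonneg_form =
  fixes b :: "'v::real_vector \<Rightarrow> 'v \<Rightarrow> real"
  assumes sym: "b x y = b y x"
    and add_left: "b (x + y) z = b x z + b y z"
    and scale_left: "b (r *\<^sub>R x) z = r * b x z"
    and nonneg: "0 \<le> b x x"
begin

lemma add_right: "b z (x + y) = b z x + b z y"
  using add_left sym by metis

lemma scale_right: "b z (r *\<^sub>R x) = r * b z x"
  using scale_left sym by metis

lemma minus_left: "b (- x) z = - b x z"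
  using scale_left[of "-1" x z] by simp

lemma minus_right: "b z (- x) = - b z x"
  using minus_left sym by metis

lemma diff_left: "b (x - y) z = b x z - b y z"
  using add_left[of x "- y" z] minus_left by simp

lemma diff_right: "b z (x - y) = b z x - b z y"
  using diff_left sym by metis

lemmas expand = add_left add_right scale_left scale_right minus_left minus_right diff_left diff_right

lemma discriminant:
  fixes \<epsilon> \<delta> \<beta> :: real
  assumes "\<And>t. 0 \<le> \<epsilon> + 2 * t * \<delta> + t\<^sup>2 * \<beta>" "0 \<le> \<beta>"
  shows "\<delta>\<^sup>2 \<le> \<epsilon> * \<beta>"
proof (cases "\<beta> = 0")
  case True
  have "\<delta> = 0"
  proof (rule ccontr)
    assume "\<delta> \<noteq> 0"
    then show False
      using assms(1)[of "- (\<epsilon> + 1) / (2 * \<delta>)"] True by (simp add: field_simps)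
  qed
  then show ?thesis using True by simp
next
  case False
  then have "\<beta> > 0" using assms(2) by simp
  then show ?thesis
    using assms(1)[of "- \<delta> / \<beta>"] by (simp add: field_simps power2_eq_square)
qed

lemma cauchy_schwarz: "(b x y)\<^sup>2 \<le> b x x * b y y"
proof (rule discriminant)
  fix t
  show "0 \<le> b x x + 2 * t * b x y + t\<^sup>2 * b y y"
    using nonneg[of "x + t *\<^sub>R y"] sym[of y x]
    by (simp add: expand power2_eq_square algebra_simps)
qed (rule nonneg)

text \<open>The sequence minimises \<open>b x x - 2 * l x\<close> over \<open>X\<close> up to \<open>1 / (n + 1)\<close>. Varying in the direction
  \<open>w\<close> shows that \<open>s n\<close> represents \<open>l\<close> up to an error of order \<open>(n + 1)\<^sup>-\<^sup>1\<^sup>/\<^sup>2\<close>, and this error estimate,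
  applied to \<open>w = s m - s n\<close>, makes the sequence Cauchy. This is the common core of the Riesz
  representation and of the density criterion below.\<close>

lemma minimizing_sequence:
  assumes X: "lin_on X l" and bnd: "\<And>x. x \<in> X \<Longrightarrow> (l x)\<^sup>2 \<le> c * b x x"
  obtains s :: "nat \<Rightarrow> 'v" where "\<And>n. s n \<in> X"
    "\<And>n w. w \<in> X \<Longrightarrow> (b (s n) w - l w)\<^sup>2 \<le> inverse (real (Suc n)) * b w w"
    "\<And>m n. b (s m - s n) (s m - s n) \<le> 2 * (inverse (real (Suc m)) + inverse (real (Suc n)))"
proof -
  note l = lin_onD[OF X]
  define F where "F x = b x x - 2 * l x" for x
  have lower: "- \<bar>c\<bar> \<le> F x" if "x \<in> X" for x
  proof -
    have "(l x)\<^sup>2 \<le> \<bar>c\<bar> * b x x"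
      using order_trans[OF bnd[OF that] mult_right_mono[OF abs_ge_self nonneg]] .
    then have "(2 * l x)\<^sup>2 \<le> (\<bar>c\<bar> + b x x)\<^sup>2"
      using zero_le_power2[of "\<bar>c\<bar> - b x x"] by (simp add: power2_eq_square algebra_simps)
    then have "2 * l x \<le> \<bar>c\<bar> + b x x"
      by (rule power2_le_imp_le) (use nonneg[of x] in auto)
    then show ?thesis by (simp add: F_def)
  qed
  have bdd: "bdd_below (F ` X)" using lower by (auto intro!: bdd_belowI2)
  define I where "I = Inf (F ` X)"
  have ne: "F ` X \<noteq> {}" using subspace_0[OF l(1)] by auto
  have "\<exists>x\<in>X. F x < I + inverse (real (Suc n))" for n
    using cInf_lessD[OF ne, of "I + inverse (real (Suc n))"] by (auto simp: I_def)
  then obtain s where sX: "\<And>n. s n \<in> X" and sF: "\<And>n. F (s n) < I + inverse (real (Suc n))"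
    by metis
  have I: "I \<le> F x" if "x \<in> X" for x
    unfolding I_def using bdd that by (auto intro: cInf_lower)
  have var: "(b (s n) w - l w)\<^sup>2 \<le> inverse (real (Suc n)) * b w w" if w: "w \<in> X" for n w
  proof (rule discriminant)
    fix t
    have "s n + t *\<^sub>R w \<in> X"
      using l(1) sX w by (simp add: subspace_add subspace_scale)
    from I[OF this] have "I \<le> F (s n) + 2 * t * (b (s n) w - l w) + t\<^sup>2 * b w w"
      using sym[of w "s n"] sX w l(1)
      by (simp add: F_def expand l(2,3) subspace_scale power2_eq_square algebra_simps)
    then show "0 \<le> inverse (real (Suc n)) + 2 * t * (b (s n) w - l w) + t\<^sup>2 * b w w"
      using sF[of n] by linarith
  qed (rule nonneg)
  have "b (s m - s n) (s m - s n) \<le> 2 * (inverse (real (Suc m)) + inverse (real (Suc n)))" for m n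
  proof -
    define w where "w = s m - s n"
    define p where "p = b (s m) w - l w"
    define q where "q = b (s n) w - l w"
    have w: "w \<in> X" using sX l(1) by (simp add: w_def subspace_diff)
    have bw: "b w w = p - q" by (simp add: p_def q_def w_def expand)
    have "(p - q)\<^sup>2 \<le> 2 * (p\<^sup>2 + q\<^sup>2)"
      using zero_le_power2[of "p + q"] by (simp add: power2_eq_square algebra_simps)
    also have "\<dots> \<le> 2 * (inverse (real (Suc m)) + inverse (real (Suc n))) * b w w"
      using var[OF w, of m] var[OF w, of n] by (simp add: p_def q_def algebra_simps)
    finally have "b w w * b w w \<le> 2 * (inverse (real (Suc m)) + inverse (real (Suc n))) * b w w"
      by (simp add: bw power2_eq_square)
    then show ?thesis
      unfolding w_def[symmetric] using nonneg[of w] mult_right_le_imp_le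
      by (cases "b w w = 0") auto
  qed
  then show ?thesis using that sX var by blast
qed

text \<open>Without completeness, density of a subspace is still detected by functionals: the limit of
  \<open>b (z - s n)\<close> along a minimising sequence \<open>s\<close> in \<open>N\<close> for \<open>b z\<close> is a functional that vanishes
  on \<open>N\<close>, and its value at \<open>z\<close> is the squared distance from \<open>z\<close> to \<open>N\<close>.\<close>

lemma approx_if_functionals_vanish:
  assumes N: "subspace N"
    and van: "\<And>f. linear f \<Longrightarrow> \<exists>c. \<forall>z. (f z)\<^sup>2 \<le> c * b z z \<Longrightarrow> \<forall>n\<in>N. f n = 0 \<Longrightarrow> f z = (0::real)"
    and e: "e > 0"
  shows "\<exists>n\<in>N. b (z - n) (z - n) < e"
proof -
  have lN: "lin_on N (b z)" using N by (auto simp: lin_on_def expand)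
  obtain s where sN: "\<And>n. s n \<in> N"
    and var: "\<And>n w. w \<in> N \<Longrightarrow> (b (s n) w - b z w)\<^sup>2 \<le> inverse (real (Suc n)) * b w w"
    and cau: "\<And>m n. b (s m - s n) (s m - s n) \<le> 2 * (inverse (real (Suc m)) + inverse (real (Suc n)))"
    using minimizing_sequence[OF lN] cauchy_schwarz by blast
  have cau4: "b (s m - s n) (s m - s n) \<le> 4 * inverse (real (Suc m))" if "m \<le> n" for m n
    using cau[of m n] inverse_Suc_mono[OF that] by argo
  have cauy: "Cauchy (\<lambda>n. b (z - s n) y)" for y
  proof (rule CauchyI')
    fix \<epsilon> :: real assume \<epsilon>: "\<epsilon> > 0"
    obtain M where M: "inverse (real (Suc M)) < \<epsilon>\<^sup>2 / (4 * (b y y + 1))"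
      using reals_Archimedean[of "\<epsilon>\<^sup>2 / (4 * (b y y + 1))"] \<epsilon> nonneg[of y] by auto
    have "dist (b (z - s m) y) (b (z - s n) y) < \<epsilon>" if "M \<le> m" "m < n" for m n
    proof -
      have "(b (s m - s n) y)\<^sup>2 \<le> 4 * inverse (real (Suc m)) * b y y"
        using order_trans[OF cauchy_schwarz mult_right_mono[OF cau4[OF less_imp_le[OF that(2)]] nonneg]] .
      also have "\<dots> \<le> 4 * inverse (real (Suc M)) * (b y y + 1)"
        using that(1) nonneg[of y] by (intro mult_mono) (auto simp: field_simps)
      also have "\<dots> < \<epsilon>\<^sup>2" using M nonneg[of y] by (simp add: field_simps)
      finally have "\<bar>b (s m - s n) y\<bar> < \<epsilon>"
        using \<epsilon> by (metis abs_of_pos power2_abs power2_less_imp_less abs_ge_zero less_imp_le)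
      then show ?thesis by (simp add: dist_real_def expand abs_minus_commute)
    qed
    then show "\<exists>M. \<forall>m\<ge>M. \<forall>n>m. dist (b (z - s m) y) (b (z - s n) y) < \<epsilon>" by blast
  qed
  define f where "f y = lim (\<lambda>n. b (z - s n) y)" for y
  have f: "(\<lambda>n. b (z - s n) y) \<longlonglongrightarrow> f y" for y
    using cauy[of y] unfolding f_def by (metis Cauchy_convergent convergent_LIMSEQ_iff)
  have lin: "linear f"
  proof (rule linearI)
    show "f (x + y) = f x + f y" for x y
      using tendsto_add[OF f[of x] f[of y]] f[of "x + y"]
      by (simp add: add_right LIMSEQ_unique)
    show "f (r *\<^sub>R x) = r *\<^sub>R f x" for r x
      using tendsto_mult_left[OF f[of x], of r] f[of "r *\<^sub>R x"]
      by (simp add: scale_right LIMSEQ_unique)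
  qed
  have bounded: "\<exists>c. \<forall>n. b (z - s n) (z - s n) \<le> c"
  proof (intro exI allI)
    fix n
    let ?x = "z - s 0" and ?y = "s 0 - s n"
    have "b (?x + ?y) (?x + ?y) \<le> 2 * b ?x ?x + 2 * b ?y ?y"
      using nonneg[of "?x - ?y"] by (simp add: expand)
    then show "b (z - s n) (z - s n) \<le> 2 * b ?x ?x + 8"
      using cau4[of 0 n] by simp
  qed
  then obtain c where c: "\<And>n. b (z - s n) (z - s n) \<le> c" by blast
  have bnd: "(f y)\<^sup>2 \<le> c * b y y" for y
  proof (rule LIMSEQ_le_const2)
    show "(\<lambda>n. (b (z - s n) y)\<^sup>2) \<longlonglongrightarrow> (f y)\<^sup>2" by (intro tendsto_intros f)
    show "\<exists>N. \<forall>n\<ge>N. (b (z - s n) y)\<^sup>2 \<le> c * b y y"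
      using order_trans[OF cauchy_schwarz mult_right_mono[OF c nonneg]] by blast
  qed
  have zero: "f w = 0" if w: "w \<in> N" for w
  proof -
    have lim0: "(\<lambda>n. inverse (real (Suc n)) * b w w) \<longlonglongrightarrow> 0"
      using tendsto_mult_right[OF LIMSEQ_inverse_real_of_nat] by fastforce
    have "(\<lambda>n. (b (s n) w - b z w)\<^sup>2) \<longlonglongrightarrow> 0"
      by (rule tendsto_sandwich[OF _ _ tendsto_const lim0]) (use var[OF w] in auto)
    then have "(\<lambda>n. (b (z - s n) w)\<^sup>2) \<longlonglongrightarrow> 0"
      by (simp add: diff_left power2_commute)
    moreover have "(\<lambda>n. (b (z - s n) w)\<^sup>2) \<longlonglongrightarrow> (f w)\<^sup>2" by (intro tendsto_intros f)
    ultimately have "(f w)\<^sup>2 = 0" using LIMSEQ_unique by blast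
    then show ?thesis by simp
  qed
  have fz: "f z = 0" using van[OF lin] bnd zero by blast
  have lim1: "(\<lambda>n. b (z - s n) (z - s m)) \<longlonglongrightarrow> 0" for m
    using tendsto_diff[OF f[of z] f[of "s m"]] fz zero[OF sN] by (simp add: diff_right)
  obtain c' where c': "c' > 0" "\<And>n. b (z - s n) (z - s n) \<le> c'"
  proof (rule that[of "max c 1"])
    show "b (z - s n) (z - s n) \<le> max c 1" for n using c[of n] by simp
  qed simp
  obtain m where m: "inverse (real (Suc m)) < e\<^sup>2 / (16 * c')"
    using reals_Archimedean[of "e\<^sup>2 / (16 * c')"] e c'(1) by auto
  have "eventually (\<lambda>n. b (z - s n) (z - s m) < e / 2) sequentially"
    using order_tendstoD(2)[OF lim1[of m], of "e / 2"] e by simp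
  then obtain n0 where "\<forall>n\<ge>n0. b (z - s n) (z - s m) < e / 2"
    unfolding eventually_sequentially by blast
  then obtain n where n: "m \<le> n" "b (z - s n) (z - s m) < e / 2"
    using max.cobounded1[of n0 m] max.cobounded2[of m n0] by (metis max.commute)
  have "(b (z - s n) (s m - s n))\<^sup>2 \<le> c' * (4 * inverse (real (Suc m)))"
    using mult_mono[OF c'(2)[of n] cau4[OF n(1)] less_imp_le[OF c'(1)] nonneg]
      cauchy_schwarz[of "z - s n" "s m - s n"] by linarith
  also have "\<dots> < (e / 2)\<^sup>2" using m c'(1) by (simp add: field_simps power2_eq_square)
  finally have "b (z - s n) (s m - s n) < e / 2"
    by (rule power2_less_imp_less) (use e in simp)
  then have "b (z - s n) (z - s n) < e" using n(2) by (simp add: expand)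
  then show ?thesis using sN by blast
qed

end

lemma nonneg_form_inner: "nonneg_form (inner :: 'a::real_inner \<Rightarrow> 'a \<Rightarrow> real)"
  by standard (rule inner_commute inner_add_left inner_scaleR_left inner_ge_zero)+

text \<open>Riesz representation on an arbitrary subspace: the representing vector is the limit of the
  minimising sequence and lies in the closure.\<close>

lemma riesz_subspace:
  fixes l :: "'a::{real_inner,complete_space} \<Rightarrow> real"
  assumes l: "lin_on X l" and bnd: "\<And>x. x \<in> X \<Longrightarrow> \<bar>l x\<bar> \<le> c * norm x"
  obtains p where "p \<in> closure X" "\<And>w. w \<in> X \<Longrightarrow> inner p w = l w"
proof -
  interpret nonneg_form "inner :: 'a \<Rightarrow> 'a \<Rightarrow> real" by (rule nonneg_form_inner)
  have bnd2: "(l x)\<^sup>2 \<le> c\<^sup>2 * inner x x" if "x \<in> X" for x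
    using power_mono[OF bnd[OF that], of 2] by (simp add: power_mult_distrib power2_norm_eq_inner)
  obtain s where sX: "\<And>n. s n \<in> X"
    and var: "\<And>n w. w \<in> X \<Longrightarrow> (inner (s n) w - l w)\<^sup>2 \<le> inverse (real (Suc n)) * inner w w"
    and cau: "\<And>m n. inner (s m - s n) (s m - s n) \<le> 2 * (inverse (real (Suc m)) + inverse (real (Suc n)))"
    using minimizing_sequence[OF l bnd2] by blast
  have "Cauchy s"
  proof (rule CauchyI')
    fix \<epsilon> :: real assume \<epsilon>: "\<epsilon> > 0"
    obtain M where M: "inverse (real (Suc M)) < \<epsilon>\<^sup>2 / 4"
      using reals_Archimedean[of "\<epsilon>\<^sup>2 / 4"] \<epsilon> by auto
    have "dist (s m) (s n) < \<epsilon>" if "M \<le> m" "m < n" for m n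
    proof -
      have "(norm (s m - s n))\<^sup>2 \<le> 4 * inverse (real (Suc M))"
        using cau[of m n] inverse_Suc_mono[OF that(1)]
          inverse_Suc_mono[OF order_trans[OF that(1) less_imp_le[OF that(2)]]]
        unfolding power2_norm_eq_inner by argo
      also have "\<dots> < \<epsilon>\<^sup>2" using M by simp
      finally show ?thesis using \<epsilon> by (simp add: dist_norm power2_less_imp_less)
    qed
    then show "\<exists>M. \<forall>m\<ge>M. \<forall>n>m. dist (s m) (s n) < \<epsilon>" by blast
  qed
  then obtain p where p: "s \<longlonglongrightarrow> p" using Cauchy_convergent convergentD by blast
  have "inner p w = l w" if w: "w \<in> X" for w
  proof -
    have lim0: "(\<lambda>n. inverse (real (Suc n)) * inner w w) \<longlonglongrightarrow> 0"
      using tendsto_mult_right[OF LIMSEQ_inverse_real_of_nat] by fastforce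
    have "(\<lambda>n. (inner (s n) w - l w)\<^sup>2) \<longlonglongrightarrow> 0"
      by (rule tendsto_sandwich[OF _ _ tendsto_const lim0]) (use var[OF w] in auto)
    moreover have "(\<lambda>n. (inner (s n) w - l w)\<^sup>2) \<longlonglongrightarrow> (inner p w - l w)\<^sup>2"
      by (intro tendsto_intros p)
    ultimately have "(inner p w - l w)\<^sup>2 = 0" using LIMSEQ_unique by blast
    then show ?thesis by simp
  qed
  moreover have "p \<in> closure X" using sX p closure_sequential by blast
  ultimately show ?thesis using that by blast
qed

lemma dense_subspaceI:
  fixes X :: "'a::{real_inner,complete_space} set"
  assumes X: "subspace X" and orth: "\<And>x. (\<And>w. w \<in> X \<Longrightarrow> inner x w = 0) \<Longrightarrow> x = 0"
  shows "closure X = UNIV"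
proof (intro set_eqI iffI UNIV_I)
  fix z
  have "lin_on X (inner z)" using X by (auto simp: lin_on_def inner_add_right)
  then obtain p where p: "p \<in> closure X" "\<And>w. w \<in> X \<Longrightarrow> inner p w = inner z w"
    using riesz_subspace[of X "inner z" "norm z"] Cauchy_Schwarz_ineq2 by blast
  have "z - p = 0" by (rule orth) (simp add: inner_diff_left p)
  then show "z \<in> closure X" using p by simp
qed

lemma dense_inner_eq:
  fixes X :: "'a::real_inner set"
  assumes "closure X = UNIV" "\<And>w. w \<in> X \<Longrightarrow> inner x w = inner y w"
  shows "x = y"
proof -
  have "closed {w. inner (x - y) w = 0}"
    by (intro closed_Collect_eq continuous_intros)
  then have "closure X \<subseteq> {w. inner (x - y) w = 0}"
    using assms(2) by (intro closure_minimal) (auto simp: inner_diff_left)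
  then have "inner (x - y) (x - y) = 0" using assms(1) by blast
  then show ?thesis by simp
qed

text \<open>Lax--Milgram on a closed subspace \<open>X\<close>, where \<open>A x\<close> enters through its pairings with \<open>X\<close> and may
  itself lie outside \<open>X\<close>. In the application \<open>X\<close> is the graph of an unbounded operator. The solution is the fixed point of the contraction
  \<open>x \<mapsto> P (x - \<rho> *\<^sub>R (A x - p))\<close>, where \<open>P\<close> is the orthogonal projection onto \<open>X\<close> and
  \<open>\<rho> = a / K\<^sup>2\<close>.\<close>

lemma lax_milgram:
  fixes A :: "'a::{real_inner,complete_space} \<Rightarrow> 'a"
  assumes A: "lin_on X A" and X: "closed X"
    and bnd: "\<And>x. x \<in> X \<Longrightarrow> norm (A x) \<le> K * norm x"
    and a: "a > 0" and coer: "\<And>x. x \<in> X \<Longrightarrow> a * (norm x)\<^sup>2 \<le> inner (A x) x"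
  obtains q where "q \<in> X" "\<And>w. w \<in> X \<Longrightarrow> inner (A q) w = inner p w"
proof -
  note A' = lin_onD[OF A]
  \<comment> \<open>A bound strictly above \<open>a\<close> keeps the contraction constant \<open>sqrt (1 - (a / K')\<^sup>2)\<close> positive.\<close>
  define K' where "K' = max K a + 1"
  have K': "K' > 0" "K' > a" "K \<le> K'" using a by (auto simp: K'_def)
  have bnd': "norm (A x) \<le> K' * norm x" if "x \<in> X" for x
    using bnd[OF that] K'(3) by (meson mult_right_mono norm_ge_zero order_trans)
  have "\<exists>x\<in>X. \<forall>w\<in>X. inner x w = inner z w" for z
  proof -
    have "lin_on X (inner z)" using A'(1) by (auto simp: lin_on_def inner_add_right)
    then obtain x where "x \<in> closure X" "\<And>w. w \<in> X \<Longrightarrow> inner x w = inner z w"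
      using riesz_subspace[of X "inner z" "norm z"] Cauchy_Schwarz_ineq2 by blast
    then show ?thesis using X by (auto simp: closure_closed)
  qed
  then obtain P where P: "\<And>z. P z \<in> X" "\<And>z w. w \<in> X \<Longrightarrow> inner (P z) w = inner z w" by metis
  define \<rho> where "\<rho> = a / K'\<^sup>2"
  define f where "f x = P (x - \<rho> *\<^sub>R (A x - p))" for x
  define k where "k = sqrt (1 - (a / K')\<^sup>2)"
  have aK: "0 < (a / K')\<^sup>2" "(a / K')\<^sup>2 < 1"
    using a K' by (auto simp: power_less_one_iff abs_square_less_1)
  have k: "0 \<le> k" "k < 1" "k\<^sup>2 = 1 - (a / K')\<^sup>2" using aK by (auto simp: k_def)
  have contr: "dist (f x) (f y) \<le> k * dist x y" if x: "x \<in> X" and y: "y \<in> X" for x y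
  proof -
    define d where "d = x - y"
    define g where "g = d - \<rho> *\<^sub>R A d"
    have d: "d \<in> X" using x y A'(1) by (simp add: d_def subspace_diff)
    have "f x - f y \<in> X" using P A'(1) by (simp add: f_def subspace_diff)
    then have "inner (f x - f y) (f x - f y) =
        inner ((x - \<rho> *\<^sub>R (A x - p)) - (y - \<rho> *\<^sub>R (A y - p))) (f x - f y)"
      unfolding f_def inner_diff_left[of "P _"] by (simp add: P(2) inner_diff_left)
    also have "(x - \<rho> *\<^sub>R (A x - p)) - (y - \<rho> *\<^sub>R (A y - p)) = g"
      using A'(5)[OF x y] by (simp add: g_def d_def scaleR_diff_right)
    also have "inner g (f x - f y) \<le> norm g * norm (f x - f y)" by (rule norm_cauchy_schwarz)
    finally have "norm (f x - f y) * norm (f x - f y) \<le> norm g * norm (f x - f y)"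
      by (simp flip: power2_norm_eq_inner power2_eq_square)
    then have 1: "norm (f x - f y) \<le> norm g"
      by (metis mult_right_le_imp_le norm_ge_zero order_le_less)
    have "(norm g)\<^sup>2 = (norm d)\<^sup>2 - 2 * \<rho> * inner (A d) d + \<rho>\<^sup>2 * (norm (A d))\<^sup>2"
      unfolding g_def power2_norm_eq_inner
      by (simp add: inner_diff_left inner_diff_right inner_commute algebra_simps power2_eq_square)
    also have "\<dots> \<le> (norm d)\<^sup>2 - 2 * \<rho> * (a * (norm d)\<^sup>2) + \<rho>\<^sup>2 * (K' * norm d)\<^sup>2"
    proof -
      have "\<rho> * (a * (norm d)\<^sup>2) \<le> \<rho> * inner (A d) d"
        using coer[OF d] a by (intro mult_left_mono) (auto simp: \<rho>_def)
      moreover have "\<rho>\<^sup>2 * (norm (A d))\<^sup>2 \<le> \<rho>\<^sup>2 * (K' * norm d)\<^sup>2"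
        using bnd'[OF d] by (intro mult_left_mono power_mono) auto
      ultimately show ?thesis by linarith
    qed
    also have "\<dots> = k\<^sup>2 * (norm d)\<^sup>2"
      unfolding k(3) using K'(1) by (simp add: \<rho>_def field_simps power2_eq_square)
    finally have "norm g \<le> k * norm d"
      using k(1) by (metis power_mult_distrib power2_le_imp_le mult_nonneg_nonneg norm_ge_zero)
    then show ?thesis using 1 by (simp add: dist_norm d_def)
  qed
  have "\<exists>!x\<in>X. f x = x"
    by (rule Banach_fix[of X k]) (use X k contr A'(1) P subspace_0 in \<open>auto simp: complete_eq_closed f_def\<close>)
  then obtain q where q: "q \<in> X" "f q = q" by blast
  have "inner (A q) w = inner p w" if w: "w \<in> X" for w
  proof -
    have "inner q w = inner (q - \<rho> *\<^sub>R (A q - p)) w"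
      using P(2)[OF w, of "q - \<rho> *\<^sub>R (A q - p)"] q(2) by (simp add: f_def)
    then have "\<rho> * inner (A q - p) w = 0" by (simp add: inner_diff_left)
    then show ?thesis using a K' by (simp add: \<rho>_def inner_diff_left)
  qed
  then show ?thesis using that q by blast
qed

text \<open>Uniform boundedness by a gliding hump: at step \<open>n\<close> the current point is moved by at most \<open>3\<^sup>-\<^sup>n\<close>
  so that an operator of norm at least \<open>4\<^sup>n\<close> becomes large there, and the later moves cannot undo this.\<close>

lemma uniform_boundedness:
  fixes F :: "('a::{real_normed_vector,complete_space} \<Rightarrow> 'b::real_normed_vector) set"
  assumes F: "\<And>T. T \<in> F \<Longrightarrow> bounded_linear T"
    and pw: "\<And>x. \<exists>K. \<forall>T\<in>F. norm (T x) \<le> K"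
  obtains K where "\<And>T x. T \<in> F \<Longrightarrow> norm (T x) \<le> K * norm x"
proof (rule ccontr)
  assume "\<not> thesis"
  with that have neg: "\<exists>T\<in>F. \<exists>x. K * norm x < norm (T x)" for K
    by (metis not_less)
  have "\<exists>T\<in>F. 4 ^ n < onorm T" for n :: nat
  proof -
    obtain T x where T: "T \<in> F" "4 ^ n * norm x < norm (T x)" using neg by blast
    have "norm (T x) \<le> onorm T * norm x" using F[OF T(1)] by (rule onorm)
    then have "4 ^ n * norm x < onorm T * norm x" using T(2) by linarith
    then have "4 ^ n < onorm T" by (simp add: mult_less_cancel_right)
    then show ?thesis using T(1) by blast
  qed
  then obtain T where TF: "\<And>n::nat. T n \<in> F" and T4: "\<And>n::nat. 4 ^ n < onorm (T n)" by metis
  have lin: "bounded_linear (T n)" for n using F TF by blast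
  have pos: "onorm (T n) > 0" for n using T4[of n] by (meson less_trans zero_less_power zero_less_numeral)
  have ex: "\<exists>z. norm (z - y) \<le> (1/3) ^ n \<and> 2/3 * (1/3) ^ n * onorm (T n) \<le> norm (T n z)" for n y
  proof -
    have "\<exists>x. 2/3 * onorm (T n) * norm x < norm (T n x)"
    proof (rule ccontr)
      assume "\<not> ?thesis"
      then have "onorm (T n) \<le> 2/3 * onorm (T n)" using pos[of n] by (intro onorm_bound) (auto simp: not_less)
      then show False using pos[of n] by simp
    qed
    then obtain x where x: "2/3 * onorm (T n) * norm x < norm (T n x)" by blast
    interpret bounded_linear "T n" by (rule lin)
    have x0: "norm x > 0" using x pos[of n] by (cases "x = 0") auto
    define e where "e = ((1/3) ^ n / norm x) *\<^sub>R x"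
    have e: "norm e = (1/3) ^ n" using x0 by (simp add: e_def)
    have "(1/3) ^ n / norm x * (2/3 * onorm (T n) * norm x) \<le> (1/3) ^ n / norm x * norm (T n x)"
      using x by (intro mult_left_mono) auto
    then have Te: "2/3 * (1/3) ^ n * onorm (T n) \<le> norm (T n e)"
      using x0 by (simp add: e_def scaleR field_simps)
    have "2 * norm (T n e) = norm (T n (y + e) - T n (y - e))"
      by (simp add: add diff flip: scaleR_2)
    also have "\<dots> \<le> norm (T n (y + e)) + norm (T n (y - e))" by (rule norm_triangle_ineq4)
    finally have "norm (T n e) \<le> norm (T n (y + e)) \<or> norm (T n e) \<le> norm (T n (y - e))" by linarith
    then consider "2/3 * (1/3) ^ n * onorm (T n) \<le> norm (T n (y + e))"
      | "2/3 * (1/3) ^ n * onorm (T n) \<le> norm (T n (y - e))"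
      using Te by linarith
    then show ?thesis
    proof cases
      case 1
      with e show ?thesis by (intro exI[of _ "y + e"]) simp
    next
      case 2
      with e show ?thesis by (intro exI[of _ "y - e"]) simp
    qed
  qed
  define pick where "pick n y = (SOME z. norm (z - y) \<le> (1/3) ^ n \<and>
    2/3 * (1/3) ^ n * onorm (T n) \<le> norm (T n z))" for n y
  have pick: "norm (pick n y - y) \<le> (1/3) ^ n" "2/3 * (1/3) ^ n * onorm (T n) \<le> norm (T n (pick n y))"
    for n y using someI_ex[OF ex[of y n]] by (simp_all add: pick_def)
  define s where "s = rec_nat 0 pick"
  have s: "s (Suc n) = pick n (s n)" for n by (simp add: s_def)
  have tail: "norm (s (Suc (n + k)) - s (Suc n)) \<le> ((1/3) ^ n - (1/3) ^ (n + k)) / 2" for n k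
  proof (induction k)
    case (Suc k)
    have "norm (s (Suc (n + Suc k)) - s (Suc n)) \<le>
        norm (s (Suc (n + Suc k)) - s (Suc (n + k))) + norm (s (Suc (n + k)) - s (Suc n))"
      using norm_triangle_ineq[of "s (Suc (n + Suc k)) - s (Suc (n + k))" "s (Suc (n + k)) - s (Suc n)"]
      by simp
    also have "norm (s (Suc (n + Suc k)) - s (Suc (n + k))) \<le> (1/3) ^ (n + Suc k)"
      using pick(1)[of "n + Suc k" "s (n + Suc k)"] by (simp add: s)
    also have "(1/3) ^ (n + Suc k) = (1/3::real) ^ (n + k) / 3" by simp
    finally have step: "norm (s (Suc (n + Suc k)) - s (Suc n)) \<le>
        (1/3) ^ (n + k) / 3 + norm (s (Suc (n + k)) - s (Suc n))" by simp
    have "(1/3) ^ (n + Suc k) = (1/3::real) ^ (n + k) / 3" by simp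
    with step Suc.IH show ?case by argo
  qed simp
  have tail': "norm (s (Suc m) - s (Suc n)) \<le> (1/3) ^ n / 2" if "n \<le> m" for n m
  proof -
    have "norm (s (Suc m) - s (Suc n)) \<le> ((1/3) ^ n - (1/3) ^ m) / 2"
      using tail[of n "m - n"] that by simp
    moreover have "0 \<le> (1/3::real) ^ m" by simp
    ultimately show ?thesis by argo
  qed
  have "Cauchy (\<lambda>n. s (Suc n))"
  proof (rule CauchyI')
    fix e :: real assume "e > 0"
    then obtain M where M: "(1/3) ^ M < e" using real_arch_pow_inv[of e "1/3"] by auto
    have "dist (s (Suc m)) (s (Suc n)) < e" if "M \<le> m" "m < n" for m n
    proof -
      have "(1/3::real) ^ m \<le> (1/3) ^ M" using that by (intro power_decreasing) auto
      moreover have "dist (s (Suc m)) (s (Suc n)) \<le> (1/3) ^ m / 2"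
        using tail'[of m n] that(2) by (simp add: dist_norm norm_minus_commute)
      moreover have "0 \<le> (1/3::real) ^ m" by simp
      ultimately show ?thesis using M by argo
    qed
    then show "\<exists>M. \<forall>m\<ge>M. \<forall>n>m. dist (s (Suc m)) (s (Suc n)) < e" by blast
  qed
  then obtain x where x: "(\<lambda>n. s (Suc n)) \<longlonglongrightarrow> x" using Cauchy_convergent convergentD by blast
  have big: "(4/3) ^ n / 6 \<le> norm (T n x)" for n
  proof -
    interpret bounded_linear "T n" by (rule lin)
    have "norm (x - s (Suc n)) \<le> (1/3) ^ n / 2"
      by (rule LIMSEQ_le_const2[OF tendsto_norm[OF tendsto_diff[OF x tendsto_const]]])
        (use tail' in blast)
    then have "onorm (T n) * norm (x - s (Suc n)) \<le> onorm (T n) * ((1/3) ^ n / 2)"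
      using pos[of n] by (intro mult_left_mono) auto
    then have "norm (T n (x - s (Suc n))) \<le> onorm (T n) * ((1/3) ^ n / 2)"
      using onorm[OF lin, of n "x - s (Suc n)"] by linarith
    moreover have "norm (T n (s (Suc n))) \<le> norm (T n x) + norm (T n (x - s (Suc n)))"
      using norm_triangle_ineq4[of "T n x" "T n (x - s (Suc n))"] by (simp flip: diff)
    moreover have "4 ^ n * (1/3) ^ n \<le> onorm (T n) * (1/3::real) ^ n"
      using T4[of n] by (intro mult_right_mono) auto
    moreover have "4 ^ n * (1/3) ^ n = (4/3 :: real) ^ n" by (simp flip: power_mult_distrib)
    moreover have "2/3 * (onorm (T n) * (1/3) ^ n) \<le> norm (T n (s (Suc n)))"
      using pick(2)[of n "s n"] by (simp add: s mult.commute mult.left_commute)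
    ultimately show ?thesis by argo
  qed
  obtain K where K: "\<And>n. norm (T n x) \<le> K" using pw[of x] TF by blast
  obtain n where "6 * K < (4/3) ^ n" using real_arch_pow[of "4/3" "6 * K"] by auto
  then show False using big[of n] K[of n] by simp
qed

lemma dense_image_eq:
  fixes f g :: "'b::topological_space \<Rightarrow> 'c::t2_space"
  assumes "closure (i ` X) = UNIV" "continuous_on UNIV f" "continuous_on UNIV g"
    "\<And>x. x \<in> X \<Longrightarrow> f (i x) = g (i x)"
  shows "f y = g y"
proof -
  have "closure (i ` X) \<subseteq> {y. f y = g y}"
    using assms by (intro closure_minimal closed_Collect_eq) auto
  then show ?thesis using assms(1) by auto
qed

text \<open>The estimate \<open>norm (T x) \<le> c * norm (i x)\<close> makes \<open>i x \<mapsto> T x\<close> well defined and Lipschitz on the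
  dense set \<open>i ` X\<close>, so that it extends by uniform continuity; linearity and uniqueness pass to the
  limit.\<close>

lemma bounded_ext:
  fixes i :: "'a::real_vector \<Rightarrow> 'b::real_normed_vector" and T :: "'a \<Rightarrow> 'c::{real_normed_vector,complete_space}"
  assumes i: "lin_on X i" and dense: "closure (i ` X) = UNIV" and T: "lin_on X T"
    and bnd: "\<And>x. x \<in> X \<Longrightarrow> norm (T x) \<le> c * norm (i x)"
  shows bounded_linear_bounded_ext: "bounded_linear (bounded_ext i X T)"
    and bounded_ext_apply: "x \<in> X \<Longrightarrow> bounded_ext i X T (i x) = T x"
proof -
  note i' = lin_onD[OF i] and T' = lin_onD[OF T]
  define f where "f z = T (inv_into X i z)" for z
  have f: "f (i x) = T x" if x: "x \<in> X" for x
  proof -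
    let ?y = "inv_into X i (i x)"
    have y: "?y \<in> X" "i ?y = i x" using x by (auto simp: inv_into_into f_inv_into_f)
    then have "norm (T (?y - x)) \<le> 0"
      using bnd[of "?y - x"] x i'(5)[OF y(1) x] i'(1) by (simp add: subspace_diff)
    then show ?thesis using T'(5)[OF y(1) x] by (simp add: f_def)
  qed
  have "(\<bar>c\<bar>)-lipschitz_on (i ` X) f"
  proof (rule lipschitz_onI)
    fix y z assume "y \<in> i ` X" "z \<in> i ` X"
    then obtain u v where uv: "u \<in> X" "v \<in> X" "y = i u" "z = i v" by blast
    have "norm (T (u - v)) \<le> \<bar>c\<bar> * norm (i (u - v))"
      by (rule order_trans[OF bnd[OF subspace_diff[OF i'(1) uv(1,2)]]
            mult_right_mono[OF abs_ge_self norm_ge_zero]])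
    then show "dist (f y) (f z) \<le> \<bar>c\<bar> * dist y z"
      using uv by (simp add: dist_norm f i'(5) T'(5))
  qed simp
  then have "uniformly_continuous_on (i ` X) f" by (rule lipschitz_on_uniformly_continuous)
  then obtain g where g: "uniformly_continuous_on (closure (i ` X)) g" "\<And>y. y \<in> i ` X \<Longrightarrow> f y = g y"
    using uniformly_continuous_on_extension_on_closure by metis
  have cont: "continuous_on UNIV g"
    using uniformly_continuous_imp_continuous[OF g(1)] dense by simp
  have cont': "continuous_on UNIV (\<lambda>y. g (h y))" if "continuous_on UNIV h" for h :: "'b \<Rightarrow> 'b"
    using continuous_on_compose2[OF cont that] by simp
  have gi: "g (i x) = T x" if "x \<in> X" for x using f[OF that] g(2) that by simp
  have add1: "g (i x + y) = g (i x) + g y" if x: "x \<in> X" for x y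
  proof (rule dense_image_eq[OF dense, of "\<lambda>y. g (i x + y)" "\<lambda>y. g (i x) + g y"])
    show "g (i x + i y) = g (i x) + g (i y)" if "y \<in> X" for y
      using x that gi i'(2)[OF x that] T'(2)[OF x that] subspace_add[OF i'(1) x that] by metis
  qed (intro continuous_intros cont' cont)+
  have add: "g (x + y) = g x + g y" for x y
    by (rule dense_image_eq[OF dense, of "\<lambda>x. g (x + y)" "\<lambda>x. g x + g y"])
      (auto intro!: continuous_intros cont' cont add1)
  have scale: "g (r *\<^sub>R y) = r *\<^sub>R g y" for r y
  proof (rule dense_image_eq[OF dense, of "\<lambda>y. g (r *\<^sub>R y)" "\<lambda>y. r *\<^sub>R g y"])
    show "g (r *\<^sub>R i x) = r *\<^sub>R g (i x)" if "x \<in> X" for x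
      using gi i'(3)[OF that] T'(3)[OF that] subspace_scale[OF i'(1) that] that by metis
  qed (intro continuous_intros cont' cont)+
  have norm: "norm (g y) \<le> c * norm y" for y
  proof -
    have "closed {y. norm (g y) \<le> c * norm y}"
      by (intro closed_Collect_le continuous_intros cont)
    then have "closure (i ` X) \<subseteq> {y. norm (g y) \<le> c * norm y}"
      using bnd gi by (intro closure_minimal) auto
    then show ?thesis using dense by auto
  qed
  have bl: "bounded_linear g"
    using add scale norm by (intro bounded_linear_intro[of g c]) (auto simp: mult.commute)
  have "bounded_ext i X T = g"
    unfolding bounded_ext_def
  proof (rule the_equality)
    fix h assume h: "bounded_linear h \<and> (\<forall>x\<in>X. h (i x) = T x)"
    show "h = g"
      by (rule ext, rule dense_image_eq[OF dense, of h g])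
        (use h gi cont linear_continuous_on in auto)
  qed (use bl gi in auto)
  then show "bounded_linear (bounded_ext i X T)" "x \<in> X \<Longrightarrow> bounded_ext i X T (i x) = T x"
    using bl gi by auto
qed

section \<open>Unbounded self-adjoint operators\<close>

lemma norm_fst_snd_le:
  fixes z :: "'a::real_normed_vector \<times> 'b::real_normed_vector"
  shows "norm (fst z) \<le> norm z" "norm (snd z) \<le> norm z"
  by (cases z, simp add: norm_fst_le norm_snd_le)+

text \<open>The last condition says that the adjoint of \<open>S\<close>, including its domain, is \<open>S\<close>.\<close>

locale self_adj =
  fixes D :: "'a::{real_inner,complete_space} set" and S :: "'a \<Rightarrow> 'a"
  assumes lin: "lin_on D S" and dense: "closure D = UNIV"
    and adj: "(\<forall>w\<in>D. inner x (S w) = inner y w) \<longleftrightarrow> x \<in> D \<and> S x = y"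
begin

lemmas subspace_D = lin_onD(1)[OF lin]
lemmas S_simps = lin_onD(2-6)[OF lin]
lemmas D_closed = subspace_add[OF subspace_D] subspace_diff[OF subspace_D]
  subspace_scale[OF subspace_D] subspace_0[OF subspace_D] subspace_neg[OF subspace_D]

lemma in_dom: "(\<And>w. w \<in> D \<Longrightarrow> inner x (S w) = inner y w) \<Longrightarrow> x \<in> D"
  and eqI: "(\<And>w. w \<in> D \<Longrightarrow> inner x (S w) = inner y w) \<Longrightarrow> S x = y"
  using adj[of x y] by blast+

lemma sym: "x \<in> D \<Longrightarrow> y \<in> D \<Longrightarrow> inner (S x) y = inner x (S y)"
  using adj[of x "S x"] by simp

lemma closed_op:
  assumes "\<And>n. s n \<in> D" "s \<longlonglongrightarrow> x" "(\<lambda>n. S (s n)) \<longlonglongrightarrow> y"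
  shows "x \<in> D" "S x = y"
proof -
  have *: "inner x (S w) = inner y w" if w: "w \<in> D" for w
  proof (rule LIMSEQ_unique)
    show "(\<lambda>n. inner (s n) (S w)) \<longlonglongrightarrow> inner x (S w)" by (intro tendsto_intros assms)
    show "(\<lambda>n. inner (s n) (S w)) \<longlonglongrightarrow> inner y w"
      unfolding sym[OF assms(1) w, symmetric] by (intro tendsto_intros assms)
  qed
  show "x \<in> D" by (rule in_dom) (rule *)
  show "S x = y" by (rule eqI) (rule *)
qed

definition graph :: "('a \<times> 'a) set" where "graph = (\<lambda>x. (x, S x)) ` D"

lemma closed_graph: "closed graph"
  unfolding closed_sequential_limits
proof safe
  fix s :: "nat \<Rightarrow> 'a \<times> 'a" and x y assume s: "\<forall>n. s n \<in> graph" "s \<longlonglongrightarrow> (x, y)"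
  have gr: "z \<in> graph \<Longrightarrow> fst z \<in> D" "z \<in> graph \<Longrightarrow> snd z = S (fst z)" for z
    by (auto simp: graph_def)
  have "\<And>n. fst (s n) \<in> D" "\<And>n. snd (s n) = S (fst (s n))" using s(1) gr by blast+
  moreover have "(\<lambda>n. fst (s n)) \<longlonglongrightarrow> x" "(\<lambda>n. snd (s n)) \<longlonglongrightarrow> y"
    using tendsto_fst[OF s(2)] tendsto_snd[OF s(2)] by simp_all
  ultimately show "(x, y) \<in> graph"
    using closed_op[of "\<lambda>n. fst (s n)" x y] by (auto simp: graph_def)
qed

lemma subspace_graph: "subspace graph"
  unfolding subspace_def graph_def
  using D_closed S_simps by (auto simp: image_iff zero_prod_def)

text \<open>The form belongs to \<open>S\<^sup>2 - \<mu> C + \<mu>\<^sup>2\<close>. On the diagonal the skew part drops out, so the form is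
  coercive for the graph norm.\<close>

lemma form_solution:
  assumes C: "lin_on D C" and skew: "\<And>x y. x \<in> D \<Longrightarrow> y \<in> D \<Longrightarrow> inner (C x) y = - inner x (C y)"
    and Cbnd: "\<And>x. x \<in> D \<Longrightarrow> norm (C x) \<le> c * norm (S x)"
    and lam: "\<mu> \<noteq> 0"
    and l: "lin_on D l" and lbnd: "\<And>w. w \<in> D \<Longrightarrow> \<bar>l w\<bar> \<le> K * (norm w + norm (S w))"
  shows "\<exists>q\<in>D. \<forall>w\<in>D. inner (S q) (S w) - \<mu> * inner (C q) w + \<mu>\<^sup>2 * inner q w = l w"
proof -
  note C' = lin_onD[OF C] and l' = lin_onD[OF l]
  let ?l = "\<lambda>z :: 'a \<times> 'a. l (fst z)"
  define A where "A z = (\<mu>\<^sup>2 *\<^sub>R fst z - \<mu> *\<^sub>R C (fst z), snd z)" for z :: "'a \<times> 'a"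
  have grD: "fst z \<in> D" "snd z = S (fst z)" if "z \<in> graph" for z using that by (auto simp: graph_def)
  have linl: "lin_on graph ?l"
    using subspace_graph l'(2,3) grD by (auto simp: lin_on_def)
  have "\<bar>?l z\<bar> \<le> (2 * \<bar>K\<bar>) * norm z" if z: "z \<in> graph" for z
  proof -
    have "\<bar>?l z\<bar> \<le> K * (norm (fst z) + norm (snd z))" using lbnd[OF grD(1)[OF z]] grD(2)[OF z] by simp
    also have "\<dots> \<le> \<bar>K\<bar> * (norm z + norm z)"
      using norm_fst_snd_le(1)[of z] norm_fst_snd_le(2)[of z] by (intro mult_mono add_mono) auto
    finally show ?thesis by simp
  qed
  then obtain p where p: "\<And>w. w \<in> graph \<Longrightarrow> inner p w = ?l w"
    using riesz_subspace[OF linl] by blast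
  have linA: "lin_on graph A"
    using subspace_graph C'(2,3) grD by (auto simp: lin_on_def A_def algebra_simps)
  have bndA: "norm (A z) \<le> (\<mu>\<^sup>2 + \<bar>\<mu>\<bar> * \<bar>c\<bar> + 1) * norm z" if z: "z \<in> graph" for z
  proof -
    have "norm (C (fst z)) \<le> \<bar>c\<bar> * norm z"
      using Cbnd[OF grD(1)[OF z]] norm_fst_snd_le(2)[of z] grD(2)[OF z]
        mult_mono[OF abs_ge_self[of c] norm_fst_snd_le(2)[of z]] by simp
    then have "\<bar>\<mu>\<bar> * norm (C (fst z)) \<le> \<bar>\<mu>\<bar> * (\<bar>c\<bar> * norm z)" by (intro mult_left_mono) auto
    moreover have "\<mu>\<^sup>2 * norm (fst z) \<le> \<mu>\<^sup>2 * norm z" using norm_fst_snd_le(1)[of z] by (intro mult_left_mono) auto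
    moreover have "norm (A z) \<le> norm (\<mu>\<^sup>2 *\<^sub>R fst z - \<mu> *\<^sub>R C (fst z)) + norm (snd z)"
      unfolding A_def by (rule norm_Pair_le)
    moreover have "norm (\<mu>\<^sup>2 *\<^sub>R fst z - \<mu> *\<^sub>R C (fst z)) \<le> \<mu>\<^sup>2 * norm (fst z) + \<bar>\<mu>\<bar> * norm (C (fst z))"
      using norm_triangle_ineq4[of "\<mu>\<^sup>2 *\<^sub>R fst z" "\<mu> *\<^sub>R C (fst z)"] by simp
    ultimately show ?thesis using norm_fst_snd_le(2)[of z] by (simp add: algebra_simps)
  qed
  have coer: "min 1 (\<mu>\<^sup>2) * (norm z)\<^sup>2 \<le> inner (A z) z" if z: "z \<in> graph" for z
  proof -
    have "inner (C (fst z)) (fst z) = 0"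
      using skew[of "fst z" "fst z"] grD(1)[OF z] by (simp add: inner_commute)
    then have eq: "inner (A z) z = \<mu>\<^sup>2 * (norm (fst z))\<^sup>2 + (norm (snd z))\<^sup>2"
      by (simp add: A_def inner_prod_def inner_diff_left power2_norm_eq_inner)
    have "min 1 (\<mu>\<^sup>2) * (norm z)\<^sup>2 = min 1 (\<mu>\<^sup>2) * (norm (fst z))\<^sup>2 + min 1 (\<mu>\<^sup>2) * (norm (snd z))\<^sup>2"
      by (simp add: norm_prod_def algebra_simps)
    also have "\<dots> \<le> \<mu>\<^sup>2 * (norm (fst z))\<^sup>2 + 1 * (norm (snd z))\<^sup>2"
      by (intro add_mono mult_right_mono) auto
    finally show ?thesis using eq by simp
  qed
  obtain z where z: "z \<in> graph" "\<And>w. w \<in> graph \<Longrightarrow> inner (A z) w = inner p w"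
    using lax_milgram[OF linA closed_graph bndA _ coer, of p] lam by auto
  have "inner (S (fst z)) (S w) - \<mu> * inner (C (fst z)) w + \<mu>\<^sup>2 * inner (fst z) w = l w"
    if w: "w \<in> D" for w
  proof -
    have wg: "(w, S w) \<in> graph" using w by (auto simp: graph_def)
    show ?thesis
      using z(2)[OF wg] p[OF wg] grD(2)[OF z(1)] by (simp add: A_def inner_prod_def inner_diff_left)
  qed
  then show ?thesis using grD(1)[OF z(1)] by blast
qed

lemma square_plus_one_surj:
  obtains y where "y \<in> D" "S y \<in> D" "S (S y) + y = f"
proof -
  have "lin_on D (inner f)" using subspace_D by (auto simp: lin_on_def inner_add_right)
  moreover have "\<bar>inner f w\<bar> \<le> norm f * (norm w + norm (S w))" for w
    using Cauchy_Schwarz_ineq2[of f w] by (simp add: algebra_simps add_increasing2)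
  ultimately have "\<exists>y\<in>D. \<forall>w\<in>D. inner (S y) (S w) - 1 * inner 0 w + 1\<^sup>2 * inner y w = inner f w"
    using subspace_D by (intro form_solution[where c = 0 and K = "norm f"]) (auto simp: lin_on_def)
  then obtain y where y: "y \<in> D" "\<And>w. w \<in> D \<Longrightarrow> inner (S y) (S w) + inner y w = inner f w" by auto
  have weak: "inner (S y) (S w) = inner (f - y) w" if "w \<in> D" for w
    using y(2)[OF that] by (simp add: inner_diff_left)
  have "S y \<in> D" "S (S y) = f - y" using in_dom[OF weak] eqI[OF weak] by blast+
  then show ?thesis using that y(1) by simp
qed

text \<open>The domain of \<open>S\<^sup>2\<close> is a core: a vector orthogonal to it for the graph product is orthogonal
  to the range of \<open>S\<^sup>2 + 1\<close>.\<close>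

lemma core:
  assumes x: "x \<in> D"
  obtains s where "\<And>n. s n \<in> D" "\<And>n. S (s n) \<in> D" "s \<longlonglongrightarrow> x" "(\<lambda>n. S (s n)) \<longlonglongrightarrow> S x"
proof -
  define X where "X = (\<lambda>x. (x, S x)) ` {x \<in> D. S x \<in> D}"
  have Xg: "X \<subseteq> graph" by (auto simp: X_def graph_def)
  have "subspace X"
    unfolding subspace_def X_def
    using D_closed S_simps by (auto simp: image_iff zero_prod_def)
  then have "lin_on X (inner (x, S x))" by (auto simp: lin_on_def inner_add_right)
  then obtain p where p: "p \<in> closure X" "\<And>w. w \<in> X \<Longrightarrow> inner p w = inner (x, S x) w"
    using riesz_subspace[of X "inner (x, S x)" "norm (x, S x)"] Cauchy_Schwarz_ineq2 by blast
  have "p \<in> graph" using p(1) closure_minimal[OF Xg closed_graph] by blast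
  then obtain z where z: "z \<in> D" "p = (z, S z)" by (auto simp: graph_def)
  obtain y where y: "y \<in> D" "S y \<in> D" "S (S y) + y = x - z" by (rule square_plus_one_surj)
  have r: "x - z \<in> D" using x z(1) by (rule D_closed)
  have "inner (x - z) (S (S y) + y) = 0"
    using p(2)[of "(y, S y)"] y(1,2) z x sym[OF r y(2)] S_simps(4)[OF x z(1)]
    by (auto simp: X_def inner_add_right inner_diff_left)
  then have "x = z" using y(3) by simp
  then have "(x, S x) \<in> closure X" using p(1) z by simp
  then obtain t where t: "\<And>n. t n \<in> X" "t \<longlonglongrightarrow> (x, S x)" unfolding closure_sequential by blast
  show ?thesis
  proof (rule that)
    show "(\<lambda>n. fst (t n)) \<longlonglongrightarrow> x" using tendsto_fst[OF t(2)] by simp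
    have "(\<lambda>n. snd (t n)) \<longlonglongrightarrow> S x" using tendsto_snd[OF t(2)] by simp
    moreover have "snd (t n) = S (fst (t n))" for n using t(1)[of n] by (auto simp: X_def)
    ultimately show "(\<lambda>n. S (fst (t n))) \<longlonglongrightarrow> S x" by simp
    show "fst (t n) \<in> D" "S (fst (t n)) \<in> D" for n using t(1)[of n] by (auto simp: X_def)
  qed
qed

text \<open>If \<open>x\<close> and \<open>y\<close> satisfy the adjoint relation for \<open>S\<^sup>2\<close>, the solution \<open>z\<close> of \<open>S\<^sup>2 z + z = x + y\<close>
  differs from \<open>x\<close> by a vector orthogonal to the range of \<open>S\<^sup>2 + 1\<close>, hence equals \<open>x\<close>.\<close>

lemma self_adj_square: "self_adj {x \<in> D. S x \<in> D} (\<lambda>x. S (S x))"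
proof
  let ?X = "{x \<in> D. S x \<in> D}"
  show "lin_on ?X (\<lambda>x. S (S x))"
    by (rule lin_onI) (auto simp: subspace_def S_simps D_closed)
  have "D \<subseteq> closure ?X"
  proof
    fix x assume "x \<in> D"
    obtain s where "\<And>n. s n \<in> D" "\<And>n. S (s n) \<in> D" "s \<longlonglongrightarrow> x"
      by (rule core[OF \<open>x \<in> D\<close>]) (rule that)
    then have "\<And>n. s n \<in> ?X" "s \<longlonglongrightarrow> x" by auto
    then show "x \<in> closure ?X" unfolding closure_sequential by blast
  qed
  then show "closure ?X = UNIV" using dense closure_minimal[of D "closure ?X"] by auto
  fix x y
  show "(\<forall>w\<in>?X. inner x (S (S w)) = inner y w) \<longleftrightarrow> x \<in> ?X \<and> S (S x) = y"
  proof safe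
    assume *: "\<forall>w\<in>?X. inner x (S (S w)) = inner y w"
    obtain z where z: "z \<in> D" "S z \<in> D" "S (S z) + z = x + y" by (rule square_plus_one_surj)
    obtain w where w: "w \<in> D" "S w \<in> D" "S (S w) + w = x - z" by (rule square_plus_one_surj)
    have "inner z (S (S w)) = inner (S (S z)) w" using z w by (simp add: sym)
    moreover have "inner x (S (S w)) = inner y w" using * w by simp
    ultimately have "inner (x - z) (S (S w) + w) = inner (x + y) w - inner (S (S z) + z) w"
      by (simp only: inner_add_right inner_add_left inner_diff_left)
    then have "x = z" using w(3) z(3) by simp
    then show "x \<in> D" "S x \<in> D" "S (S x) = y" using z by auto
  qed (simp add: sym)
qed

text \<open>An estimate of \<open>S'\<close> by the graph norm of \<open>S\<close> on the domain of \<open>S\<^sup>2\<close> extends the domain inclusion to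
  all of \<open>D\<close>, because \<open>S'\<close> is closed and \<open>D(S\<^sup>2)\<close> is a core. This compares operators of which only
  the squares are known.\<close>

lemma core_transfer:
  assumes S': "self_adj D' S'" and sub: "\<And>x. x \<in> D \<Longrightarrow> S x \<in> D \<Longrightarrow> x \<in> D'"
    and bnd: "\<And>x. x \<in> D \<Longrightarrow> S x \<in> D \<Longrightarrow> norm (S' x) \<le> k * (norm x + norm (S x))"
    and x: "x \<in> D"
  obtains s where "\<And>n. s n \<in> D" "\<And>n. S (s n) \<in> D" "s \<longlonglongrightarrow> x" "(\<lambda>n. S (s n)) \<longlonglongrightarrow> S x"
    "x \<in> D'" "(\<lambda>n. S' (s n)) \<longlonglongrightarrow> S' x"
proof -
  interpret S': self_adj D' S' by (rule S')
  obtain s where s: "\<And>n. s n \<in> D" "\<And>n. S (s n) \<in> D" "s \<longlonglongrightarrow> x" "(\<lambda>n. S (s n)) \<longlonglongrightarrow> S x"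
    by (rule core[OF x]) (rule that)
  have "Cauchy (\<lambda>n. (s n, S (s n)))"
    using tendsto_Pair[OF s(3,4)] by (rule LIMSEQ_imp_Cauchy)
  have "Cauchy (\<lambda>n. S' (s n))"
  proof (rule CauchyI)
    fix e :: real assume e: "e > 0"
    define e' where "e' = e / (2 * (\<bar>k\<bar> + 1))"
    have e': "e' > 0" using e by (simp add: e'_def)
    from CauchyD[OF \<open>Cauchy (\<lambda>n. (s n, S (s n)))\<close> e'] obtain M
      where M: "\<And>m n. m \<ge> M \<Longrightarrow> n \<ge> M \<Longrightarrow> norm ((s m, S (s m)) - (s n, S (s n))) < e'" by blast
    have "norm (S' (s m) - S' (s n)) < e" if "m \<ge> M" "n \<ge> M" for m n
    proof -
      let ?d = "s m - s n"
      have d: "?d \<in> D" "S ?d = S (s m) - S (s n)" "S ?d \<in> D" using s by (auto simp: D_closed S_simps)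
      have "norm (S' (s m) - S' (s n)) = norm (S' ?d)" using s sub by (simp add: S'.S_simps)
      also have "\<dots> \<le> \<bar>k\<bar> * (norm ?d + norm (S ?d))"
        using order_trans[OF bnd[OF d(1,3)] mult_right_mono[OF abs_ge_self]] by simp
      also have "\<dots> \<le> (\<bar>k\<bar> + 1) * (norm ?d + norm (S ?d))" by (intro mult_right_mono) auto
      also have "\<dots> < (\<bar>k\<bar> + 1) * (2 * e')"
        using M[OF that] norm_fst_le[of ?d "S ?d"] norm_snd_le[of "S ?d" ?d] d(2)
        by (intro mult_strict_left_mono) auto
      also have "\<dots> = e" unfolding e'_def by (simp add: add_pos_nonneg field_simps)
      finally show ?thesis .
    qed
    then show "\<exists>M. \<forall>m\<ge>M. \<forall>n\<ge>M. norm (S' (s m) - S' (s n)) < e" by blast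
  qed
  then obtain y where y: "(\<lambda>n. S' (s n)) \<longlonglongrightarrow> y" using Cauchy_convergent convergentD by blast
  have "x \<in> D'" "S' x = y" using S'.closed_op[OF _ s(3) y] sub s by blast+
  then show ?thesis using that s y by blast
qed

end

section \<open>Commutation with a positive square root\<close>

text \<open>The numbers \<open>b n = norm ((V ^^ n) z) ^ 2\<close> decrease, and \<open>norm ((V ^^ n) (z - V (V z))) ^ 2\<close> is their second
  difference because \<open>V\<close> is symmetric. Hence the powers tend to zero on the range of \<open>1 - V\<^sup>2\<close>, which is
  dense, and everywhere by contractivity.\<close>

lemma contraction_powers_tendsto_zero:
  fixes V :: "'a::{real_inner,complete_space} \<Rightarrow> 'a"
  assumes V: "bounded_linear V" and sym: "\<And>x y. inner (V x) y = inner x (V y)"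
    and contr: "\<And>x. norm (V x) \<le> norm x" and inj: "\<And>x. V (V x) = x \<Longrightarrow> x = 0"
  shows "(\<lambda>n. (V ^^ n) x) \<longlonglongrightarrow> 0"
proof -
  interpret V: bounded_linear V by (rule V)
  have Vn: "bounded_linear (V ^^ n)" for n
  proof (induction n)
    case 0
    show ?case using bounded_linear_ident by (simp add: id_def)
  next
    case (Suc n)
    show ?case using bounded_linear_compose[OF V Suc] by (simp add: o_def)
  qed
  have symn: "inner ((V ^^ n) x) y = inner x ((V ^^ n) y)" for n x y
    by (induction n arbitrary: x) (simp_all add: sym funpow_swap1)
  have contrn: "norm ((V ^^ n) x) \<le> norm x" for n x
    by (induction n) (auto intro: order_trans[OF contr])
  define W where "W x = x - V (V x)" for x
  have closW: "closure (range W) = UNIV"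
  proof (rule dense_subspaceI)
    show "subspace (range W)"
      by (intro linear_subspace_image subspace_UNIV linearI) (auto simp: W_def V.add V.scaleR algebra_simps)
    fix x assume *: "\<And>w. w \<in> range W \<Longrightarrow> inner x w = 0"
    have "inner (W x) y = 0" for y
      using *[of "W y"] by (simp add: W_def inner_diff_left inner_diff_right sym)
    then have "W x = 0" by (metis inner_eq_zero_iff)
    then show "x = 0" using inj by (simp add: W_def)
  qed
  have onW: "(\<lambda>n. (V ^^ n) (W z)) \<longlonglongrightarrow> 0" for z
  proof -
    define b where "b n = (norm ((V ^^ n) z))\<^sup>2" for n
    have "decseq b" unfolding b_def by (auto simp: decseq_Suc_iff contr intro!: power_mono)
    then obtain L where L: "b \<longlonglongrightarrow> L"
      using decseq_convergent[of b 0] by (auto simp: b_def)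
    have L1: "(\<lambda>n. b (Suc n)) \<longlonglongrightarrow> L" using L by (rule LIMSEQ_Suc)
    then have L2: "(\<lambda>n. b (Suc (Suc n))) \<longlonglongrightarrow> L" by (rule LIMSEQ_Suc)
    have "(norm ((V ^^ n) (W z)))\<^sup>2 = b n - 2 * b (Suc n) + b (Suc (Suc n))" for n
    proof -
      interpret Vn: bounded_linear "V ^^ n" by (rule Vn)
      have "(V ^^ n) (W z) = (V ^^ n) z - V (V ((V ^^ n) z))"
        by (simp add: W_def Vn.diff funpow_swap1[of V])
      then show ?thesis
        using inner_commute[of "V (V ((V ^^ n) z))" "(V ^^ n) z"]
        by (simp add: b_def power2_norm_eq_inner inner_diff_left inner_diff_right sym)
    qed
    then have "(\<lambda>n. (norm ((V ^^ n) (W z)))\<^sup>2) \<longlonglongrightarrow> L - 2 * L + L"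
      by (simp only:) (intro tendsto_intros L L1 L2)
    then have "(\<lambda>n. sqrt ((norm ((V ^^ n) (W z)))\<^sup>2)) \<longlonglongrightarrow> sqrt (L - 2 * L + L)"
      by (rule tendsto_real_sqrt)
    then show ?thesis by (simp add: tendsto_norm_zero_iff)
  qed
  show ?thesis
  proof (rule LIMSEQ_I)
    fix e :: real assume e: "e > 0"
    have "x \<in> closure (range W)" using closW by simp
    then obtain z where z: "norm (W z - x) < e / 2"
      using e unfolding closure_approachable dist_norm by (metis half_gt_zero imageE)
    obtain M where M: "\<And>n. n \<ge> M \<Longrightarrow> norm ((V ^^ n) (W z)) < e / 2"
      using LIMSEQ_D[OF onW[of z], of "e / 2"] e by auto
    have "norm ((V ^^ n) x) < e" if "n \<ge> M" for n
    proof -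
      interpret Vn: bounded_linear "V ^^ n" by (rule Vn)
      have "norm ((V ^^ n) x) \<le> norm ((V ^^ n) (W z)) + norm ((V ^^ n) (W z - x))"
        using norm_triangle_ineq4[of "(V ^^ n) (W z)" "(V ^^ n) (W z - x)"] by (simp add: Vn.diff)
      then show ?thesis using M[OF that] contrn[of n "W z - x"] z by linarith
    qed
    then show "\<exists>M. \<forall>n\<ge>M. norm ((V ^^ n) x - 0) < e" by auto
  qed
qed

text \<open>Let \<open>Y \<ge> 0\<close> be injective and \<open>C\<close> commute with \<open>Y\<^sup>2\<close>. Then \<open>X = Y C - C Y\<close> anticommutes with
  \<open>Y\<close>, hence \<open>X = V X V\<close> with the contraction \<open>V = (1 - Y) (1 + Y)\<^sup>-\<^sup>1\<close>, hence \<open>X = V\<^sup>n X V\<^sup>n\<close>. Since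
  \<open>1 - V\<^sup>2\<close> is injective, \<open>V\<^sup>n\<close> tends strongly to zero, so \<open>X = 0\<close>.\<close>

lemma bounded_sqrt_commute:
  fixes Y C :: "'a::{real_inner,complete_space} \<Rightarrow> 'a"
  assumes Y: "bounded_linear Y" and C: "bounded_linear C"
    and sym: "\<And>x y. inner (Y x) y = inner x (Y y)" and pos: "\<And>x. 0 \<le> inner x (Y x)"
    and inj: "\<And>x. Y x = 0 \<Longrightarrow> x = 0" and comm: "\<And>x. C (Y (Y x)) = Y (Y (C x))"
  shows "Y (C x) = C (Y x)"
proof -
  interpret Y: bounded_linear Y by (rule Y)
  interpret C: bounded_linear C by (rule C)
  have pos0: "Y x = 0" if "inner x (Y x) = 0" for x
  proof -
    interpret nonneg_form "\<lambda>x y. inner x (Y y)"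
      by standard (use sym pos in \<open>simp_all add: inner_add_left, metis inner_commute\<close>)
    have "(inner (Y x) (Y x))\<^sup>2 \<le> 0"
      using cauchy_schwarz[of x "Y x"] that by (simp add: sym)
    then show ?thesis by simp
  qed
  define X where "X x = Y (C x) - C (Y x)" for x
  interpret X: bounded_linear X
    unfolding X_def by (intro bounded_linear_sub bounded_linear_compose[OF Y C] bounded_linear_compose[OF C Y])
  have anti: "Y (X x) = - X (Y x)" for x
    by (simp add: X_def Y.diff comm)
  have coer: "1 * (norm x)\<^sup>2 \<le> inner (x + Y x) x" for x
    using pos[of x] by (simp add: inner_add_left inner_add_right power2_norm_eq_inner inner_commute)
  obtain KY where KY: "\<And>x. norm (Y x) \<le> norm x * KY" using Y.bounded by blast
  have "\<exists>y. y + Y y = x" for x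
  proof -
    have lin: "lin_on UNIV (\<lambda>x. x + Y x)" by (auto simp: lin_on_def Y.add Y.scaleR algebra_simps)
    have bnd: "norm (x + Y x) \<le> (1 + KY) * norm x" for x
      using norm_triangle_ineq[of x "Y x"] KY[of x] by (simp add: algebra_simps)
    obtain y where "\<And>w. inner (y + Y y) w = inner x w"
      using lax_milgram[OF lin closed_UNIV bnd _ coer, of x] by auto
    then show ?thesis by (metis dense_inner_eq closure_UNIV)
  qed
  then obtain K where K: "\<And>x. K x + Y (K x) = x" by metis
  have Kuniq: "K (y + Y y) = y" for y
  proof -
    let ?d = "K (y + Y y) - y"
    have "?d + Y ?d = 0" using K[of "y + Y y"] by (simp add: Y.diff algebra_simps)
    then have "(norm ?d)\<^sup>2 \<le> 0" using coer[of ?d] by simp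
    then show ?thesis by simp
  qed
  define V where "V x = K x - Y (K x)" for x
  have V1: "V (y + Y y) = y - Y y" for y by (simp add: V_def Kuniq)
  have ex: "\<exists>y. x = y + Y y" for x by (rule exI[of _ "K x"]) (simp add: K)
  have Vsym: "inner (V x) y = inner x (V y)" for x y
  proof -
    obtain u v where "x = u + Y u" "y = v + Y v" using ex by blast
    then show ?thesis by (simp add: V1 inner_add_left inner_add_right inner_diff_left inner_diff_right sym)
  qed
  have contr: "norm (V x) \<le> norm x" and Vnorm: "norm (V x) = norm x \<Longrightarrow> x = 0" for x
  proof -
    obtain u where u: "x = u + Y u" using ex by blast
    have eq: "(norm x)\<^sup>2 = (norm (V x))\<^sup>2 + 4 * inner u (Y u)"
      unfolding u V1 power2_norm_eq_inner using inner_commute[of u "Y u"]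
      by (simp add: inner_add_left inner_add_right inner_diff_left inner_diff_right)
    then have "(norm (V x))\<^sup>2 \<le> (norm x)\<^sup>2" using pos[of u] by linarith
    then show "norm (V x) \<le> norm x" by (rule power2_le_imp_le) simp
    assume "norm (V x) = norm x"
    then have "Y u = 0" using eq pos0 by simp
    then have "u = 0" by (rule inj)
    then show "x = 0" using u by simp
  qed
  have Vadd: "V (x + y) = V x + V y" and Vscale: "V (r *\<^sub>R x) = r *\<^sub>R V x" for x y r
    by (rule dense_inner_eq[of UNIV]; simp add: Vsym inner_add_left inner_add_right)+
  have V: "bounded_linear V"
    using contr by (intro bounded_linear_intro[of V 1]) (auto simp: Vadd Vscale)
  have "(\<lambda>n. (V ^^ n) x) \<longlonglongrightarrow> 0" for x
    using V Vsym contr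
  proof (rule contraction_powers_tendsto_zero)
    fix x assume "V (V x) = x"
    then have "norm (V x) = norm x" using contr[of x] contr[of "V x"] by simp
    then show "x = 0" by (rule Vnorm)
  qed
  note pow = this
  have XV: "V (X (V x)) = X x" for x
  proof -
    obtain u where u: "x = u + Y u" using ex by blast
    have "X (V x) = X u + Y (X u)" by (simp add: u V1 X.diff anti)
    then have "V (X (V x)) = X u - Y (X u)" by (simp add: V1)
    then show ?thesis by (simp add: u X.add anti)
  qed
  have Xn: "(V ^^ n) (X ((V ^^ n) x)) = X x" for n x
  proof (induction n arbitrary: x)
    case (Suc n)
    have "(V ^^ Suc n) (X ((V ^^ Suc n) x)) = (V ^^ n) (V (X (V ((V ^^ n) x))))"
      by (simp add: funpow_swap1)
    then show ?case using XV Suc by simp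
  qed simp
  have contrn: "norm ((V ^^ n) x) \<le> norm x" for n x
    by (induction n) (auto intro: order_trans[OF contr])
  have "(\<lambda>n. norm (X ((V ^^ n) x))) \<longlonglongrightarrow> 0"
    using tendsto_norm[OF X.tendsto[OF pow[of x]]] by (simp add: X.zero)
  moreover have "norm (X x) \<le> norm (X ((V ^^ n) x))" for n
    using contrn[of n "X ((V ^^ n) x)"] Xn[of n x] by simp
  ultimately have "norm (X x) \<le> 0" by (intro LIMSEQ_le_const[of _ 0]) auto
  then show ?thesis by (simp add: X_def)
qed

context self_adj
begin

text \<open>A skew \<open>C\<close> that is bounded relative to \<open>S\<close> and commutes with \<open>S\<^sup>2\<close> in the weak sense commutes with
  \<open>S\<close> in the weak sense. With \<open>Z = (S\<^sup>2 + 1)\<^sup>-\<^sup>1\<close>, the bounded operator \<open>C Z\<close>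
  commutes with the square \<open>Z - Z\<^sup>2\<close> of the positive operator \<open>S Z\<close>, hence with \<open>S Z\<close>.\<close>

lemma positive_sqrt_commute:
  assumes pos: "\<And>x. x \<in> D \<Longrightarrow> 0 \<le> inner x (S x)" and inj: "\<And>x. x \<in> D \<Longrightarrow> S x = 0 \<Longrightarrow> x = 0"
    and C: "lin_on D C" and skew: "\<And>x y. x \<in> D \<Longrightarrow> y \<in> D \<Longrightarrow> inner (C x) y = - inner x (C y)"
    and Cbnd: "\<And>x. x \<in> D \<Longrightarrow> norm (C x) \<le> c * norm (S x)"
    and comm: "\<And>y w. y \<in> D \<Longrightarrow> S y \<in> D \<Longrightarrow> w \<in> D \<Longrightarrow> S w \<in> D \<Longrightarrow>
      inner (C y) (S (S w)) = - inner (S (S y)) (C w)"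
    and x: "x \<in> D" and y: "y \<in> D"
  shows "inner (S x) (C y) = - inner (C x) (S y)"
proof -
  note C' = lin_onD(2-6)[OF C]
  have "\<exists>y. y \<in> D \<and> S y \<in> D \<and> S (S y) + y = x" for x by (rule square_plus_one_surj[of x]) blast
  then obtain Z where Z: "\<And>x. Z x \<in> D" "\<And>x. S (Z x) \<in> D" "\<And>x. S (S (Z x)) + Z x = x" by metis
  have Zuniq: "Z x = y" if "y \<in> D" "S y \<in> D" "S (S y) + y = x" for x y
  proof -
    let ?d = "Z x - y"
    have d: "?d \<in> D" "S ?d \<in> D" using that Z by (auto simp: D_closed S_simps)
    have "S (S ?d) + ?d = 0" using that Z by (simp add: S_simps D_closed) (metis Z(3) add_diff_add diff_self)
    then have "inner (S (S ?d) + ?d) ?d = 0" by simp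
    then have "inner (S ?d) (S ?d) + inner ?d ?d = 0" by (simp add: inner_add_left sym d)
    then have "inner ?d ?d = 0" using inner_ge_zero[of "S ?d"] inner_ge_zero[of ?d] by linarith
    then show ?thesis by simp
  qed
  have Zadd: "Z (x + y) = Z x + Z y" for x y
    using Z by (intro Zuniq) (auto simp: D_closed S_simps, metis (no_types) Z(3) add.commute add.left_commute)
  have Zscale: "Z (r *\<^sub>R x) = r *\<^sub>R Z x" for r x
    using Z by (intro Zuniq) (auto simp: D_closed S_simps simp flip: scaleR_add_right)
  have Znorm: "(norm (Z x))\<^sup>2 + 2 * (norm (S (Z x)))\<^sup>2 \<le> (norm x)\<^sup>2" for x
  proof -
    have "(norm x)\<^sup>2 = (norm (S (S (Z x)) + Z x))\<^sup>2" by (simp add: Z(3))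
    also have "\<dots> = (norm (S (S (Z x))))\<^sup>2 + 2 * (norm (S (Z x)))\<^sup>2 + (norm (Z x))\<^sup>2"
      unfolding power2_norm_eq_inner
      by (simp add: inner_add_left inner_add_right sym[OF Z(1) Z(2), symmetric] inner_commute)
    finally show ?thesis by simp
  qed
  have Zn: "norm (Z x) \<le> norm x" and SZn: "norm (S (Z x)) \<le> norm x" for x
  proof -
    show "norm (Z x) \<le> norm x"
      by (rule power2_le_imp_le) (use Znorm[of x] zero_le_power2[of "norm (S (Z x))"] in linarith, simp)
    have "(norm (S (Z x)))\<^sup>2 \<le> (norm x)\<^sup>2"
      using Znorm[of x] zero_le_power2[of "norm (S (Z x))"] zero_le_power2[of "norm (Z x)"] by linarith
    then show "norm (S (Z x)) \<le> norm x" by (rule power2_le_imp_le) simp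
  qed
  have Zsym: "inner (Z x) y = inner x (Z y)" for x y
  proof -
    have "inner (Z x) (S (S (Z y)) + Z y) = inner (S (S (Z x)) + Z x) (Z y)"
      unfolding inner_add_left inner_add_right by (simp add: sym Z)
    then show ?thesis by (simp add: Z(3))
  qed
  define Y where "Y x = S (Z x)" for x
  define C1 where "C1 x = C (Z x)" for x
  have ZS: "Z (S x) = S (Z x)" if x: "x \<in> D" for x
  proof (rule Zuniq)
    have "S (S (Z x)) = x - Z x" by (metis Z(3) add_diff_cancel_right')
    then show 1: "S (S (Z x)) \<in> D" using x Z by (simp add: D_closed)
    have "S (S (S (Z x)) + Z x) = S x" by (simp add: Z(3))
    then show "S (S (S (Z x))) + S (Z x) = S x" using 1 Z S_simps by metis
  qed (rule Z)
  have ZC: "C (Z x) = Z (C x)" if x: "x \<in> D" for x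
  proof (rule dense_inner_eq[OF closure_UNIV])
    fix v
    have "inner (C (Z x)) v = inner (C (Z x)) (S (S (Z v))) + inner (C (Z x)) (Z v)"
      by (simp add: Z(3) flip: inner_add_right)
    also have "\<dots> = - inner (S (S (Z x)) + Z x) (C (Z v))"
      unfolding inner_add_left by (simp add: comm[OF Z(1,2) Z(1,2)] skew[OF Z(1) Z(1)])
    also have "\<dots> = inner (C x) (Z v)" by (simp only: Z(3)) (simp add: Z skew x)
    finally show "inner (C (Z x)) v = inner (Z (C x)) v" by (simp add: Zsym)
  qed
  have Y: "bounded_linear Y"
    using SZn by (intro bounded_linear_intro[of Y 1]) (auto simp: Y_def Zadd Zscale S_simps Z)
  have C1: "bounded_linear C1"
  proof (rule bounded_linear_intro)
    show "norm (C1 x) \<le> norm x * \<bar>c\<bar>" for x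
      using order_trans[OF Cbnd[OF Z(1)] mult_mono[OF abs_ge_self SZn]] by (simp add: C1_def mult.commute)
  qed (auto simp: C1_def Zadd Zscale C' Z)
  have Y2: "Y (Y x) = Z x - Z (Z x)" for x
  proof -
    have "Y (Y x) = S (S (Z (Z x)))" by (simp add: Y_def ZS Z)
    then show ?thesis by (metis Z(3) add_diff_cancel_right')
  qed
  have "Y (C1 x) = C1 (Y x)" for x
  proof (rule bounded_sqrt_commute[OF Y C1])
    show "inner (Y x) y = inner x (Y y)" for x y
    proof -
      have "inner (Y x) y = inner (S (Z x)) (S (S (Z y)) + Z y)" by (simp add: Y_def Z(3))
      also have "\<dots> = inner (S (S (Z x)) + Z x) (S (Z y))"
        unfolding inner_add_left inner_add_right by (simp add: sym Z(1,2))
      finally show ?thesis by (simp add: Y_def Z(3))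
    qed
    show "0 \<le> inner x (Y x)" for x
    proof -
      have "inner x (Y x) = inner (S (S (Z x)) + Z x) (S (Z x))" by (simp add: Y_def Z(3))
      also have "\<dots> = inner (S (Z x)) (S (S (Z x))) + inner (Z x) (S (Z x))"
        unfolding inner_add_left by (simp only: inner_commute)
      finally show ?thesis using pos Z by simp
    qed
    show "x = 0" if "Y x = 0" for x
    proof -
      have "Z x = 0" using that inj[OF Z(1)] by (simp add: Y_def)
      then show ?thesis using Z(3)[of x] by (simp add: S_simps)
    qed
    show "C1 (Y (Y x)) = Y (Y (C1 x))" for x
    proof -
      have "C1 (Y (Y x)) = C1 (Z x) - C1 (Z (Z x))"
        unfolding Y2 using bounded_linear.linear[OF C1] by (rule linear_diff)
      also have "\<dots> = Z (C1 x) - Z (Z (C1 x))" by (simp add: C1_def ZC Z)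
      finally show ?thesis by (simp add: Y2)
    qed
  qed
  note YC1 = this
  have main: "inner (S w) (C z) = - inner (C w) (S z)"
    if w: "w \<in> D" "S w \<in> D" and z: "z \<in> D" "S z \<in> D" for w z
  proof -
    define x where "x = S (S w) + w"
    define v where "v = S (S z) + z"
    have wx: "Z x = w" "Z v = z" using w z by (auto simp: x_def v_def intro: Zuniq)
    have 1: "Y (C1 x) = C1 (Y x)" by (rule YC1)
    have "inner (Y (C1 x)) v = inner (C w) (S z)"
    proof -
      have "inner (Y (C1 x)) v = inner (S (Z (C w))) (S (S z) + z)" by (simp add: Y_def C1_def wx v_def)
      also have "\<dots> = inner (S (S (Z (C w))) + Z (C w)) (S z)"
        unfolding inner_add_left inner_add_right by (simp add: sym Z(1,2) z)
      finally show ?thesis by (simp add: Z(3))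
    qed
    moreover have "inner (C1 (Y x)) v = - inner (S w) (C z)"
    proof -
      have "inner (C1 (Y x)) v = inner (Z (C (S w))) v" by (simp add: Y_def C1_def wx ZC w)
      also have "\<dots> = inner (C (S w)) z" by (simp add: Zsym wx)
      finally show ?thesis using skew w z by simp
    qed
    ultimately show ?thesis using 1 by simp
  qed
  have Ccont: "(\<lambda>n. C (s n)) \<longlonglongrightarrow> C u" if "\<And>n. s n \<in> D" "u \<in> D" "(\<lambda>n. S (s n)) \<longlonglongrightarrow> S u" for s u
  proof -
    have lim: "(\<lambda>n. c * norm (S (s n) - S u)) \<longlonglongrightarrow> 0"
      using tendsto_mult_right_zero[OF tendsto_norm_zero[OF LIM_zero[OF that(3)]]] .
    have "(\<lambda>n. norm (C (s n) - C u)) \<longlonglongrightarrow> 0"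
    proof (rule tendsto_sandwich[OF _ _ tendsto_const lim])
      show "\<forall>\<^sub>F n in sequentially. norm (C (s n) - C u) \<le> c * norm (S (s n) - S u)"
        using Cbnd[of "s _ - u"] that(1,2) by (simp add: D_closed C' S_simps)
    qed simp
    then show ?thesis by (simp add: LIM_zero_iff tendsto_norm_zero_iff)
  qed
  obtain s where s: "\<And>n. s n \<in> D" "\<And>n. S (s n) \<in> D" "s \<longlonglongrightarrow> x" "(\<lambda>n. S (s n)) \<longlonglongrightarrow> S x"
    by (rule core[OF x]) (rule that)
  obtain t where t: "\<And>n. t n \<in> D" "\<And>n. S (t n) \<in> D" "t \<longlonglongrightarrow> y" "(\<lambda>n. S (t n)) \<longlonglongrightarrow> S y"
    by (rule core[OF y]) (rule that)
  show ?thesis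
  proof (rule LIMSEQ_unique)
    show "(\<lambda>n. inner (S (s n)) (C (t n))) \<longlonglongrightarrow> inner (S x) (C y)"
      by (intro tendsto_intros s Ccont t y)
    show "(\<lambda>n. inner (S (s n)) (C (t n))) \<longlonglongrightarrow> - inner (C x) (S y)"
      unfolding main[OF s(1,2) t(1,2)] by (intro tendsto_intros Ccont s t x)
  qed
qed

end

section \<open>The coupled operator in normal form\<close>

text \<open>\<open>S\<close>, \<open>C\<close>, \<open>T\<close> are the energy operator, the skew part and the trace in the coordinates of the
  introduction, and \<open>J\<close> is a regularisation that commutes with \<open>S\<close> and \<open>C\<close>. The assumption
  \<open>T_rough\<close> says that \<open>z \<circ> T\<close> is bounded for the ambient norm only if \<open>z = 0\<close>, and \<open>lim_C\<close> gives a
  regularised trace to \<open>C q\<close>, where \<open>q\<close> is a potential in the sense defined below.\<close>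

locale coupled = self_adj D S for D :: "'a::{real_inner,complete_space} set" and S +
  fixes C :: "'a \<Rightarrow> 'a" and c :: real and T :: "'a \<Rightarrow> 'h::{real_inner,complete_space}" and k :: real
    and \<Theta> :: "'h \<Rightarrow> 'h" and J :: "real \<Rightarrow> 'a \<Rightarrow> 'a"
  assumes C_lin: "lin_on D C"
    and C_skew: "\<And>x y. x \<in> D \<Longrightarrow> y \<in> D \<Longrightarrow> inner (C x) y = - inner x (C y)"
    and C_bound: "\<And>x. x \<in> D \<Longrightarrow> norm (C x) \<le> c * norm (S x)"
    and C_commute: "\<And>x y. x \<in> D \<Longrightarrow> y \<in> D \<Longrightarrow> inner (S x) (C y) = - inner (C x) (S y)"
    and T_lin: "lin_on D T"
    and T_bound: "\<And>x. x \<in> D \<Longrightarrow> norm (T x) \<le> k * (norm x + norm (S x))"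
    and \<Theta>_bl: "bounded_linear \<Theta>"
    and \<Theta>_sym: "\<And>x y. inner (\<Theta> x) y = inner x (\<Theta> y)"
    and \<Theta>_pos: "\<And>x. 0 \<le> inner (\<Theta> x) x"
    and \<Theta>_inj: "\<And>x. \<Theta> x = 0 \<Longrightarrow> x = 0"
    and J_bl: "\<And>\<nu>. \<nu> > 0 \<Longrightarrow> bounded_linear (J \<nu>)"
    and J_sym: "\<And>\<nu> x y. \<nu> > 0 \<Longrightarrow> inner (J \<nu> x) y = inner x (J \<nu> y)"
    and J_D: "\<And>\<nu> x. \<nu> > 0 \<Longrightarrow> J \<nu> x \<in> D"
    and J_bound: "\<And>\<nu>. \<nu> > 0 \<Longrightarrow> \<exists>K. \<forall>x. norm (S (J \<nu> x)) \<le> K * norm x"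
    and J_S: "\<And>\<nu> x. \<nu> > 0 \<Longrightarrow> x \<in> D \<Longrightarrow> J \<nu> (S x) = S (J \<nu> x)"
    and J_C: "\<And>\<nu> x. \<nu> > 0 \<Longrightarrow> x \<in> D \<Longrightarrow> J \<nu> (C x) = C (J \<nu> x)"
    and J_lim: "\<And>x. ((\<lambda>\<nu>. J \<nu> x) \<longlongrightarrow> x) (at_right 0)"
    and range_full: "\<And>y. \<exists>w\<in>D. \<exists>z. T w - \<Theta> z = y"
    and T_rough: "\<And>z x. (\<And>w. w \<in> D \<Longrightarrow> inner z (T w) = inner x w) \<Longrightarrow> z = 0"
    and lim_C: "\<And>\<mu> z q. \<mu> \<noteq> 0 \<Longrightarrow> q \<in> D \<Longrightarrow>
      (\<And>w. w \<in> D \<Longrightarrow> inner (S q) (S w) - \<mu> * inner (C q) w + \<mu>\<^sup>2 * inner q w = inner z (T w)) \<Longrightarrow>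
      \<exists>l. ((\<lambda>\<nu>. T (J \<nu> (C q))) \<longlongrightarrow> l) (at_right 0)"
begin

lemmas C_simps = lin_onD(2-6)[OF C_lin]
lemmas T_simps = lin_onD(2-6)[OF T_lin]
lemmas \<Theta>_simps = linear_add[OF bounded_linear.linear[OF \<Theta>_bl]] linear_diff[OF bounded_linear.linear[OF \<Theta>_bl]]
  linear_scale[OF bounded_linear.linear[OF \<Theta>_bl]] linear_0[OF bounded_linear.linear[OF \<Theta>_bl]]
  linear_neg[OF bounded_linear.linear[OF \<Theta>_bl]]

lemma J_simps:
  assumes "\<nu> > 0"
  shows "J \<nu> (x + y) = J \<nu> x + J \<nu> y" "J \<nu> (x - y) = J \<nu> x - J \<nu> y" "J \<nu> (r *\<^sub>R x) = r *\<^sub>R J \<nu> x"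
    "J \<nu> 0 = 0" "J \<nu> (- x) = - J \<nu> x"
  using bounded_linear.linear[OF J_bl[OF assms]]
  by (simp_all add: linear_add linear_diff linear_scale linear_0 linear_neg)

lemma C_diag: "x \<in> D \<Longrightarrow> inner (C x) x = 0"
  using C_skew[of x x] by (simp add: inner_commute)

lemma SJ_bl: "\<nu> > 0 \<Longrightarrow> bounded_linear (\<lambda>x. S (J \<nu> x))"
proof -
  assume \<nu>: "\<nu> > 0"
  obtain K where K: "\<And>x. norm (S (J \<nu> x)) \<le> K * norm x" using J_bound[OF \<nu>] by blast
  show ?thesis
    by (rule bounded_linear_intro[of _ K]) (use \<nu> K in \<open>auto simp: J_simps S_simps J_D mult.commute\<close>)
qed

lemma CJ_bl: "\<nu> > 0 \<Longrightarrow> bounded_linear (\<lambda>x. C (J \<nu> x))"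
proof -
  assume \<nu>: "\<nu> > 0"
  obtain K where K: "\<And>x. norm (S (J \<nu> x)) \<le> K * norm x" using J_bound[OF \<nu>] by blast
  have "norm (C (J \<nu> x)) \<le> norm x * (\<bar>c\<bar> * K)" for x
  proof -
    have "norm (C (J \<nu> x)) \<le> c * norm (S (J \<nu> x))" using \<nu> by (intro C_bound J_D)
    also have "\<dots> \<le> \<bar>c\<bar> * (K * norm x)" by (intro mult_mono K) auto
    finally show ?thesis by (simp add: mult_ac)
  qed
  then show ?thesis
    by (rule bounded_linear_intro[rotated 2]) (use \<nu> in \<open>auto simp: J_simps C_simps J_D\<close>)
qed

lemma TJ_bl: "\<nu> > 0 \<Longrightarrow> bounded_linear (\<lambda>x. T (J \<nu> x))"
proof -
  assume \<nu>: "\<nu> > 0"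
  obtain K where K: "\<And>x. norm (S (J \<nu> x)) \<le> K * norm x" using J_bound[OF \<nu>] by blast
  obtain K' where K': "\<And>x. norm (J \<nu> x) \<le> norm x * K'" using bounded_linear.bounded[OF J_bl[OF \<nu>]] by blast
  have "norm (T (J \<nu> x)) \<le> norm x * (\<bar>k\<bar> * (K' + K))" for x
  proof -
    have "norm (T (J \<nu> x)) \<le> k * (norm (J \<nu> x) + norm (S (J \<nu> x)))" using \<nu> by (intro T_bound J_D)
    also have "\<dots> \<le> \<bar>k\<bar> * (norm x * K' + K * norm x)" by (intro mult_mono add_mono K K') auto
    finally show ?thesis by (simp add: algebra_simps)
  qed
  then show ?thesis
    by (rule bounded_linear_intro[rotated 2]) (use \<nu> in \<open>auto simp: J_simps T_simps J_D\<close>)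
qed

text \<open>On \<open>D\<close> this is the commutation of \<open>J\<close> with \<open>S\<close>. Both sides are continuous in \<open>x\<close>, since \<open>S J\<close> is
  bounded, so it extends to the whole space; the same applies to \<open>C J\<close> below.\<close>

lemma SJ_sym: "\<nu> > 0 \<Longrightarrow> inner x (S (J \<nu> y)) = inner (S (J \<nu> x)) y"
proof -
  assume \<nu>: "\<nu> > 0"
  have on_D: "inner x (S (J \<nu> y)) = inner (S (J \<nu> x)) y" if "x \<in> D" for x
    using that \<nu> by (metis J_D J_S J_sym sym)
  have "closed {x. inner x (S (J \<nu> y)) = inner (S (J \<nu> x)) y}"
    by (intro closed_Collect_eq continuous_intros linear_continuous_on SJ_bl \<nu>)
  then have "closure D \<subseteq> {x. inner x (S (J \<nu> y)) = inner (S (J \<nu> x)) y}"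
    using on_D by (intro closure_minimal) auto
  then show ?thesis using dense by auto
qed

lemma CJ_skew: "\<nu> > 0 \<Longrightarrow> inner x (C (J \<nu> y)) = - inner (C (J \<nu> x)) y"
proof -
  assume \<nu>: "\<nu> > 0"
  have on_D: "inner x (C (J \<nu> y)) = - inner (C (J \<nu> x)) y" if "x \<in> D" for x
  proof -
    have "inner x (C (J \<nu> y)) = - inner (C x) (J \<nu> y)" using C_skew[OF that J_D[OF \<nu>]] by simp
    also have "inner (C x) (J \<nu> y) = inner (C (J \<nu> x)) y" by (simp add: J_sym[OF \<nu>, symmetric] J_C[OF \<nu> that])
    finally show ?thesis .
  qed
  have "closed {x. inner x (C (J \<nu> y)) = - inner (C (J \<nu> x)) y}"
    by (intro closed_Collect_eq continuous_intros linear_continuous_on CJ_bl \<nu>)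
  then have "closure D \<subseteq> {x. inner x (C (J \<nu> y)) = - inner (C (J \<nu> x)) y}"
    using on_D by (intro closure_minimal) auto
  then show ?thesis using dense by auto
qed

lemma eventually_pos: "eventually (\<lambda>\<nu>. \<nu> > 0) (at_right (0::real))"
  by (auto simp: eventually_at_filter)

lemma T_smooth: "u \<in> D \<Longrightarrow> ((\<lambda>\<nu>. T (J \<nu> u)) \<longlongrightarrow> T u) (at_right 0)"
proof -
  assume u: "u \<in> D"
  have "((\<lambda>\<nu>. \<bar>k\<bar> * (norm (J \<nu> u - u) + norm (J \<nu> (S u) - S u))) \<longlongrightarrow> \<bar>k\<bar> * (norm (u - u) + norm (S u - S u)))
      (at_right 0)"
    by (intro tendsto_intros J_lim)
  then have lim: "((\<lambda>\<nu>. \<bar>k\<bar> * (norm (J \<nu> u - u) + norm (J \<nu> (S u) - S u))) \<longlongrightarrow> 0) (at_right 0)" by simp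
  have "((\<lambda>\<nu>. norm (T (J \<nu> u) - T u)) \<longlongrightarrow> 0) (at_right 0)"
  proof (rule tendsto_sandwich[OF _ _ tendsto_const lim])
    show "\<forall>\<^sub>F \<nu> in at_right 0. norm (T (J \<nu> u) - T u) \<le> \<bar>k\<bar> * (norm (J \<nu> u - u) + norm (J \<nu> (S u) - S u))"
      using eventually_pos
    proof eventually_elim
      case (elim \<nu>)
      have "norm (T (J \<nu> u) - T u) = norm (T (J \<nu> u - u))" using elim u by (simp add: T_simps J_D)
      also have "\<dots> \<le> k * (norm (J \<nu> u - u) + norm (S (J \<nu> u - u)))"
        using elim u by (intro T_bound D_closed J_D)
      also have "\<dots> = k * (norm (J \<nu> u - u) + norm (J \<nu> (S u) - S u))"
        using elim u by (simp add: S_simps J_D J_S)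
      also have "\<dots> \<le> \<bar>k\<bar> * (norm (J \<nu> u - u) + norm (J \<nu> (S u) - S u))"
        by (intro mult_right_mono) auto
      finally show ?case .
    qed
  qed simp
  then show ?thesis by (simp add: LIM_zero_iff tendsto_norm_zero_iff)
qed

text \<open>The weak form of \<open>S\<^sup>2 q - \<mu> C q + \<mu>\<^sup>2 q = T\<^sup>* z\<close>, where \<open>T\<^sup>* z\<close> is a functional on \<open>D\<close>.\<close>

definition potential :: "real \<Rightarrow> 'h \<Rightarrow> 'a \<Rightarrow> bool"
  where "potential \<mu> z q \<longleftrightarrow> q \<in> D \<and>
    (\<forall>w\<in>D. inner (S q) (S w) - \<mu> * inner (C q) w + \<mu>\<^sup>2 * inner q w = inner z (T w))"

lemma potentialD:
  assumes "potential \<mu> z q"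
  shows "q \<in> D" "w \<in> D \<Longrightarrow> inner (S q) (S w) - \<mu> * inner (C q) w + \<mu>\<^sup>2 * inner q w = inner z (T w)"
  using assms by (auto simp: potential_def)

lemma potential_exists: "\<mu> \<noteq> 0 \<Longrightarrow> \<exists>q. potential \<mu> z q"
proof -
  assume \<mu>: "\<mu> \<noteq> 0"
  have l: "lin_on D (\<lambda>w. inner z (T w))"
    using subspace_D by (auto simp: lin_on_def T_simps inner_add_right)
  have "\<bar>inner z (T w)\<bar> \<le> (norm z * k) * (norm w + norm (S w))" if "w \<in> D" for w
  proof -
    have "\<bar>inner z (T w)\<bar> \<le> norm z * norm (T w)" by (rule Cauchy_Schwarz_ineq2)
    also have "\<dots> \<le> norm z * (k * (norm w + norm (S w)))" by (intro mult_left_mono T_bound that) simp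
    finally show ?thesis by (simp add: mult.assoc)
  qed
  from form_solution[OF C_lin C_skew C_bound \<mu> l this] show ?thesis by (auto simp: potential_def)
qed

lemma potential_diag:
  assumes "potential \<mu> z q"
  shows "inner z (T q) = (norm (S q))\<^sup>2 + \<mu>\<^sup>2 * (norm q)\<^sup>2"
  using potentialD(2)[OF assms potentialD(1)[OF assms]] C_diag[OF potentialD(1)[OF assms]]
  by (simp add: power2_norm_eq_inner)

lemma potential_combine:
  assumes "potential \<mu> x p" "potential \<mu> y q"
  shows "potential \<mu> (a *\<^sub>R x + b *\<^sub>R y) (a *\<^sub>R p + b *\<^sub>R q)"
proof -
  note [simp] = potentialD(1)[OF assms(1)] potentialD(1)[OF assms(2)]
  have "inner (S (a *\<^sub>R p + b *\<^sub>R q)) (S w) - \<mu> * inner (C (a *\<^sub>R p + b *\<^sub>R q)) w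
      + \<mu>\<^sup>2 * inner (a *\<^sub>R p + b *\<^sub>R q) w = inner (a *\<^sub>R x + b *\<^sub>R y) (T w)" if w: "w \<in> D" for w
    using arg_cong2[where f = "(+)", OF arg_cong[where f = "\<lambda>t. a * t", OF potentialD(2)[OF assms(1) w]]
        arg_cong[where f = "\<lambda>t. b * t", OF potentialD(2)[OF assms(2) w]]]
    by (simp add: S_simps C_simps D_closed inner_add_left algebra_simps)
  then show ?thesis by (simp add: potential_def D_closed)
qed

lemma potential_0: "\<mu> \<noteq> 0 \<Longrightarrow> potential \<mu> 0 q \<Longrightarrow> q = 0"
proof -
  assume \<mu>: "\<mu> \<noteq> 0" and "potential \<mu> 0 q"
  from potential_diag[OF this(2)] have "(norm (S q))\<^sup>2 + \<mu>\<^sup>2 * (norm q)\<^sup>2 = 0" by simp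
  then have "\<mu>\<^sup>2 * (norm q)\<^sup>2 = 0" using add_nonneg_eq_0_iff[of "(norm (S q))\<^sup>2" "\<mu>\<^sup>2 * (norm q)\<^sup>2"] by simp
  then show ?thesis using \<mu> by simp
qed

lemma potential_unique: "\<mu> \<noteq> 0 \<Longrightarrow> potential \<mu> z p \<Longrightarrow> potential \<mu> z q \<Longrightarrow> p = q"
  using potential_0[of \<mu> "p - q"] potential_combine[of \<mu> z p z q 1 "- 1"] by simp

definition Q :: "real \<Rightarrow> 'h \<Rightarrow> 'a" where "Q \<mu> z = (SOME q. potential \<mu> z q)"

lemma Q: "\<mu> \<noteq> 0 \<Longrightarrow> potential \<mu> z (Q \<mu> z)"
  unfolding Q_def by (rule someI_ex) (rule potential_exists)

lemma Q_eq: "\<mu> \<noteq> 0 \<Longrightarrow> potential \<mu> z q \<Longrightarrow> Q \<mu> z = q"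
  using Q potential_unique by blast

lemma Q_D: "\<mu> \<noteq> 0 \<Longrightarrow> Q \<mu> z \<in> D"
  using Q potentialD(1) by blast

lemma Q_add: "\<mu> \<noteq> 0 \<Longrightarrow> Q \<mu> (x + y) = Q \<mu> x + Q \<mu> y"
proof -
  assume \<mu>: "\<mu> \<noteq> 0"
  show ?thesis
    using Q_eq[OF \<mu> potential_combine[OF Q[OF \<mu>, of x] Q[OF \<mu>, of y], of 1 1]] by simp
qed

lemma Q_scale: "\<mu> \<noteq> 0 \<Longrightarrow> Q \<mu> (r *\<^sub>R x) = r *\<^sub>R Q \<mu> x"
proof -
  assume \<mu>: "\<mu> \<noteq> 0"
  show ?thesis
    using Q_eq[OF \<mu> potential_combine[OF Q[OF \<mu>, of x] Q[OF \<mu>, of x], of r 0]] by simp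
qed

lemma energy_ge:
  assumes "\<mu> \<noteq> 0"
  shows "min 1 (\<mu>\<^sup>2) / 2 * (norm q + norm (S q))\<^sup>2 \<le> (norm (S q))\<^sup>2 + \<mu>\<^sup>2 * (norm q)\<^sup>2"
proof -
  have "(norm q + norm (S q))\<^sup>2 \<le> 2 * ((norm q)\<^sup>2 + (norm (S q))\<^sup>2)"
    using zero_le_power2[of "norm q - norm (S q)"] by (simp add: power2_eq_square algebra_simps)
  then have "min 1 (\<mu>\<^sup>2) / 2 * (norm q + norm (S q))\<^sup>2 \<le> min 1 (\<mu>\<^sup>2) / 2 * (2 * ((norm q)\<^sup>2 + (norm (S q))\<^sup>2))"
    by (intro mult_left_mono) auto
  also have "\<dots> = min 1 (\<mu>\<^sup>2) * (norm q)\<^sup>2 + min 1 (\<mu>\<^sup>2) * (norm (S q))\<^sup>2" by (simp add: algebra_simps)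
  also have "\<dots> \<le> \<mu>\<^sup>2 * (norm q)\<^sup>2 + 1 * (norm (S q))\<^sup>2" by (intro add_mono mult_right_mono) auto
  finally show ?thesis by simp
qed

lemma Q_bound:
  assumes \<mu>: "\<mu> \<noteq> 0"
  obtains K where "\<And>z. norm (Q \<mu> z) + norm (S (Q \<mu> z)) \<le> K * norm z"
proof
  fix z
  let ?n = "norm (Q \<mu> z) + norm (S (Q \<mu> z))" and ?a = "min 1 (\<mu>\<^sup>2) / 2"
  have a: "?a > 0" using \<mu> by simp
  have "?a * ?n\<^sup>2 \<le> inner z (T (Q \<mu> z))"
    using energy_ge[OF \<mu>] potential_diag[OF Q[OF \<mu>]] by simp
  also have "\<dots> \<le> norm z * norm (T (Q \<mu> z))" by (rule norm_cauchy_schwarz)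
  also have "\<dots> \<le> norm z * (\<bar>k\<bar> * ?n)"
    using order_trans[OF T_bound[OF Q_D[OF \<mu>]] mult_right_mono[OF abs_ge_self]]
    by (intro mult_left_mono) auto
  finally have "(?a * ?n) * ?n \<le> (norm z * \<bar>k\<bar>) * ?n" by (simp add: power2_eq_square mult_ac)
  then have "?a * ?n \<le> norm z * \<bar>k\<bar>"
  proof (cases "?n = 0")
    case False
    then have "?n > 0" using norm_ge_zero[of "Q \<mu> z"] norm_ge_zero[of "S (Q \<mu> z)"] by linarith
    with \<open>(?a * ?n) * ?n \<le> _\<close> show ?thesis by (rule mult_right_le_imp_le)
  qed simp
  then show "?n \<le> (\<bar>k\<bar> / ?a) * norm z" using a by (simp add: field_simps)
qed

text \<open>The range condition bounds \<open>z\<close> by the norms of the functional \<open>z \<circ> T\<close> and of \<open>\<Theta> z\<close>: the vectors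
  for which both are at most one form a weakly bounded set.\<close>

lemma range_coercive:
  "\<exists>K>0. \<forall>z m. 0 \<le> m \<longrightarrow> (\<forall>w\<in>D. \<bar>inner z (T w)\<bar> \<le> m * (norm w + norm (S w))) \<longrightarrow>
    norm (\<Theta> z) \<le> m \<longrightarrow> norm z \<le> K * m"
proof -
  define U where "U = {z. (\<forall>w\<in>D. \<bar>inner z (T w)\<bar> \<le> norm w + norm (S w)) \<and> norm (\<Theta> z) \<le> 1}"
  have "\<exists>K. \<forall>f\<in>inner ` U. norm (f y) \<le> K" for y
  proof -
    obtain w z where w: "w \<in> D" and y: "y = T w - \<Theta> z" using range_full[of y] by auto
    have "\<bar>inner v y\<bar> \<le> norm w + norm (S w) + norm z" if v: "v \<in> U" for v
    proof -
      have "\<bar>inner v (\<Theta> z)\<bar> \<le> norm (\<Theta> v) * norm z"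
        using Cauchy_Schwarz_ineq2[of "\<Theta> v" z] by (simp add: \<Theta>_sym)
      also have "\<dots> \<le> 1 * norm z" using v by (intro mult_right_mono) (auto simp: U_def)
      finally have "\<bar>inner v (\<Theta> z)\<bar> \<le> norm z" by simp
      moreover have "\<bar>inner v (T w)\<bar> \<le> norm w + norm (S w)" using v w by (auto simp: U_def)
      ultimately show ?thesis unfolding y inner_diff_right by linarith
    qed
    then show ?thesis by auto
  qed
  then obtain K where K: "\<And>f y. f \<in> inner ` U \<Longrightarrow> norm (f y) \<le> K * norm y"
    using uniform_boundedness[of "inner ` U"] bounded_linear_inner_right by blast
  have KU: "norm z \<le> \<bar>K\<bar> + 1" if "z \<in> U" for z
  proof -
    have "(norm z)\<^sup>2 \<le> K * norm z" using K[of "inner z" z] that by (simp add: power2_norm_eq_inner)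
    then have "norm z \<le> \<bar>K\<bar>" by (cases "z = 0") (auto simp: power2_eq_square)
    then show ?thesis by simp
  qed
  let ?K = "\<bar>K\<bar> + 1"
  have K0: "?K > 0" by simp
  have "norm z \<le> ?K * m"
    if m: "0 \<le> m" and z: "\<And>w. w \<in> D \<Longrightarrow> \<bar>inner z (T w)\<bar> \<le> m * (norm w + norm (S w))" "norm (\<Theta> z) \<le> m" for z m
  proof (rule field_le_epsilon)
    fix e :: real assume "e > 0"
    define r where "r = m + e / ?K"
    have r: "r > 0" "m \<le> r" using m K0 \<open>e > 0\<close> by (auto simp: r_def intro: add_nonneg_pos)
    have "inverse r *\<^sub>R z \<in> U"
    proof -
      have "\<bar>inner z (T w)\<bar> \<le> r * (norm w + norm (S w))" if "w \<in> D" for w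
        using order_trans[OF z(1)[OF that] mult_right_mono[OF r(2)]] by simp
      moreover have "norm (\<Theta> z) \<le> r" using z(2) r(2) by linarith
      ultimately show ?thesis
        using r(1) by (auto simp: U_def \<Theta>_simps abs_mult field_simps)
    qed
    then have "norm (inverse r *\<^sub>R z) \<le> ?K" by (rule KU)
    then have "norm z \<le> ?K * r" using r(1) by (simp add: field_simps)
    also have "\<dots> = ?K * m + e" using K0 by (simp add: r_def distrib_left)
    finally show "norm z \<le> ?K * m + e" .
  qed
  then show ?thesis using K0 by blast
qed

text \<open>The energy of the potential controls the functional \<open>z \<circ> T\<close>, by the equation that defines the
  potential, so \<open>range_coercive\<close> applies with \<open>m\<close> a multiple of the graph norm of the potential plus
  the norm of \<open>\<Theta> z\<close>.\<close>

lemma potential_coercive: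
  assumes \<mu>: "\<mu> \<noteq> 0"
  obtains a where "a > 0"
    "\<And>z. a * (norm z)\<^sup>2 \<le> (norm (S (Q \<mu> z)))\<^sup>2 + \<mu>\<^sup>2 * (norm (Q \<mu> z))\<^sup>2 + (norm (\<Theta> z))\<^sup>2"
proof -
  obtain K where K: "K > 0"
    "\<And>z m. 0 \<le> m \<Longrightarrow> \<forall>w\<in>D. \<bar>inner z (T w)\<bar> \<le> m * (norm w + norm (S w)) \<Longrightarrow>
      norm (\<Theta> z) \<le> m \<Longrightarrow> norm z \<le> K * m" using range_coercive by blast
  define k1 where "k1 = 1 + \<bar>\<mu>\<bar> * \<bar>c\<bar> + \<mu>\<^sup>2"
  define b where "b = 2 * k1\<^sup>2 / (min 1 (\<mu>\<^sup>2) / 2) + 2"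
  have "0 \<le> \<bar>\<mu>\<bar> * \<bar>c\<bar>" "0 \<le> \<mu>\<^sup>2" by simp_all
  then have k1: "k1 > 0" "1 \<le> k1" "\<bar>\<mu>\<bar> * \<bar>c\<bar> \<le> k1" "\<mu>\<^sup>2 \<le> k1" unfolding k1_def by linarith+
  have b: "b > 0" unfolding b_def using \<mu> by (auto intro!: add_nonneg_pos)
  have main: "(norm z)\<^sup>2 \<le> K\<^sup>2 * b * ((norm (S (Q \<mu> z)))\<^sup>2 + \<mu>\<^sup>2 * (norm (Q \<mu> z))\<^sup>2 + (norm (\<Theta> z))\<^sup>2)" for z
  proof -
    define q where "q = Q \<mu> z"
    have q: "potential \<mu> z q" "q \<in> D" using Q[OF \<mu>] Q_D[OF \<mu>] by (auto simp: q_def)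
    define n where "n = norm q + norm (S q)"
    define m where "m = k1 * n + norm (\<Theta> z)"
    have n: "0 \<le> n" by (simp add: n_def)
    have "\<bar>inner z (T w)\<bar> \<le> m * (norm w + norm (S w))" if w: "w \<in> D" for w
    proof -
      have "\<bar>inner (S q) (S w)\<bar> \<le> norm (S q) * norm (S w)" "\<bar>inner q w\<bar> \<le> norm q * norm w"
        by (rule Cauchy_Schwarz_ineq2)+
      then have "\<mu>\<^sup>2 * \<bar>inner q w\<bar> \<le> \<mu>\<^sup>2 * (norm q * norm w)" by (intro mult_left_mono) simp_all
      moreover have "\<bar>inner (C q) w\<bar> \<le> (\<bar>c\<bar> * norm (S q)) * norm w"
        using order_trans[OF Cauchy_Schwarz_ineq2 mult_right_mono[OF order_trans[OF C_bound[OF q(2)]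
              mult_right_mono[OF abs_ge_self]]]] by simp
      then have "\<bar>\<mu>\<bar> * \<bar>inner (C q) w\<bar> \<le> (\<bar>\<mu>\<bar> * \<bar>c\<bar>) * (norm (S q) * norm w)"
        by (simp add: mult.assoc mult_left_mono)
      moreover have "\<bar>inner z (T w)\<bar> \<le> \<bar>inner (S q) (S w)\<bar> + \<bar>\<mu>\<bar> * \<bar>inner (C q) w\<bar> + \<mu>\<^sup>2 * \<bar>inner q w\<bar>"
        unfolding potentialD(2)[OF q(1) w, symmetric]
        by (rule order_trans[OF abs_triangle_ineq] order_trans[OF add_right_mono[OF abs_triangle_ineq4]])+
          (simp add: abs_mult)
      ultimately have "\<bar>inner z (T w)\<bar> \<le> 1 * (norm (S q) * norm (S w)) + (\<bar>\<mu>\<bar> * \<bar>c\<bar>) * (norm (S q) * norm w)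
          + \<mu>\<^sup>2 * (norm q * norm w)"
        using \<open>\<bar>inner (S q) (S w)\<bar> \<le> norm (S q) * norm (S w)\<close> by linarith
      also have "\<dots> \<le> k1 * (norm (S q) * norm (S w)) + k1 * (norm (S q) * norm w) + k1 * (norm q * norm w)"
        using k1 by (intro add_mono mult_right_mono) auto
      also have "\<dots> \<le> k1 * n * (norm w + norm (S w))"
        using k1(1) mult_nonneg_nonneg[of "norm q" "norm (S w)"] by (simp add: n_def algebra_simps)
      also have "\<dots> \<le> m * (norm w + norm (S w))" by (intro mult_right_mono) (auto simp: m_def)
      finally show ?thesis .
    qed
    then have "norm z \<le> K * m" using k1(1) n by (intro K(2)) (auto simp: m_def)
    then have "(norm z)\<^sup>2 \<le> K\<^sup>2 * m\<^sup>2" using power_mono[of "norm z" "K * m" 2] by (simp add: power_mult_distrib)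
    also have "m\<^sup>2 \<le> 2 * k1\<^sup>2 * n\<^sup>2 + 2 * (norm (\<Theta> z))\<^sup>2"
      using zero_le_power2[of "k1 * n - norm (\<Theta> z)"] by (simp add: m_def power2_eq_square algebra_simps)
    also have "\<dots> \<le> b * ((norm (S q))\<^sup>2 + \<mu>\<^sup>2 * (norm q)\<^sup>2 + (norm (\<Theta> z))\<^sup>2)"
    proof -
      define e where "e = (norm (S q))\<^sup>2 + \<mu>\<^sup>2 * (norm q)\<^sup>2"
      define a where "a = min 1 (\<mu>\<^sup>2) / 2"
      have a: "a > 0" using \<mu> by (simp add: a_def)
      have "a * n\<^sup>2 \<le> e" using energy_ge[OF \<mu>, of q] by (simp add: a_def n_def e_def)
      then have "n\<^sup>2 \<le> e / a" using a by (simp add: field_simps)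
      then have "2 * k1\<^sup>2 * n\<^sup>2 \<le> 2 * k1\<^sup>2 * (e / a)" by (intro mult_left_mono) auto
      moreover have "0 \<le> e" by (simp add: e_def)
      moreover have "0 \<le> 2 * k1\<^sup>2 / a * (norm (\<Theta> z))\<^sup>2" using a by simp
      moreover have "b * (e + (norm (\<Theta> z))\<^sup>2) = 2 * k1\<^sup>2 * (e / a) + 2 * k1\<^sup>2 / a * (norm (\<Theta> z))\<^sup>2
          + (2 * e + 2 * (norm (\<Theta> z))\<^sup>2)"
        unfolding b_def a_def[symmetric] by (simp add: algebra_simps add_divide_distrib)
      ultimately show ?thesis unfolding e_def[symmetric] by linarith
    qed
    finally show ?thesis using K(1) by (simp add: q_def mult.assoc)
  qed
  show ?thesis
  proof
    show "inverse (K\<^sup>2 * b) > 0" using K(1) b by simp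
    show "inverse (K\<^sup>2 * b) * (norm z)\<^sup>2 \<le> (norm (S (Q \<mu> z)))\<^sup>2 + \<mu>\<^sup>2 * (norm (Q \<mu> z))\<^sup>2 + (norm (\<Theta> z))\<^sup>2" for z
      using main[of z] K(1) b by (simp add: field_simps)
  qed
qed

text \<open>The operator inequality \<open>\<Theta>\<^sup>2 \<le> K \<Theta>\<close>, by Cauchy--Schwarz for the form of \<open>\<Theta>\<close>.\<close>

lemma \<Theta>_norm:
  obtains K where "K > 0" "\<And>z. (norm (\<Theta> z))\<^sup>2 \<le> K * inner (\<Theta> z) z"
proof -
  interpret nonneg_form "\<lambda>x y. inner (\<Theta> x) y"
  proof
    show "inner (\<Theta> x) y = inner (\<Theta> y) x" for x y by (metis \<Theta>_sym inner_commute)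
  qed (auto simp: \<Theta>_simps inner_add_left \<Theta>_pos)
  obtain K where K: "K > 0" "\<And>z. norm (\<Theta> z) \<le> norm z * K" using bounded_linear.pos_bounded[OF \<Theta>_bl] by blast
  have "(norm (\<Theta> z))\<^sup>2 \<le> K * inner (\<Theta> z) z" for z
  proof -
    have "inner (\<Theta> (\<Theta> z)) (\<Theta> z) \<le> norm (\<Theta> (\<Theta> z)) * norm (\<Theta> z)" by (rule norm_cauchy_schwarz)
    also have "\<dots> \<le> (norm (\<Theta> z) * K) * norm (\<Theta> z)" using K(2) by (intro mult_right_mono) auto
    finally have "inner (\<Theta> (\<Theta> z)) (\<Theta> z) \<le> K * (norm (\<Theta> z))\<^sup>2" by (simp add: power2_eq_square mult_ac)
    then have "((norm (\<Theta> z))\<^sup>2)\<^sup>2 \<le> inner (\<Theta> z) z * (K * (norm (\<Theta> z))\<^sup>2)"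
      using order_trans[OF cauchy_schwarz[of z "\<Theta> z"] mult_left_mono[OF _ \<Theta>_pos]]
      by (simp add: power2_norm_eq_inner)
    then have "(norm (\<Theta> z))\<^sup>2 * (norm (\<Theta> z))\<^sup>2 \<le> (K * inner (\<Theta> z) z) * (norm (\<Theta> z))\<^sup>2"
      by (simp add: power2_eq_square mult_ac)
    then show ?thesis
      using mult_right_le_imp_le[of "(norm (\<Theta> z))\<^sup>2" "(norm (\<Theta> z))\<^sup>2"] by (cases "\<Theta> z = 0") simp_all
  qed
  then show ?thesis using that K(1) by blast
qed

text \<open>The relation \<open>u' = S v - T\<^sup>* z'\<close>, \<open>v' = C v - S u\<close>, with both equations tested against \<open>D\<close>, under the
  constraint that the regularised trace of \<open>u\<close> exists and equals \<open>\<Theta> z\<close>.\<close>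

definition W :: "(('a \<times> 'a \<times> 'h) \<times> ('a \<times> 'a \<times> 'h)) set"
  where "W = {((u, v, z), (u', v', z')).
    (\<forall>w\<in>D. inner u' w = inner v (S w) - inner z' (T w)) \<and>
    (\<forall>w\<in>D. inner v' w = - inner v (C w) - inner u (S w)) \<and>
    ((\<lambda>\<nu>. T (J \<nu> u)) \<longlongrightarrow> \<Theta> z) (at_right 0)}"

text \<open>Subtracting \<open>S q\<close> from \<open>v\<close> and \<open>C q\<close> from \<open>u\<close>, where \<open>q\<close> is the potential of \<open>z'\<close>, removes the
  singular parts: the equation for \<open>q\<close> replaces \<open>T\<^sup>* z'\<close> by vectors of the ambient space, and
  self-adjointness of \<open>S\<close> then puts the remainders into \<open>D\<close>. The left-hand side does not mention \<open>\<mu>\<close>,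
  so the description on the right is the same for all \<open>\<mu> \<noteq> 0\<close>.\<close>

lemma W_explicit:
  assumes \<mu>: "\<mu> \<noteq> 0"
  shows "((u, v, z), (u', v', z')) \<in> W \<longleftrightarrow>
    (\<exists>ul\<in>D. \<exists>vl\<in>D. u = ul + C (Q \<mu> z') \<and> v = vl + S (Q \<mu> z') \<and>
      u' = S vl + \<mu> *\<^sub>R C (Q \<mu> z') - \<mu>\<^sup>2 *\<^sub>R Q \<mu> z' \<and> v' = C vl - S ul \<and>
      ((\<lambda>\<nu>. T (J \<nu> u)) \<longlongrightarrow> \<Theta> z) (at_right 0))"
    (is "?l \<longleftrightarrow> ?r")
proof -
  define q where "q = Q \<mu> z'"
  have q: "q \<in> D" and pot: "w \<in> D \<Longrightarrow> inner z' (T w) = inner (S q) (S w) - \<mu> * inner (C q) w + \<mu>\<^sup>2 * inner q w" for w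
    using potentialD[OF Q[OF \<mu>, of z']] by (auto simp: q_def)
  show ?thesis
  proof
    assume W: ?l
    then have a: "inner u' w = inner v (S w) - inner z' (T w)"
      and b: "inner v' w = - inner v (C w) - inner u (S w)" if "w \<in> D" for w using that by (auto simp: W_def)
    have av: "inner (v - S q) (S w) = inner (u' - \<mu> *\<^sub>R C q + \<mu>\<^sup>2 *\<^sub>R q) w" if "w \<in> D" for w
      using a[OF that] pot[OF that] by (simp add: inner_diff_left inner_add_left)
    have vl: "v - S q \<in> D" and Sv: "S (v - S q) = u' - \<mu> *\<^sub>R C q + \<mu>\<^sup>2 *\<^sub>R q"
      using in_dom[OF av] eqI[OF av] by blast+
    have bu: "inner (u - C q) (S w) = inner (C (v - S q) - v') w" if w: "w \<in> D" for w
    proof -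
      have "inner (C (v - S q)) w = - inner v (C w) + inner (S q) (C w)"
        using C_skew[OF vl w] by (simp add: inner_diff_left)
      then show ?thesis
        using b[OF w] C_commute[OF q w] by (simp add: inner_diff_left)
    qed
    have ul: "u - C q \<in> D" and Su: "S (u - C q) = C (v - S q) - v'"
      using in_dom[OF bu] eqI[OF bu] by blast+
    show ?r unfolding q_def[symmetric]
      using W by (intro bexI[OF _ ul] bexI[OF _ vl]) (auto simp: W_def Su Sv)
  next
    assume ?r
    then obtain ul vl where *: "ul \<in> D" "vl \<in> D" "u = ul + C q" "v = vl + S q"
      "u' = S vl + \<mu> *\<^sub>R C q - \<mu>\<^sup>2 *\<^sub>R q" "v' = C vl - S ul"
      "((\<lambda>\<nu>. T (J \<nu> u)) \<longlongrightarrow> \<Theta> z) (at_right 0)" unfolding q_def by blast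
    have "inner u' w = inner v (S w) - inner z' (T w)" if w: "w \<in> D" for w
      using sym[OF *(2) w] by (simp add: *(4,5) pot[OF w] inner_diff_left inner_add_left)
    moreover have "inner v' w = - inner v (C w) - inner u (S w)" if w: "w \<in> D" for w
      using sym[OF *(1) w] C_skew[OF *(2) w] C_commute[OF q w]
      by (simp add: *(3,4,6) inner_diff_left inner_add_left)
    ultimately show ?l using *(7) by (auto simp: W_def)
  qed
qed

definition form :: "'a \<times> 'a \<times> 'h \<Rightarrow> 'a \<times> 'a \<times> 'h \<Rightarrow> real"
  where "form x y = inner (fst x) (fst y) + inner (fst (snd x)) (fst (snd y)) +
    inner (\<Theta> (snd (snd x))) (snd (snd y))"

lemma nonneg_form: "nonneg_form form"
proof
  show "form x y = form y x" for x y
    by (simp add: form_def inner_commute) (metis \<Theta>_sym inner_commute)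
qed (auto simp: form_def \<Theta>_simps inner_add_left \<Theta>_pos algebra_simps)

lemma form_nondegenerate:
  assumes "\<And>y. form x y = 0"
  shows "x = 0"
proof -
  obtain u v z where x: "x = (u, v, z)" by (cases x)
  have "inner u u + inner v v + inner (\<Theta> z) (\<Theta> z) = 0"
    using assms[of "(u, v, \<Theta> z)"] by (simp add: x form_def)
  then have "inner u u = 0" "inner v v = 0" "inner (\<Theta> z) (\<Theta> z) = 0"
    using inner_ge_zero[of u] inner_ge_zero[of v] inner_ge_zero[of "\<Theta> z"] by linarith+
  then show ?thesis using \<Theta>_inj by (simp add: x zero_prod_def)
qed

lemma subspace_W: "subspace W"
proof -
  have "at_right (0::real) \<noteq> bot" by simp
  show ?thesis
    unfolding subspace_def
  proof (intro conjI ballI allI)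
    have "eventually (\<lambda>\<nu>. T (J \<nu> 0) = 0) (at_right 0)"
      using eventually_pos by eventually_elim (simp add: J_simps T_simps)
    then have "((\<lambda>\<nu>. T (J \<nu> 0)) \<longlongrightarrow> 0) (at_right 0)" by (rule tendsto_eventually)
    then show "0 \<in> W" by (simp add: W_def zero_prod_def \<Theta>_simps)
  next
    fix x y assume xy: "x \<in> W" "y \<in> W"
    obtain u v z u' v' z' where x: "x = ((u, v, z), (u', v', z'))" by (metis surj_pair)
    obtain p q r p' q' r' where y: "y = ((p, q, r), (p', q', r'))" by (metis surj_pair)
    have "((\<lambda>\<nu>. T (J \<nu> u) + T (J \<nu> p)) \<longlongrightarrow> \<Theta> z + \<Theta> r) (at_right 0)"
      using xy by (intro tendsto_add) (auto simp: W_def x y)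
    moreover have "eventually (\<lambda>\<nu>. T (J \<nu> u) + T (J \<nu> p) = T (J \<nu> (u + p))) (at_right 0)"
      using eventually_pos by eventually_elim (simp add: J_simps T_simps J_D)
    ultimately have "((\<lambda>\<nu>. T (J \<nu> (u + p))) \<longlongrightarrow> \<Theta> (z + r)) (at_right 0)"
      unfolding \<Theta>_simps by (rule Lim_transform_eventually)
    then show "x + y \<in> W"
      using xy by (simp add: W_def x y inner_add_left)
  next
    fix a x assume xW: "x \<in> W"
    obtain u v z u' v' z' where x: "x = ((u, v, z), (u', v', z'))" by (metis surj_pair)
    have "((\<lambda>\<nu>. a *\<^sub>R T (J \<nu> u)) \<longlongrightarrow> a *\<^sub>R \<Theta> z) (at_right 0)"
      using xW by (intro tendsto_scaleR tendsto_const) (auto simp: W_def x)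
    moreover have "eventually (\<lambda>\<nu>. a *\<^sub>R T (J \<nu> u) = T (J \<nu> (a *\<^sub>R u))) (at_right 0)"
      using eventually_pos by eventually_elim (simp add: J_simps T_simps J_D)
    ultimately have "((\<lambda>\<nu>. T (J \<nu> (a *\<^sub>R u))) \<longlongrightarrow> \<Theta> (a *\<^sub>R z)) (at_right 0)"
      unfolding \<Theta>_simps by (rule Lim_transform_eventually)
    then show "a *\<^sub>R x \<in> W"
      using xW by (simp add: W_def x right_diff_distrib)
  qed
qed

text \<open>The identity is exact once test vectors are regularised by \<open>J\<close>; the two boundary terms cancel in
  the limit because \<open>T (J \<nu> u)\<close> tends to \<open>\<Theta> z\<close>.\<close>

lemma W_skew:
  assumes "(x, x') \<in> W" "(y, y') \<in> W"
  shows "form x' y + form x y' = 0"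
proof -
  obtain u v z u' v' z' where x: "x = (u, v, z)" "x' = (u', v', z')" by (metis surj_pair)
  obtain p q r p' q' r' where y: "y = (p, q, r)" "y' = (p', q', r')" by (metis surj_pair)
  have X: "\<And>w. w \<in> D \<Longrightarrow> inner u' w = inner v (S w) - inner z' (T w)"
      "\<And>w. w \<in> D \<Longrightarrow> inner v' w = - inner v (C w) - inner u (S w)"
      "((\<lambda>\<nu>. T (J \<nu> u)) \<longlongrightarrow> \<Theta> z) (at_right 0)"
    and Y: "\<And>w. w \<in> D \<Longrightarrow> inner p' w = inner q (S w) - inner r' (T w)"
      "\<And>w. w \<in> D \<Longrightarrow> inner q' w = - inner q (C w) - inner p (S w)"
      "((\<lambda>\<nu>. T (J \<nu> p)) \<longlongrightarrow> \<Theta> r) (at_right 0)"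
    using assms by (auto simp: W_def x y)
  let ?f = "\<lambda>\<nu>. inner u' (J \<nu> p) + inner v' (J \<nu> q) + inner z' (T (J \<nu> p)) +
    (inner p' (J \<nu> u) + inner q' (J \<nu> v) + inner r' (T (J \<nu> u)))"
  have lim: "(?f \<longlongrightarrow> inner u' p + inner v' q + inner z' (\<Theta> r) + (inner p' u + inner q' v + inner r' (\<Theta> z))) (at_right 0)"
    by (intro tendsto_intros J_lim X(3) Y(3))
  have "eventually (\<lambda>\<nu>. ?f \<nu> = 0) (at_right 0)"
    using eventually_pos
  proof eventually_elim
    case (elim \<nu>)
    note JD = J_D[OF elim]
    have "inner v (S (J \<nu> p)) = inner p (S (J \<nu> v))" "inner q (S (J \<nu> u)) = inner u (S (J \<nu> q))"
      "inner v (C (J \<nu> q)) = - inner q (C (J \<nu> v))"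
      using SJ_sym[OF elim, of v p] SJ_sym[OF elim, of q u] CJ_skew[OF elim, of v q]
        inner_commute[of p] inner_commute[of u] inner_commute[of q] by simp_all
    then show ?case by (simp add: X(1,2) Y(1,2) JD)
  qed
  then have "(?f \<longlongrightarrow> 0) (at_right 0)" by (rule tendsto_eventually)
  then have "inner u' p + inner v' q + inner z' (\<Theta> r) + (inner p' u + inner q' v + inner r' (\<Theta> z)) = 0"
    using lim by (intro tendsto_unique[of "at_right (0::real)"]) auto
  moreover have "form x' y = inner u' p + inner v' q + inner z' (\<Theta> r)"
    by (simp add: form_def x y \<Theta>_sym)
  moreover have "form x y' = inner p' u + inner q' v + inner r' (\<Theta> z)"
    by (simp add: form_def x y inner_commute)
  ultimately show ?thesis by simp
qed

text \<open>Eliminating \<open>u\<close> and \<open>v\<close> from the resolvent equation leaves, for the point variable,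
  \<open>\<Theta> z + \<mu>\<^sup>2 T (Q z) - \<mu> \<Gamma> z = y\<close> with \<open>\<Gamma> z\<close> the limit of \<open>T (J \<nu> (C (Q z)))\<close>. The quadratic form of
  its left-hand side is \<open>\<langle>\<Theta> z, z\<rangle> + \<mu>\<^sup>2 (|S q|\<^sup>2 + \<mu>\<^sup>2 |q|\<^sup>2 + |C q|\<^sup>2)\<close>, \<open>q = Q z\<close>, and \<open>\<Gamma>\<close> is
  bounded as a pointwise limit of bounded operators.\<close>

lemma point_equation:
  assumes \<mu>: "\<mu> \<noteq> 0"
  obtains z l where "((\<lambda>\<nu>. T (J \<nu> (C (Q \<mu> z)))) \<longlongrightarrow> l) (at_right 0)"
    "\<Theta> z + \<mu>\<^sup>2 *\<^sub>R T (Q \<mu> z) - \<mu> *\<^sub>R l = y"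
proof -
  note QD = Q_D[OF \<mu>]
  have "\<exists>l. ((\<lambda>\<nu>. T (J \<nu> (C (Q \<mu> z)))) \<longlongrightarrow> l) (at_right 0)" for z
    using lim_C[OF \<mu> QD potentialD(2)[OF Q[OF \<mu>]]] .
  then obtain \<Gamma> where \<Gamma>: "\<And>z. ((\<lambda>\<nu>. T (J \<nu> (C (Q \<mu> z)))) \<longlongrightarrow> \<Gamma> z) (at_right 0)" by metis
  define \<nu> where "\<nu> n = inverse (real (Suc n))" for n
  have \<nu>: "\<nu> n > 0" for n by (simp add: \<nu>_def)
  have \<nu>_lim: "filterlim \<nu> (at_right 0) sequentially"
    unfolding filterlim_at using LIMSEQ_inverse_real_of_nat \<nu> by (auto simp: \<nu>_def[abs_def])
  define \<Gamma>n where "\<Gamma>n n z = T (J (\<nu> n) (C (Q \<mu> z)))" for n z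
  have \<Gamma>n: "(\<lambda>n. \<Gamma>n n z) \<longlonglongrightarrow> \<Gamma> z" for z
    unfolding \<Gamma>n_def using filterlim_compose[OF \<Gamma> \<nu>_lim] .
  obtain KQ where KQ: "\<And>z. norm (Q \<mu> z) + norm (S (Q \<mu> z)) \<le> KQ * norm z"
    by (rule Q_bound[OF \<mu>]) (rule that)
  have CQ: "bounded_linear (\<lambda>z. C (Q \<mu> z))"
  proof (rule bounded_linear_intro)
    show "norm (C (Q \<mu> z)) \<le> norm z * (\<bar>c\<bar> * KQ)" for z
    proof -
      have "norm (C (Q \<mu> z)) \<le> c * norm (S (Q \<mu> z))" by (rule C_bound[OF QD])
      also have "\<dots> \<le> \<bar>c\<bar> * (KQ * norm z)"
        using KQ[of z] norm_ge_zero[of "Q \<mu> z"] norm_ge_zero[of "S (Q \<mu> z)"]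
        by (intro mult_mono) linarith+
      finally show ?thesis by (simp add: mult_ac)
    qed
  qed (auto simp: Q_add[OF \<mu>] Q_scale[OF \<mu>] C_simps QD)
  have TQ: "bounded_linear (\<lambda>z. T (Q \<mu> z))"
  proof (rule bounded_linear_intro)
    show "norm (T (Q \<mu> z)) \<le> norm z * (\<bar>k\<bar> * KQ)" for z
    proof -
      have "norm (T (Q \<mu> z)) \<le> k * (norm (Q \<mu> z) + norm (S (Q \<mu> z)))" by (rule T_bound[OF QD])
      also have "\<dots> \<le> \<bar>k\<bar> * (KQ * norm z)" using KQ by (intro mult_mono) auto
      finally show ?thesis by (simp add: mult_ac)
    qed
  qed (auto simp: Q_add[OF \<mu>] Q_scale[OF \<mu>] T_simps QD)
  have bl\<Gamma>n: "bounded_linear (\<Gamma>n n)" for n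
    unfolding \<Gamma>n_def[abs_def] by (rule bounded_linear_compose[OF TJ_bl[OF \<nu>] CQ])
  have "\<exists>K. \<forall>f\<in>range \<Gamma>n. norm (f z) \<le> K" for z
    using convergent_imp_Bseq[OF convergentI[OF \<Gamma>n[of z]]] by (auto simp: Bseq_def)
  then obtain K where K: "\<And>f z. f \<in> range \<Gamma>n \<Longrightarrow> norm (f z) \<le> K * norm z"
    using uniform_boundedness[of "range \<Gamma>n"] bl\<Gamma>n by blast
  have \<Gamma>_bl: "bounded_linear \<Gamma>"
  proof (rule bounded_linear_intro)
    interpret L: bounded_linear "\<Gamma>n n" for n by (rule bl\<Gamma>n)
    show "\<Gamma> (x + y) = \<Gamma> x + \<Gamma> y" for x y
      using tendsto_add[OF \<Gamma>n[of x] \<Gamma>n[of y]] \<Gamma>n[of "x + y"] by (simp add: L.add LIMSEQ_unique)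
    show "\<Gamma> (r *\<^sub>R x) = r *\<^sub>R \<Gamma> x" for r x
      using tendsto_scaleR[OF tendsto_const \<Gamma>n[of x], of r] \<Gamma>n[of "r *\<^sub>R x"] by (simp add: L.scaleR LIMSEQ_unique)
    show "norm (\<Gamma> x) \<le> norm x * K" for x
      by (rule LIMSEQ_le_const2[OF tendsto_norm[OF \<Gamma>n]]) (use K in \<open>auto simp: mult.commute\<close>)
  qed
  have \<Gamma>_form: "inner z (\<Gamma> z) = - \<mu> * (norm (C (Q \<mu> z)))\<^sup>2" for z
  proof -
    let ?q = "Q \<mu> z"
    let ?f = "\<lambda>\<nu>. - \<mu> * inner (C ?q) (J \<nu> (C ?q)) + \<mu>\<^sup>2 * inner ?q (J \<nu> (C ?q))"
    have "(?f \<longlongrightarrow> - \<mu> * inner (C ?q) (C ?q) + \<mu>\<^sup>2 * inner ?q (C ?q)) (at_right 0)"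
      by (intro tendsto_intros J_lim)
    then have "(?f \<longlongrightarrow> - \<mu> * (norm (C ?q))\<^sup>2) (at_right 0)"
      using C_diag[OF QD, of z] by (simp add: power2_norm_eq_inner inner_commute)
    moreover have "eventually (\<lambda>\<nu>. ?f \<nu> = inner z (T (J \<nu> (C ?q)))) (at_right 0)"
      using eventually_pos
    proof eventually_elim
      case (elim \<nu>)
      have "inner (S ?q) (S (J \<nu> (C ?q))) = inner (S (J \<nu> (S ?q))) (C ?q)" by (rule SJ_sym[OF elim])
      also have "\<dots> = - inner (C (J \<nu> (S ?q))) (S ?q)" by (rule C_commute[OF J_D[OF elim] QD])
      also have "\<dots> = 0" using CJ_skew[OF elim, of "S ?q" "S ?q"] by (simp add: inner_commute)
      finally show ?case using potentialD(2)[OF Q[OF \<mu>] J_D[OF elim], of z "C ?q"] by simp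
    qed
    ultimately have "((\<lambda>\<nu>. inner z (T (J \<nu> (C ?q)))) \<longlongrightarrow> - \<mu> * (norm (C ?q))\<^sup>2) (at_right 0)"
      by (rule Lim_transform_eventually)
    moreover have "((\<lambda>\<nu>. inner z (T (J \<nu> (C ?q)))) \<longlongrightarrow> inner z (\<Gamma> z)) (at_right 0)"
      by (intro tendsto_intros \<Gamma>)
    ultimately show ?thesis by (intro tendsto_unique[of "at_right (0::real)"]) auto
  qed
  define M where "M z = \<Theta> z + \<mu>\<^sup>2 *\<^sub>R T (Q \<mu> z) - \<mu> *\<^sub>R \<Gamma> z" for z
  have M: "bounded_linear M"
    unfolding M_def[abs_def]
    by (intro bounded_linear_sub bounded_linear_add \<Theta>_bl bounded_linear_scaleR_right[THEN bounded_linear_compose] TQ \<Gamma>_bl)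
  have M_form: "inner (M z) z = inner (\<Theta> z) z + \<mu>\<^sup>2 * ((norm (S (Q \<mu> z)))\<^sup>2 + \<mu>\<^sup>2 * (norm (Q \<mu> z))\<^sup>2)
      + \<mu>\<^sup>2 * (norm (C (Q \<mu> z)))\<^sup>2" for z
    using \<Gamma>_form[of z] potential_diag[OF Q[OF \<mu>], of z]
    by (simp add: M_def inner_diff_right inner_add_right inner_commute[of _ z] power2_eq_square algebra_simps)
  obtain a where a: "a > 0"
    "\<And>z. a * (norm z)\<^sup>2 \<le> (norm (S (Q \<mu> z)))\<^sup>2 + \<mu>\<^sup>2 * (norm (Q \<mu> z))\<^sup>2 + (norm (\<Theta> z))\<^sup>2"
    by (rule potential_coercive[OF \<mu>]) (rule that)
  obtain K\<Theta> where K\<Theta>: "K\<Theta> > 0" "\<And>z. (norm (\<Theta> z))\<^sup>2 \<le> K\<Theta> * inner (\<Theta> z) z"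
    by (rule \<Theta>_norm) (rule that)
  define d where "d = min (\<mu>\<^sup>2) (inverse K\<Theta>)"
  have d: "d > 0" "d \<le> \<mu>\<^sup>2" "d * K\<Theta> \<le> 1" using \<mu> K\<Theta>(1) by (auto simp: d_def min_def field_simps)
  have coer: "(d * a) * (norm z)\<^sup>2 \<le> inner (M z) z" for z
  proof -
    let ?e = "(norm (S (Q \<mu> z)))\<^sup>2 + \<mu>\<^sup>2 * (norm (Q \<mu> z))\<^sup>2"
    have "d * (a * (norm z)\<^sup>2) \<le> d * (?e + (norm (\<Theta> z))\<^sup>2)" using a(2) d(1) by (intro mult_left_mono) auto
    also have "\<dots> \<le> d * ?e + d * (K\<Theta> * inner (\<Theta> z) z)"
      using K\<Theta>(2)[of z] d(1) by (simp add: distrib_left)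
    also have "\<dots> \<le> \<mu>\<^sup>2 * ?e + 1 * inner (\<Theta> z) z"
    proof (intro add_mono mult_right_mono d)
      show "d * (K\<Theta> * inner (\<Theta> z) z) \<le> 1 * inner (\<Theta> z) z"
        using mult_right_mono[OF d(3) \<Theta>_pos[of z]] by (simp add: mult.assoc)
    qed simp
    also have "\<dots> \<le> inner (M z) z" unfolding M_form by simp
    finally show ?thesis by (simp add: mult.assoc)
  qed
  obtain KM where KM: "\<And>z. norm (M z) \<le> KM * norm z"
    using bounded_linear.bounded[OF M] by (metis mult.commute)
  obtain z where z: "\<And>w. inner (M z) w = inner y w"
    using lax_milgram[OF linear_imp_lin_on[OF bounded_linear.linear[OF M]] closed_UNIV KM _ coer, of y] a(1) d(1) by auto
  have "M z = y" by (rule dense_inner_eq[OF closure_UNIV]) (rule z)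
  then show ?thesis using that \<Gamma> by (auto simp: M_def)
qed

text \<open>The regular parts solve the resolvent equation of \<open>(u, v) \<mapsto> (S v, C v - S u)\<close>: eliminating \<open>u\<close> gives
  the weak equation for \<open>v\<close> below. The potential of \<open>z'\<close> is then added, and \<open>z'\<close> is determined by the
  constraint.\<close>

lemma W_surj:
  assumes \<mu>: "\<mu> \<noteq> 0"
  obtains x x' where "(x, x') \<in> W" "\<mu> *\<^sub>R x - x' = y"
proof -
  obtain f g \<kappa> where y: "y = (f, g, \<kappa>)" by (cases y)
  have l: "lin_on D (\<lambda>w. \<mu> * inner g w - inner f (S w))"
    using subspace_D by (auto simp: lin_on_def S_simps inner_add_right algebra_simps)
  have lb: "\<bar>\<mu> * inner g w - inner f (S w)\<bar> \<le> (\<bar>\<mu>\<bar> * norm g + norm f) * (norm w + norm (S w))" for w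
  proof -
    have "\<bar>\<mu> * inner g w\<bar> \<le> \<bar>\<mu>\<bar> * (norm g * norm w)"
      unfolding abs_mult by (intro mult_left_mono Cauchy_Schwarz_ineq2) simp
    moreover have "\<bar>inner f (S w)\<bar> \<le> norm f * norm (S w)" by (rule Cauchy_Schwarz_ineq2)
    moreover have "0 \<le> \<bar>\<mu>\<bar> * (norm g * norm (S w))" "0 \<le> norm f * norm w" by simp_all
    moreover have "(\<bar>\<mu>\<bar> * norm g + norm f) * (norm w + norm (S w)) = \<bar>\<mu>\<bar> * (norm g * norm w)
        + \<bar>\<mu>\<bar> * (norm g * norm (S w)) + norm f * norm w + norm f * norm (S w)"
      by (simp add: algebra_simps)
    ultimately show ?thesis
      using abs_triangle_ineq4[of "\<mu> * inner g w" "inner f (S w)"] by linarith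
  qed
  obtain v where v: "v \<in> D" "\<And>w. w \<in> D \<Longrightarrow>
      inner (S v) (S w) - \<mu> * inner (C v) w + \<mu>\<^sup>2 * inner v w = \<mu> * inner g w - inner f (S w)"
    using form_solution[OF C_lin C_skew C_bound \<mu> l lb] by blast
  have weak: "inner (f + S v) (S w) = inner (\<mu> *\<^sub>R g - \<mu>\<^sup>2 *\<^sub>R v + \<mu> *\<^sub>R C v) w" if "w \<in> D" for w
    using v(2)[OF that] by (simp add: inner_add_left inner_diff_left)
  have fD: "f + S v \<in> D" and Sf: "S (f + S v) = \<mu> *\<^sub>R g - \<mu>\<^sup>2 *\<^sub>R v + \<mu> *\<^sub>R C v"
    using in_dom[OF weak] eqI[OF weak] by blast+
  define u where "u = inverse \<mu> *\<^sub>R (f + S v)"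
  have u: "u \<in> D" "\<mu> *\<^sub>R u = f + S v" using fD \<mu> by (auto simp: u_def D_closed)
  have Su: "S u = g - \<mu> *\<^sub>R v + C v"
  proof -
    have "S u = inverse \<mu> *\<^sub>R (\<mu> *\<^sub>R g - \<mu>\<^sup>2 *\<^sub>R v + \<mu> *\<^sub>R C v)"
      unfolding u_def S_simps(2)[OF fD] Sf ..
    then show ?thesis using \<mu> by (simp add: scaleR_diff_right scaleR_add_right power2_eq_square)
  qed
  obtain z l where z: "((\<lambda>\<nu>. T (J \<nu> (C (Q \<mu> z)))) \<longlongrightarrow> l) (at_right 0)"
    "\<Theta> z + \<mu>\<^sup>2 *\<^sub>R T (Q \<mu> z) - \<mu> *\<^sub>R l = \<mu> *\<^sub>R T u - \<Theta> \<kappa>" by (rule point_equation[OF \<mu>]) (rule that)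
  define q where "q = Q \<mu> z"
  have q: "q \<in> D" using Q_D[OF \<mu>] by (simp add: q_def)
  define ul where "ul = u - \<mu> *\<^sub>R q"
  have ul: "ul \<in> D" using u q by (simp add: ul_def D_closed)
  define \<zeta> where "\<zeta> = inverse \<mu> *\<^sub>R (z + \<kappa>)"
  have "((\<lambda>\<nu>. T (J \<nu> ul) + T (J \<nu> (C q))) \<longlongrightarrow> T ul + l) (at_right 0)"
    using z(1) by (intro tendsto_add T_smooth ul) (simp add: q_def)
  moreover have "eventually (\<lambda>\<nu>. T (J \<nu> ul) + T (J \<nu> (C q)) = T (J \<nu> (ul + C q))) (at_right 0)"
    using eventually_pos by eventually_elim (simp add: J_simps T_simps J_D)
  ultimately have "((\<lambda>\<nu>. T (J \<nu> (ul + C q))) \<longlongrightarrow> T ul + l) (at_right 0)"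
    by (rule Lim_transform_eventually)
  moreover have "T ul + l = \<Theta> \<zeta>"
  proof -
    have "\<mu> *\<^sub>R (T ul + l) = \<Theta> z + \<Theta> \<kappa>"
      using z(2) u q by (simp add: ul_def T_simps D_closed q_def[symmetric] scaleR_diff_right
          scaleR_add_right power2_eq_square algebra_simps)
    also have "\<dots> = \<mu> *\<^sub>R \<Theta> \<zeta>" using \<mu> by (simp add: \<zeta>_def \<Theta>_simps)
    finally show ?thesis using \<mu> by simp
  qed
  ultimately have lim: "((\<lambda>\<nu>. T (J \<nu> (ul + C q))) \<longlongrightarrow> \<Theta> \<zeta>) (at_right 0)" by simp
  have "((ul + C q, v + S q, \<zeta>), (S v + \<mu> *\<^sub>R C q - \<mu>\<^sup>2 *\<^sub>R q, C v - S ul, z)) \<in> W"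
    unfolding W_explicit[OF \<mu>] q_def[symmetric] using ul v(1) lim by blast
  moreover have "\<mu> *\<^sub>R (ul + C q, v + S q, \<zeta>) - (S v + \<mu> *\<^sub>R C q - \<mu>\<^sup>2 *\<^sub>R q, C v - S ul, z) = y"
    using u \<mu> q by (simp add: y ul_def S_simps Su D_closed \<zeta>_def power2_eq_square algebra_simps)
  ultimately show ?thesis using that by blast
qed

text \<open>The argument is algebraic: surjectivity at \<open>1\<close> yields a candidate \<open>z\<close> in the domain, surjectivity at
  \<open>- 1\<close> shows that \<open>x - z\<close> is orthogonal to everything. It therefore applies to an incomplete form.\<close>

lemma W_maximal:
  assumes "\<And>y y'. (y, y') \<in> W \<Longrightarrow> form x y' = form x' y"
  shows "(x, - x') \<in> W"
proof -
  interpret nonneg_form form by (rule nonneg_form)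
  obtain z z' where z: "(z, z') \<in> W" "1 *\<^sub>R z - z' = x + x'" by (rule W_surj) (auto intro: that)
  have "form (x - z) y = 0" for y
  proof -
    obtain t t' where t: "(t, t') \<in> W" "(- 1) *\<^sub>R t - t' = y" by (rule W_surj[of "-1"]) (auto intro: that)
    have "form (x - z) t' = form x' t + form z' t"
      using assms[OF t(1)] W_skew[OF z(1) t(1)] by (simp add: diff_left)
    also have "\<dots> = form (z - x) t"
    proof -
      have "x' + z' = z - x" using z(2) by (simp add: algebra_simps)
      then show ?thesis by (simp add: add_left[symmetric])
    qed
    finally show ?thesis by (simp add: t(2)[symmetric] expand)
  qed
  then have "x - z = 0" by (rule form_nondegenerate)
  moreover from this have "z' = - x'" using z(2) by (simp add: minus_equation_iff)
  ultimately show ?thesis using z(1) by simp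
qed

text \<open>Over the zero vector the first equation reads \<open>u' = - T\<^sup>* z'\<close>, which roughness excludes unless
  \<open>z' = 0\<close>.\<close>

lemma W_single_valued:
  assumes "(x, y) \<in> W" "(x, y') \<in> W"
  shows "y = y'"
proof -
  have "(x, y) - (x, y') \<in> W" using assms subspace_W by (intro subspace_diff)
  then have W: "(0, y - y') \<in> W" by simp
  obtain u v z where d: "y - y' = (u, v, z)" by (cases "y - y'")
  have 1: "inner u w = - inner z (T w)" "inner v w = 0" if "w \<in> D" for w
    using W that by (auto simp: W_def d zero_prod_def)
  have z: "z = 0" by (rule T_rough[of z "- u"]) (simp add: 1)
  have "u = 0" "v = 0" using 1 z by (auto intro!: dense_inner_eq[OF dense])
  then have "y - y' = 0" using z d by (simp add: zero_prod_def)
  then show ?thesis by simp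
qed

text \<open>A functional on the pairs \<open>(u, z)\<close> that vanishes where \<open>T u = \<Theta> z\<close> is \<open>\<langle>\<omega>, T u - \<Theta> z\<rangle>\<close> for some
  \<open>\<omega>\<close>, which is obtained from a coercive equation. If the functional is also bounded in \<open>u\<close> for the
  norm of the ambient space, then \<open>\<omega> = 0\<close> by roughness.\<close>

lemma dense_constraint:
  assumes e: "e > 0"
  shows "\<exists>n\<in>{(u, v, z). u \<in> D \<and> v \<in> D \<and> T u = \<Theta> z}. form (x - n) (x - n) < e"
proof -
  interpret nonneg_form form by (rule nonneg_form)
  let ?N = "{(u, v, z). u \<in> D \<and> v \<in> D \<and> T u = \<Theta> z}"
  have N: "subspace ?N"
    unfolding subspace_def by (auto simp: zero_prod_def D_closed T_simps \<Theta>_simps)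
  show ?thesis
  proof (rule approx_if_functionals_vanish[OF N _ e])
    fix f :: "'a \<times> 'a \<times> 'h \<Rightarrow> real"
    assume f: "linear f" and "\<exists>K. \<forall>z. (f z)\<^sup>2 \<le> K * form z z" and van: "\<forall>n\<in>?N. f n = 0"
    then obtain K where K: "\<And>z. (f z)\<^sup>2 \<le> K * form z z" by blast
    obtain K\<Theta> where K\<Theta>: "K\<Theta> > 0" "\<And>z. norm (\<Theta> z) \<le> norm z * K\<Theta>"
      using bounded_linear.pos_bounded[OF \<Theta>_bl] by blast
    have bnd: "\<bar>g t\<bar> \<le> sqrt (\<bar>K\<bar> * b) * norm t"
      if "\<And>t. (g t)\<^sup>2 \<le> K * m t" "\<And>t. 0 \<le> m t" "\<And>t. m t \<le> b * (norm t)\<^sup>2"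
      for g :: "'z::real_normed_vector \<Rightarrow> real" and m b t
    proof -
      have "(g t)\<^sup>2 \<le> \<bar>K\<bar> * m t" using order_trans[OF that(1) mult_right_mono[OF abs_ge_self that(2)]] .
      also have "\<dots> \<le> \<bar>K\<bar> * (b * (norm t)\<^sup>2)" by (intro mult_left_mono that) simp
      finally have "sqrt ((g t)\<^sup>2) \<le> sqrt (\<bar>K\<bar> * b * (norm t)\<^sup>2)"
        unfolding mult.assoc by (rule real_sqrt_le_mono)
      then show ?thesis by (simp add: real_sqrt_mult)
    qed
    have lin1: "lin_on UNIV (\<lambda>u. f (u, 0, 0))" and lin2: "lin_on UNIV (\<lambda>v. f (0, v, 0))"
      and lin3: "lin_on UNIV (\<lambda>z. f (0, 0, z))"
      using linear_add[OF f] linear_scale[OF f]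
      by (auto simp: lin_on_def) (metis add_Pair add_0_left scaleR_Pair scaleR_zero_right)+
    have "\<bar>f (u, 0, 0)\<bar> \<le> sqrt (\<bar>K\<bar> * 1) * norm u" for u
      by (rule bnd[of _ "\<lambda>u. inner u u"]) (use K[of "(_, 0, 0)"] in \<open>auto simp: form_def power2_norm_eq_inner \<Theta>_simps\<close>)
    then obtain x1 where x1: "\<And>u. inner x1 u = f (u, 0, 0)" using riesz_subspace[OF lin1] by (metis UNIV_I)
    have "\<bar>f (0, v, 0)\<bar> \<le> sqrt (\<bar>K\<bar> * 1) * norm v" for v
      by (rule bnd[of _ "\<lambda>u. inner u u"]) (use K[of "(0, _, 0)"] in \<open>auto simp: form_def power2_norm_eq_inner \<Theta>_simps\<close>)
    then obtain x2 where x2: "\<And>u. inner x2 u = f (0, u, 0)" using riesz_subspace[OF lin2] by (metis UNIV_I)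
    have "inner (\<Theta> z) z \<le> K\<Theta> * (norm z)\<^sup>2" for z
      using order_trans[OF norm_cauchy_schwarz mult_right_mono[OF K\<Theta>(2) norm_ge_zero]]
      by (simp add: power2_eq_square mult_ac)
    then have "\<bar>f (0, 0, z)\<bar> \<le> sqrt (\<bar>K\<bar> * K\<Theta>) * norm z" for z
      by (intro bnd[of _ "\<lambda>z. inner (\<Theta> z) z"]) (use K[of "(0, 0, _)"] in \<open>auto simp: form_def \<Theta>_pos\<close>)
    then obtain p where p: "\<And>z. inner p z = f (0, 0, z)" using riesz_subspace[OF lin3] by (metis UNIV_I)
    have f_eq: "f (u, v, z) = inner x1 u + inner x2 v + inner p z" for u v z
      using linear_add[OF f, of "(u, 0, 0)" "(0, v, z)"] linear_add[OF f, of "(0, v, 0)" "(0, 0, z)"]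
      by (simp add: x1 x2 p)
    have "inner x2 w = inner 0 w" if "w \<in> D" for w
      using bspec[OF van, of "(0, w, 0)"] f_eq[of 0 w 0] that by (simp add: D_closed T_simps \<Theta>_simps)
    then have "x2 = 0" by (rule dense_inner_eq[OF dense])
    have one: "(1::real) \<noteq> 0" by simp
    have "lin_on D (inner x1)" using subspace_D by (auto simp: lin_on_def inner_add_right)
    moreover have "\<bar>inner x1 w\<bar> \<le> norm x1 * (norm w + norm (S w))" for w
      using Cauchy_Schwarz_ineq2[of x1 w] by (simp add: algebra_simps add_increasing2)
    ultimately obtain r where r: "r \<in> D"
      "\<And>w. w \<in> D \<Longrightarrow> inner (S r) (S w) - 1 * inner (C r) w + 1\<^sup>2 * inner r w = inner x1 w"
      using form_solution[OF C_lin C_skew C_bound one] by blast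
    obtain KQ where KQ: "\<And>z. norm (Q 1 z) + norm (S (Q 1 z)) \<le> KQ * norm z"
      by (rule Q_bound[OF one]) (rule that)
    \<comment> \<open>\<open>M\<close> is \<open>(w, z) \<mapsto> T w - \<Theta> z\<close> after a substitute for its adjoint, \<open>z \<mapsto> (Q 1 z, - \<Theta> z)\<close>.\<close>
    define M where "M z = T (Q 1 z) + \<Theta> (\<Theta> z)" for z
    have M: "lin_on UNIV M"
      by (auto simp: lin_on_def M_def Q_add[OF one] Q_scale[OF one] T_simps Q_D[OF one] \<Theta>_simps algebra_simps)
    have M_bnd: "norm (M z) \<le> (\<bar>k\<bar> * KQ + K\<Theta> * K\<Theta>) * norm z" for z
    proof -
      have "norm (T (Q 1 z)) \<le> k * (norm (Q 1 z) + norm (S (Q 1 z)))" by (rule T_bound[OF Q_D[OF one]])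
      also have "\<dots> \<le> \<bar>k\<bar> * (KQ * norm z)" using KQ by (intro mult_mono) auto
      finally have "norm (T (Q 1 z)) \<le> \<bar>k\<bar> * KQ * norm z" by simp
      moreover have "norm (\<Theta> (\<Theta> z)) \<le> (norm z * K\<Theta>) * K\<Theta>"
        using order_trans[OF K\<Theta>(2)[of "\<Theta> z"] mult_right_mono[OF K\<Theta>(2)]] K\<Theta>(1) by simp
      ultimately show ?thesis
        using norm_triangle_ineq[of "T (Q 1 z)" "\<Theta> (\<Theta> z)"] by (simp add: M_def algebra_simps)
    qed
    obtain a where a: "a > 0"
      "\<And>z. a * (norm z)\<^sup>2 \<le> (norm (S (Q 1 z)))\<^sup>2 + 1\<^sup>2 * (norm (Q 1 z))\<^sup>2 + (norm (\<Theta> z))\<^sup>2"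
      by (rule potential_coercive[OF one]) (rule that)
    have M_form: "a * (norm z)\<^sup>2 \<le> inner (M z) z" for z
      using a(2)[of z] potential_diag[OF Q[OF one], of z] \<Theta>_sym[of "\<Theta> z" z]
        inner_commute[of "T (Q 1 z)" z]
      by (simp add: M_def inner_add_left power2_norm_eq_inner)
    obtain \<omega> where "\<And>w. inner (M \<omega>) w = inner (T r - \<Theta> p) w"
      using lax_milgram[OF M closed_UNIV M_bnd a(1) M_form, of "T r - \<Theta> p"] by auto
    then have \<omega>: "M \<omega> = T r - \<Theta> p" using dense_inner_eq[OF closure_UNIV] by blast
    define u where "u = r - Q 1 \<omega>"
    define z where "z = p + \<Theta> \<omega>"
    have u: "u \<in> D" using r(1) Q_D[OF one] by (simp add: u_def D_closed)
    have Tu: "T u = \<Theta> z"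
      using \<omega> r(1) Q_D[OF one] by (simp add: u_def z_def M_def T_simps \<Theta>_simps algebra_simps)
    have "f (u, 0, z) = 0" using van u Tu by (auto simp: D_closed)
    then have e1: "inner x1 u + inner p z = 0" by (simp add: f_eq)
    have e2: "inner (S (Q 1 \<omega>)) (S u) - inner (C (Q 1 \<omega>)) u + inner (Q 1 \<omega>) u = inner (\<Theta> \<omega>) z"
      using potentialD(2)[OF Q[OF one] u, of \<omega>] by (simp add: Tu \<Theta>_sym)
    have "inner (S u) (S u) - inner (C u) u + inner u u + inner z z = 0"
    proof -
      have "S u = S r - S (Q 1 \<omega>)" "C u = C r - C (Q 1 \<omega>)"
        using r(1) Q_D[OF one] by (simp_all add: u_def S_simps C_simps)
      then have "inner (S u) (S u) - inner (C u) u + inner u u + inner z z =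
          (inner (S r) (S u) - inner (C r) u + inner r u + inner p z) -
          (inner (S (Q 1 \<omega>)) (S u) - inner (C (Q 1 \<omega>)) u + inner (Q 1 \<omega>) u - inner (\<Theta> \<omega>) z)"
        by (simp only: u_def[symmetric] inner_diff_left z_def inner_add_left) (simp add: u_def inner_diff_left)
      then show ?thesis using e1 e2 r(2)[OF u] by simp
    qed
    then have "inner u u = 0" "inner z z = 0"
      using C_diag[OF u] inner_ge_zero[of "S u"] inner_ge_zero[of u] inner_ge_zero[of z] by linarith+
    then have ru: "r = Q 1 \<omega>" and pz: "p = - \<Theta> \<omega>" by (auto simp: u_def z_def eq_neg_iff_add_eq_0)
    have "\<omega> = 0"
      by (rule T_rough[of \<omega> x1]) (use potentialD(2)[OF Q[OF one], of _ \<omega>] r(2) ru in simp)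
    then have "p = 0" "r = 0" using pz ru Q_scale[OF one, of 0 0] by (simp_all add: \<Theta>_simps)
    have "x1 = 0"
      by (rule dense_inner_eq[OF dense]) (use r(2) in \<open>simp add: \<open>r = 0\<close> S_simps C_simps\<close>)
    show "f x = 0" by (cases x) (simp add: f_eq \<open>x1 = 0\<close> \<open>x2 = 0\<close> \<open>p = 0\<close>)
  qed
qed

end

section \<open>From scalar products to real inner products\<close>

lemma of_real_kre: "of_real (kre a) = (a + kcnj (a::'k::rc_field)) / 2"
  using kre[of a] by (simp add: scaleR_conv_of_real)

lemma kre_add: "kre (a + b) = kre a + kre (b::'k::rc_field)"
proof -
  have "of_real (kre (a + b)) = (of_real (kre a + kre b) :: 'k)"
    by (simp add: of_real_kre kcnj_add add_divide_distrib)
  then show ?thesis by (simp only: of_real_eq_iff)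
qed

lemma kre_diff: "kre (a - b) = kre a - kre (b::'k::rc_field)"
  using kre_add[of "a - b" b] by simp

text \<open>The real parts of all multiples of a scalar determine it. For operators that commute with
  scalars, identities between scalar products can therefore be checked on real parts.\<close>

lemma kre_mult_eqI:
  assumes "\<And>c. kre (c * a) = kre (c * (b::'k::rc_field))"
  shows "a = b"
proof -
  define z where "z = a - b"
  have real: "kcnj (kcnj z * z) = kcnj z * z" by (simp add: kcnj_mult kcnj_kcnj mult.commute)
  have re: "kre (kcnj z * z) = 0" using assms[of "kcnj z"] by (simp add: z_def right_diff_distrib kre_diff)
  have "of_real ((norm z)\<^sup>2) = z * kcnj z" by (simp add: mult_kcnj scaleR_conv_of_real)
  also have "\<dots> = kcnj z * z" by (rule mult.commute)
  also have "\<dots> = of_real (kre (kcnj z * z))" unfolding of_real_kre real by simp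
  also have "\<dots> = 0" unfolding re by simp
  finally have "z = 0" by simp
  then show ?thesis by (simp add: z_def)
qed

context hilbert_space
begin

lemma ip_norm_eq: "ip_norm ip x = norm x"
  by (simp add: ip_norm_def kre_ip norm_eq_sqrt_inner)

lemma inner_sc_left: "inner (sc c x) y = inner x (sc (kcnj c) y)"
proof -
  have "ip (sc c x) y = kcnj c * ip x y"
    by (metis ip_cnj ip_scale_right kcnj_mult)
  then show ?thesis by (simp add: ip_scale_right flip: kre_ip)
qed

lemma norm_sc: "norm (sc c x) = norm c * norm x"
proof -
  have "inner (sc c x) (sc c x) = inner x (sc (kcnj c * c) x)"
    by (simp add: inner_sc_left)
  also have "kcnj c * c = of_real ((norm c)\<^sup>2)"
    using mult_kcnj[of c] by (simp add: mult.commute scaleR_conv_of_real)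
  also have "inner x (sc (of_real ((norm c)\<^sup>2)) x) = (norm c)\<^sup>2 * inner x x"
    by (simp only: scale_of_real inner_scaleR_right)
  finally have "(norm (sc c x))\<^sup>2 = (norm c * norm x)\<^sup>2"
    by (simp add: power2_norm_eq_inner power_mult_distrib)
  then show ?thesis by (simp add: power2_eq_iff_nonneg)
qed

lemma sc_bl: "bounded_linear (sc c)"
proof (rule bounded_linear_intro)
  show "sc c (r *\<^sub>R x) = r *\<^sub>R sc c x" for r x
    by (metis mult.commute scale_of_real scale_scale)
qed (auto simp: scale_right_distrib norm_sc mult.commute)

lemma ip_eqI:
  assumes "\<And>c. inner x (sc c v) = inner y (sc c u)"
  shows "ip x v = ip y u"
  by (rule kre_mult_eqI) (use assms in \<open>simp flip: ip_scale_right add: kre_ip\<close>)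

lemma ip_eqD: "ip x v = ip y u \<Longrightarrow> inner x v = inner y u"
  by (simp flip: kre_ip)

lemma subspaceI:
  assumes "0 \<in> X" "\<And>x y. x \<in> X \<Longrightarrow> y \<in> X \<Longrightarrow> x + y \<in> X" "\<And>c x. x \<in> X \<Longrightarrow> sc c x \<in> X"
  shows "real_vector.subspace X"
  using assms(1,2) assms(3)[of _ "of_real _", unfolded scale_of_real]
  by (auto simp: real_vector.subspace_def)

lemma linear_graphD:
  assumes "linear_graph sc (op_graph D S)"
  shows "lin_on D S" and "x \<in> D \<Longrightarrow> sc c x \<in> D" and "x \<in> D \<Longrightarrow> S (sc c x) = sc c (S x)"
proof -
  have add: "x + y \<in> D \<and> S (x + y) = S x + S y" if "x \<in> D" "y \<in> D" for x y
    using assms that by (fastforce simp: linear_graph_def op_graph_def)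
  have sc: "sc c x \<in> D \<and> S (sc c x) = sc c (S x)" if "x \<in> D" for x c
    using assms that by (fastforce simp: linear_graph_def op_graph_def)
  have "0 \<in> D" using assms by (auto simp: linear_graph_def op_graph_def)
  then have sub: "real_vector.subspace D" using add sc by (intro subspaceI) auto
  show "lin_on D S"
    using sc[of _ "of_real _", unfolded scale_of_real] add by (intro lin_onI[OF sub]) blast+
  show "x \<in> D \<Longrightarrow> sc c x \<in> D" "x \<in> D \<Longrightarrow> S (sc c x) = sc c (S x)" using sc by auto
qed

lemma dense_wrt_closure: "dense_wrt ip X \<longleftrightarrow> closure X = UNIV"
  by (auto simp: dense_wrt_def ip_norm_eq closure_approachable set_eq_iff dist_norm norm_minus_commute)

lemma Domain_op_graph: "Domain (op_graph D S) = D"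
  by (auto simp: op_graph_def)

lemma adjoint_graph_real:
  assumes "linear_graph sc (op_graph D S)"
  shows "(x, y) \<in> adjoint_graph ip (op_graph D S) \<longleftrightarrow> (\<forall>w\<in>D. inner x (S w) = inner y w)"
proof -
  note D = linear_graphD[OF assms]
  have "(x, y) \<in> adjoint_graph ip (op_graph D S) \<longleftrightarrow> (\<forall>w\<in>D. ip x (S w) = ip y w)"
    by (auto simp: adjoint_graph_def op_graph_def)
  also have "\<dots> \<longleftrightarrow> (\<forall>w\<in>D. inner x (S w) = inner y w)"
  proof
    assume *: "\<forall>w\<in>D. inner x (S w) = inner y w"
    show "\<forall>w\<in>D. ip x (S w) = ip y w"
      using * D(2,3) by (intro ballI ip_eqI) metis
  qed (use ip_eqD in blast)
  finally show ?thesis .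
qed

lemma self_adjointD:
  assumes "self_adjoint sc ip (op_graph D S)"
  shows "self_adj D S" and "x \<in> D \<Longrightarrow> sc c x \<in> D" and "x \<in> D \<Longrightarrow> S (sc c x) = sc c (S x)"
proof -
  have lg: "linear_graph sc (op_graph D S)" using assms by (simp add: self_adjoint_def)
  note D = linear_graphD[OF lg]
  show "self_adj D S"
  proof
    show "lin_on D S" by (rule D)
    show "closure D = UNIV"
      using assms by (simp add: self_adjoint_def Domain_op_graph dense_wrt_closure)
    show "(\<forall>w\<in>D. inner x (S w) = inner y w) \<longleftrightarrow> x \<in> D \<and> S x = y" for x y
      unfolding adjoint_graph_real[OF lg, symmetric]
      using assms by (auto simp: self_adjoint_def op_graph_def)
  qed
  show "x \<in> D \<Longrightarrow> sc c x \<in> D" "x \<in> D \<Longrightarrow> S (sc c x) = sc c (S x)" by (rule D; assumption)+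
qed

lemma skew_adjointD:
  assumes "skew_adjoint sc ip (op_graph D C)"
  shows "lin_on D C" and "x \<in> D \<Longrightarrow> y \<in> D \<Longrightarrow> inner (C x) y = - inner x (C y)"
    and "x \<in> D \<Longrightarrow> C (sc c x) = sc c (C x)"
proof -
  have lg: "linear_graph sc (op_graph D C)" using assms by (simp add: skew_adjoint_def)
  note D = linear_graphD[OF lg]
  show "lin_on D C" "x \<in> D \<Longrightarrow> C (sc c x) = sc c (C x)" by (rule D; assumption?)+
  show "inner (C x) y = - inner x (C y)" if xy: "x \<in> D" "y \<in> D"
  proof -
    have "(x, - C x) \<in> adjoint_graph ip (op_graph D C)"
      using assms xy by (auto simp: skew_adjoint_def op_graph_def)
    then show ?thesis using xy(2) unfolding adjoint_graph_real[OF lg] by simp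
  qed
qed

lemma positive_sqrtD:
  assumes "positive_sqrt sc ip D T E S"
  shows "self_adj E S" and "x \<in> E \<Longrightarrow> 0 \<le> inner x (S x)"
    and "x \<in> D \<longleftrightarrow> x \<in> E \<and> S x \<in> E" and "x \<in> D \<Longrightarrow> S (S x) = T x"
    and "x \<in> E \<Longrightarrow> sc c x \<in> E" and "x \<in> E \<Longrightarrow> S (sc c x) = sc c (S x)"
proof -
  have sa: "self_adjoint sc ip (op_graph E S)" and comp: "op_graph E S O op_graph E S = op_graph D T"
    and pos: "\<forall>x\<in>E. 0 \<le> kre (ip x (S x))"
    using assms by (auto simp: positive_sqrt_def)
  note sa' = self_adjointD[OF sa]
  show "self_adj E S" by (rule sa')
  show "x \<in> E \<Longrightarrow> sc c x \<in> E" "x \<in> E \<Longrightarrow> S (sc c x) = sc c (S x)" by (rule sa'; assumption)+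
  show "x \<in> E \<Longrightarrow> 0 \<le> inner x (S x)" using pos by (simp add: kre_ip)
  have eq: "(x, z) \<in> op_graph E S O op_graph E S \<longleftrightarrow> x \<in> E \<and> S x \<in> E \<and> z = S (S x)" for x z
    by (auto simp: op_graph_def relcomp_unfold)
  have eq2: "(x, z) \<in> op_graph D T \<longleftrightarrow> x \<in> D \<and> z = T x" for x z by (auto simp: op_graph_def)
  have *: "(x \<in> E \<and> S x \<in> E \<and> z = S (S x)) \<longleftrightarrow> (x \<in> D \<and> z = T x)" for x z
    using comp eq eq2 by metis
  show "x \<in> D \<longleftrightarrow> x \<in> E \<and> S x \<in> E" using *[of x "T x"] *[of x "S (S x)"] by blast
  show "x \<in> D \<Longrightarrow> S (S x) = T x" using *[of x "T x"] by simp
qed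

end

lemma klinear_on_lin_on:
  assumes "hilbert_space s1 ip1" "hilbert_space s2 ip2" "klinear_on s1 s2 X f" "subspace X"
  shows "lin_on X f"
proof -
  interpret h1: hilbert_space s1 ip1 by (rule assms(1))
  interpret h2: hilbert_space s2 ip2 by (rule assms(2))
  have "f (s1 (of_real r) x) = s2 (of_real r) (f x)" if "x \<in> X" for r x
    using assms(3) that by (auto simp: klinear_on_def)
  then show ?thesis
    using assms(3,4) unfolding h1.scale_of_real h2.scale_of_real by (auto simp: klinear_on_def lin_on_def)
qed

section \<open>Functionals of lower order\<close>

lemma (in self_adj) inverse_of_surjective_square:
  assumes surj: "\<And>f. \<exists>y. y \<in> D \<and> S y \<in> D \<and> S (S y) = f"
    and inj: "\<And>x. x \<in> D \<Longrightarrow> S x \<in> D \<Longrightarrow> S (S x) = 0 \<Longrightarrow> x = 0"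
  shows "inv_into D S f \<in> D" "S (inv_into D S f) = f" "x \<in> D \<Longrightarrow> inv_into D S (S x) = x"
    "lin_on UNIV (inv_into D S)"
proof -
  have im: "f \<in> S ` D" for f using surj[of f] by (auto intro: rev_image_eqI)
  show 1: "inv_into D S f \<in> D" and 2: "S (inv_into D S f) = f" for f
    using im by (simp_all add: inv_into_into f_inv_into_f)
  have "inj_on S D"
  proof (rule inj_onI)
    fix x y assume xy: "x \<in> D" "y \<in> D" "S x = S y"
    then have "S (x - y) = 0" by (simp add: S_simps)
    then have "x - y = 0" using xy inj[of "x - y"] by (simp add: D_closed S_simps)
    then show "x = y" by simp
  qed
  then show 3: "x \<in> D \<Longrightarrow> inv_into D S (S x) = x" for x by (rule inv_into_f_f)
  show "lin_on UNIV (inv_into D S)"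
  proof (rule lin_onI)
    show "inv_into D S (x + y) = inv_into D S x + inv_into D S y" for x y
      using 3[of "inv_into D S x + inv_into D S y"] by (simp add: 1 2 S_simps D_closed)
    show "inv_into D S (r *\<^sub>R x) = r *\<^sub>R inv_into D S x" for x r
      using 3[of "r *\<^sub>R inv_into D S x"] by (simp add: 1 2 S_simps D_closed)
  qed simp
qed

text \<open>\<open>R1 = (B\<^sup>2 + 1)\<^sup>1\<^sup>/\<^sup>2\<close> and \<open>R2 = (B\<^sup>4 + 1)\<^sup>1\<^sup>/\<^sup>2\<close>, while \<open>\<iota>1\<close>, \<open>\<iota>2\<close> embed into the spaces of order
  \<open>-1\<close> and \<open>-2\<close>. A functional on \<open>D(B\<^sup>2)\<close> that is bounded for the norm of \<open>D(B)\<close> is paired, by the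
  Riesz representation \<open>l = \<langle>p, R1 \<cdot>\<rangle>\<close>, with the element \<open>R1 p\<close> of the space of order \<open>-1\<close>.\<close>

locale negative_orders = self_adj D B
  for D :: "'a::{real_inner,complete_space} set" and B +
  fixes E1 E2 :: "'a set" and R1 R2 :: "'a \<Rightarrow> 'a"
    and \<iota>1 :: "'a \<Rightarrow> 'm1::{real_inner,complete_space}" and \<iota>2 :: "'a \<Rightarrow> 'm2::{real_inner,complete_space}"
  assumes R1_sa: "self_adj E1 R1" and R2_sa: "self_adj E2 R2"
    and E1: "(x \<in> E1 \<and> R1 x \<in> E1) \<longleftrightarrow> (x \<in> D \<and> B x \<in> D)"
    and R1_sq: "x \<in> D \<Longrightarrow> B x \<in> D \<Longrightarrow> R1 (R1 x) = B (B x) + x"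
    and E2: "(x \<in> E2 \<and> R2 x \<in> E2) \<longleftrightarrow> (x \<in> D \<and> B x \<in> D \<and> B (B x) \<in> D \<and> B (B (B x)) \<in> D)"
    and R2_sq: "x \<in> D \<Longrightarrow> B x \<in> D \<Longrightarrow> B (B x) \<in> D \<Longrightarrow> B (B (B x)) \<in> D \<Longrightarrow>
      R2 (R2 x) = B (B (B (B x))) + x"
    and \<iota>1_lin: "lin_on UNIV \<iota>1" and \<iota>1_dense: "closure (range \<iota>1) = UNIV"
    and \<iota>1_inner: "inner (\<iota>1 x) (\<iota>1 y) = inner (inv_into E1 R1 x) (inv_into E1 R1 y)"
    and \<iota>2_lin: "lin_on UNIV \<iota>2" and \<iota>2_dense: "closure (range \<iota>2) = UNIV"
    and \<iota>2_inner: "inner (\<iota>2 x) (\<iota>2 y) = inner (inv_into E2 R2 x) (inv_into E2 R2 y)"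
begin

sublocale R1: self_adj E1 R1 by (rule R1_sa)
sublocale R2: self_adj E2 R2 by (rule R2_sa)
sublocale BB: self_adj "{x \<in> D. B x \<in> D}" "\<lambda>x. B (B x)" by (rule self_adj_square)

lemma square_plus_one_eq_0:
  assumes "self_adj D' A" "x \<in> D'" "A x \<in> D'" "A (A x) + x = 0"
  shows "x = 0"
proof -
  interpret A: self_adj D' A by (rule assms(1))
  have "inner (A (A x)) x + inner x x = 0" using assms(4) by (metis inner_add_left inner_zero_left)
  then have "inner (A x) (A x) + inner x x = 0" using A.sym[OF assms(3,2)] by simp
  then have "inner x x = 0" using inner_ge_zero[of "A x"] inner_ge_zero[of x] by linarith
  then show ?thesis by simp
qed

lemma R1_inverse:
  shows "inv_into E1 R1 f \<in> E1" "R1 (inv_into E1 R1 f) = f" "x \<in> E1 \<Longrightarrow> inv_into E1 R1 (R1 x) = x"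
    "lin_on UNIV (inv_into E1 R1)"
proof -
  have surj: "\<exists>y. y \<in> E1 \<and> R1 y \<in> E1 \<and> R1 (R1 y) = f" for f
  proof -
    obtain y where y: "y \<in> D" "B y \<in> D" "B (B y) + y = f" by (rule square_plus_one_surj)
    then show ?thesis using E1[of y] R1_sq[of y] by auto
  qed
  have inj: "x = 0" if "x \<in> E1" "R1 x \<in> E1" "R1 (R1 x) = 0" for x
    using that E1[of x] R1_sq[of x] square_plus_one_eq_0[OF self_adj_axioms, of x] by auto
  show "inv_into E1 R1 f \<in> E1" "R1 (inv_into E1 R1 f) = f" "x \<in> E1 \<Longrightarrow> inv_into E1 R1 (R1 x) = x"
    "lin_on UNIV (inv_into E1 R1)"
    by (rule R1.inverse_of_surjective_square[OF surj inj]; assumption)+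
qed

lemma R2_inverse:
  shows "inv_into E2 R2 f \<in> E2" "R2 (inv_into E2 R2 f) = f" "x \<in> E2 \<Longrightarrow> inv_into E2 R2 (R2 x) = x"
    "lin_on UNIV (inv_into E2 R2)"
proof -
  have surj: "\<exists>y. y \<in> E2 \<and> R2 y \<in> E2 \<and> R2 (R2 y) = f" for f
  proof -
    obtain y where y: "y \<in> D" "B y \<in> D" "B (B y) \<in> D" "B (B (B y)) \<in> D" "B (B (B (B y))) + y = f"
      by (rule BB.square_plus_one_surj[of f]) auto
    then show ?thesis using E2[of y] R2_sq[of y] by auto
  qed
  have inj: "x = 0" if "x \<in> E2" "R2 x \<in> E2" "R2 (R2 x) = 0" for x
    using that E2[of x] R2_sq[of x] square_plus_one_eq_0[OF BB.self_adj_axioms, of x] by auto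
  show "inv_into E2 R2 f \<in> E2" "R2 (inv_into E2 R2 f) = f" "x \<in> E2 \<Longrightarrow> inv_into E2 R2 (R2 x) = x"
    "lin_on UNIV (inv_into E2 R2)"
    by (rule R2.inverse_of_surjective_square[OF surj inj]; assumption)+
qed

lemma R1_norm:
  assumes "x \<in> D" "B x \<in> D"
  shows "(norm (R1 x))\<^sup>2 = (norm (B x))\<^sup>2 + (norm x)\<^sup>2"
proof -
  have x: "x \<in> E1" "R1 x \<in> E1" using E1[of x] assms by auto
  have "inner (R1 x) (R1 x) = inner (B (B x) + x) x" using R1.sym[OF x(2,1)] R1_sq[OF assms] by simp
  then show ?thesis using assms by (simp add: power2_norm_eq_inner inner_add_left sym)
qed

lemma R2_norm:
  assumes "x \<in> D" "B x \<in> D" "B (B x) \<in> D" "B (B (B x)) \<in> D"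
  shows "(norm (R2 x))\<^sup>2 = (norm (B (B x)))\<^sup>2 + (norm x)\<^sup>2"
proof -
  have x: "x \<in> E2" "R2 x \<in> E2" using E2[of x] assms by auto
  have "inner (R2 x) (R2 x) = inner (B (B (B (B x))) + x) x" using R2.sym[OF x(2,1)] R2_sq[OF assms] by simp
  then show ?thesis using assms by (simp add: power2_norm_eq_inner inner_add_left sym)
qed

lemma dom_square_subset_E2:
  assumes "x \<in> D" "B x \<in> D"
  shows "x \<in> E2"
proof -
  have bnd: "norm (R2 y) \<le> 1 * (norm y + norm (B (B y)))"
    if "y \<in> {x \<in> D. B x \<in> D}" "B (B y) \<in> {x \<in> D. B x \<in> D}" for y
    by (rule power2_le_imp_le) (use R2_norm[of y] that in \<open>auto simp: power2_sum\<close>)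
  have sub: "y \<in> E2" if "y \<in> {x \<in> D. B x \<in> D}" "B (B y) \<in> {x \<in> D. B x \<in> D}" for y
    using E2[of y] that by auto
  show ?thesis
    by (rule BB.core_transfer[OF R2_sa sub bnd, of x]) (use assms in auto)
qed

lemma R2_range_total:
  assumes p: "\<And>x. x \<in> D \<Longrightarrow> B x \<in> D \<Longrightarrow> inner p (R2 x) = 0"
  shows "p = 0"
proof -
  have "inner p (R2 w) = inner 0 w" if w: "w \<in> E2" for w
  proof -
    obtain s where s: "\<And>n. s n \<in> E2" "\<And>n. R2 (s n) \<in> E2" "s \<longlonglongrightarrow> w" "(\<lambda>n. R2 (s n)) \<longlonglongrightarrow> R2 w"
      by (rule R2.core[OF w]) (rule that)
    have "inner p (R2 (s n)) = 0" for n using p E2[of "s n"] s by blast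
    moreover have "(\<lambda>n. inner p (R2 (s n))) \<longlonglongrightarrow> inner p (R2 w)" by (intro tendsto_intros s)
    ultimately show ?thesis by (simp add: LIMSEQ_const_iff)
  qed
  then have "p \<in> E2" "R2 p = 0" using R2.in_dom[of p 0] R2.eqI[of p 0] by blast+
  then show ?thesis using R2_inverse(3)[of p] R2_inverse(3)[of 0] by (simp add: R2.S_simps R2.D_closed)
qed

text \<open>By duality: for \<open>y = R2\<^sup>-\<^sup>2 x\<close> the square of \<open>norm (R2 y)\<close> is \<open>\<langle>x, y\<rangle> = \<langle>R1\<^sup>-\<^sup>1 x, R1 y\<rangle>\<close>, and the norm of \<open>R1 y\<close> is
  dominated by that of \<open>R2 y\<close>.\<close>

lemma order_comparison: "norm (inv_into E2 R2 x) \<le> 2 * norm (inv_into E1 R1 x)"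
proof -
  define y where "y = inv_into E2 R2 (inv_into E2 R2 x)"
  have y: "y \<in> E2" "R2 y \<in> E2" "R2 y = inv_into E2 R2 x" "R2 (R2 y) = x"
    by (simp_all add: y_def R2_inverse)
  have yD: "y \<in> D" "B y \<in> D" "B (B y) \<in> D" "B (B (B y)) \<in> D" using E2[of y] y by auto
  have yE: "y \<in> E1" "R1 y \<in> E1" using E1[of y] yD by auto
  have "inner (B y) (B y) \<le> norm (B (B y)) * norm y"
    using norm_cauchy_schwarz[of "B (B y)" y] sym[OF yD(2,1)] by simp
  also have "2 * (norm (B (B y)) * norm y) \<le> (norm (B (B y)))\<^sup>2 + (norm y)\<^sup>2"
    using zero_le_power2[of "norm (B (B y)) - norm y"] by (simp add: power2_eq_square algebra_simps)
  finally have By: "(norm (B y))\<^sup>2 \<le> (norm (B (B y)))\<^sup>2 + (norm y)\<^sup>2"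
    using inner_ge_zero[of "B y"] unfolding power2_norm_eq_inner by linarith
  have "(2 * norm (R2 y))\<^sup>2 = 4 * (norm (R2 y))\<^sup>2" by (simp add: power_mult_distrib)
  then have "(norm (R1 y))\<^sup>2 \<le> (2 * norm (R2 y))\<^sup>2"
    using By R1_norm[OF yD(1,2)] R2_norm[OF yD] zero_le_power2[of "norm (B (B y))"] zero_le_power2[of "norm y"]
    by linarith
  then have R1y: "norm (R1 y) \<le> 2 * norm (R2 y)" by (rule power2_le_imp_le) simp
  have "(norm (R2 y))\<^sup>2 = inner x y"
    using R2.sym[OF y(2,1)] y(4) by (simp add: power2_norm_eq_inner)
  also have "\<dots> = inner (inv_into E1 R1 x) (R1 y)"
    using R1.sym[OF R1_inverse(1)[of x] yE(1)] by (simp add: R1_inverse)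
  also have "\<dots> \<le> norm (inv_into E1 R1 x) * norm (R1 y)" by (rule norm_cauchy_schwarz)
  also have "\<dots> \<le> norm (inv_into E1 R1 x) * (2 * norm (R2 y))" by (intro mult_left_mono R1y) simp
  finally have "norm (R2 y) * norm (R2 y) \<le> (2 * norm (inv_into E1 R1 x)) * norm (R2 y)"
    by (simp add: power2_eq_square)
  then show ?thesis
    using mult_right_le_imp_le[of "norm (R2 y)" "norm (R2 y)"] unfolding y(3)
    by (cases "norm (inv_into E2 R2 x) = 0") auto
qed

abbreviation "Rinvbar2 \<equiv> bounded_ext \<iota>2 UNIV (inv_into E2 R2)"
abbreviation "incl \<equiv> bounded_ext \<iota>1 UNIV \<iota>2"

lemma norm_\<iota>: "norm (\<iota>1 x) = norm (inv_into E1 R1 x)" "norm (\<iota>2 x) = norm (inv_into E2 R2 x)"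
  by (simp_all add: norm_eq_sqrt_inner \<iota>1_inner \<iota>2_inner)

lemma Rinvbar2: "bounded_linear Rinvbar2" "Rinvbar2 (\<iota>2 x) = inv_into E2 R2 x"
  using bounded_ext[OF \<iota>2_lin \<iota>2_dense R2_inverse(4), of 1] by (auto simp: norm_\<iota>)

lemma incl: "bounded_linear incl" "incl (\<iota>1 x) = \<iota>2 x"
  using bounded_ext[OF \<iota>1_lin \<iota>1_dense \<iota>2_lin, of 2] order_comparison by (auto simp: norm_\<iota>)

lemma Rinvbar2_norm: "norm (Rinvbar2 \<eta>) = norm \<eta>"
proof (rule dense_image_eq[OF \<iota>2_dense, of "\<lambda>\<eta>. norm (Rinvbar2 \<eta>)" norm])
  show "continuous_on UNIV (\<lambda>\<eta>. norm (Rinvbar2 \<eta>))"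
    by (intro continuous_on_norm linear_continuous_on Rinvbar2(1))
  show "continuous_on UNIV (norm :: 'm2 \<Rightarrow> real)" by (intro continuous_on_norm continuous_on_id)
qed (simp add: Rinvbar2(2) norm_\<iota>)

lemma pairing_unique:
  assumes "\<And>x. x \<in> D \<Longrightarrow> B x \<in> D \<Longrightarrow> inner (Rinvbar2 \<eta>) (R2 x) = inner (Rinvbar2 \<eta>') (R2 x)"
  shows "\<eta> = \<eta>'"
proof -
  have "Rinvbar2 (\<eta> - \<eta>') = Rinvbar2 \<eta> - Rinvbar2 \<eta>'"
    by (rule linear_diff[OF bounded_linear.linear[OF Rinvbar2(1)]])
  moreover have "Rinvbar2 \<eta> - Rinvbar2 \<eta>' = 0"
    by (rule R2_range_total) (simp add: assms inner_diff_left)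
  ultimately show ?thesis using Rinvbar2_norm[of "\<eta> - \<eta>'"] by simp
qed

text \<open>The element \<open>\<eta>\<close> is the image of \<open>R1 p\<close>, which exists in the completion as the value at \<open>p\<close> of the
  isometric extension \<open>U\<close> of \<open>a \<mapsto> \<iota>1 (R1 a)\<close>.\<close>

lemma lower_order_functional:
  assumes l: "lin_on {x \<in> D. B x \<in> D} l"
    and bnd: "\<And>x. x \<in> D \<Longrightarrow> B x \<in> D \<Longrightarrow> \<bar>l x\<bar> \<le> k * (norm x + norm (B x))"
  obtains \<eta> where "\<eta> \<in> range incl" "\<And>x. x \<in> D \<Longrightarrow> B x \<in> D \<Longrightarrow> inner (Rinvbar2 \<eta>) (R2 x) = l x"
proof -
  let ?H2 = "{x \<in> D. B x \<in> D}"
  have H2E1: "x \<in> E1" if "x \<in> D" "B x \<in> D" for x using that E1 by blast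
  have inv1: "inv_into E1 R1 (R1 x) = x" if "x \<in> ?H2" for x using that H2E1 by (intro R1_inverse(3)) auto
  note l' = lin_onD[OF l]
  have linR1: "lin_on ?H2 R1"
    using l'(1) H2E1 by (auto simp: lin_on_def R1.S_simps)
  have "lin_on (R1 ` ?H2) (\<lambda>z. l (inv_into E1 R1 z))"
  proof (rule lin_onI)
    show "subspace (R1 ` ?H2)"
      unfolding subspace_def
    proof (intro conjI ballI allI)
      show "0 \<in> R1 ` ?H2" using l'(1) R1.S_simps(5) by (force simp: subspace_0 D_closed S_simps)
      fix x y assume "x \<in> R1 ` ?H2" "y \<in> R1 ` ?H2"
      then obtain a b where ab: "a \<in> ?H2" "b \<in> ?H2" "x = R1 a" "y = R1 b" by blast
      then have "x + y = R1 (a + b)" using H2E1 by (simp add: R1.S_simps)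
      then show "x + y \<in> R1 ` ?H2" using subspace_add[OF l'(1) ab(1,2)] by blast
    next
      fix r x assume "x \<in> R1 ` ?H2"
      then obtain a where a: "a \<in> ?H2" "x = R1 a" by blast
      then have "r *\<^sub>R x = R1 (r *\<^sub>R a)" using H2E1 by (simp add: R1.S_simps)
      then show "r *\<^sub>R x \<in> R1 ` ?H2" using subspace_scale[OF l'(1) a(1)] by blast
    qed
  qed (auto simp: lin_onD[OF R1_inverse(4)] inv1 l'(2,3))
  moreover have "\<bar>l (inv_into E1 R1 z)\<bar> \<le> (\<bar>k\<bar> * 2) * norm z" if z: "z \<in> R1 ` ?H2" for z
  proof -
    obtain x where x: "x \<in> ?H2" "z = R1 x" using z by blast
    have "norm x \<le> norm z" "norm (B x) \<le> norm z"
      unfolding x(2) by (rule power2_le_imp_le; use R1_norm[of x] x(1) in simp)+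
    then have "k * (norm x + norm (B x)) \<le> \<bar>k\<bar> * (2 * norm z)" by (intro mult_mono) auto
    then show ?thesis using bnd[of x] x inv1 by (simp add: x(2))
  qed
  ultimately obtain p where "\<And>z. z \<in> R1 ` ?H2 \<Longrightarrow> inner p z = l (inv_into E1 R1 z)"
    using riesz_subspace by blast
  then have p: "inner p (R1 x) = l x" if "x \<in> ?H2" for x using that inv1 by auto
  have idE: "lin_on E1 (\<lambda>x. x)" using R1.subspace_D by (simp add: lin_on_def)
  have \<iota>R: "lin_on E1 (\<lambda>x. \<iota>1 (R1 x))"
    using R1.subspace_D lin_onD[OF \<iota>1_lin] by (simp add: lin_on_def R1.S_simps)
  define U where "U = bounded_ext (\<lambda>x. x) E1 (\<lambda>x. \<iota>1 (R1 x))"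
  have U: "bounded_linear U" "x \<in> E1 \<Longrightarrow> U x = \<iota>1 (R1 x)" for x
    using bounded_ext[OF idE _ \<iota>R, of 1] R1.dense unfolding U_def by (auto simp: norm_\<iota> R1_inverse)
  show ?thesis
  proof
    show "incl (U p) \<in> range incl" by simp
    fix x assume x: "x \<in> D" "B x \<in> D"
    have "inner (Rinvbar2 (incl (U a))) (R2 x) = inner a (R1 x)" for a
    proof (rule dense_image_eq[where i = "\<lambda>x. x" and X = E1
          and f = "\<lambda>a. inner (Rinvbar2 (incl (U a))) (R2 x)" and g = "\<lambda>a. inner a (R1 x)"])
      show "closure ((\<lambda>x. x) ` E1) = UNIV" using R1.dense by simp
      have "bounded_linear (\<lambda>a. Rinvbar2 (incl (U a)))"
        by (intro bounded_linear_compose[OF Rinvbar2(1)] bounded_linear_compose[OF incl(1)] U(1))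
      then show "continuous_on UNIV (\<lambda>a. inner (Rinvbar2 (incl (U a))) (R2 x))"
        by (intro continuous_intros linear_continuous_on)
      show "continuous_on UNIV (\<lambda>a. inner a (R1 x))" by (intro continuous_intros)
      fix a assume a: "a \<in> E1"
      have "inner (Rinvbar2 (incl (U a))) (R2 x) = inner (inv_into E2 R2 (R1 a)) (R2 x)"
        by (simp add: U(2)[OF a] incl Rinvbar2)
      also have "\<dots> = inner (R1 a) x"
        using R2.sym[OF R2_inverse(1) dom_square_subset_E2[OF x], of "R1 a"] by (simp add: R2_inverse)
      also have "\<dots> = inner a (R1 x)" by (rule R1.sym[OF a H2E1[OF x]])
      finally show "inner (Rinvbar2 (incl (U a))) (R2 x) = inner a (R1 x)" .
    qed
    then show "inner (Rinvbar2 (incl (U p))) (R2 x) = l x" using p x by simp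
  qed
qed

end

section \<open>The wave operator in the energy space\<close>

text \<open>\<open>\<iota>\<close> embeds \<open>D(B)\<close> into its completion for the norm of \<open>B x\<close>, and \<open>S\<close> is the positive square root
  of \<open>B\<^sup>2 + C1 C2\<close>, given with a domain \<open>D'\<close> of its own.\<close>

locale wave = self_adj D B
  for D :: "'a::{real_inner,complete_space} set" and B +
  fixes \<iota> :: "'a \<Rightarrow> 'b::{real_inner,complete_space}" and C1 C2 :: "'a \<Rightarrow> 'a" and c1 c2 :: real
    and D' :: "'a set" and S :: "'a \<Rightarrow> 'a"
  assumes \<iota>_lin: "lin_on D \<iota>" and \<iota>_dense: "closure (\<iota> ` D) = UNIV"
    and \<iota>_inner: "x \<in> D \<Longrightarrow> y \<in> D \<Longrightarrow> inner (\<iota> x) (\<iota> y) = inner (B x) (B y)"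
    and B_inj: "x \<in> D \<Longrightarrow> B x = 0 \<Longrightarrow> x = 0"
    and C1_lin: "lin_on D C1" and C2_lin: "lin_on D C2"
    and C1_skew: "x \<in> D \<Longrightarrow> y \<in> D \<Longrightarrow> inner (C1 x) y = - inner x (C1 y)"
    and C2_skew: "x \<in> D \<Longrightarrow> y \<in> D \<Longrightarrow> inner (C2 x) y = - inner x (C2 y)"
    and C1_bound: "x \<in> D \<Longrightarrow> norm (C1 x) \<le> c1 * norm (B x)"
    and C2_bound: "x \<in> D \<Longrightarrow> norm (C2 x) \<le> c2 * norm (B x)"
    and c_less: "c1 * c2 < 1"
    and C1_D: "x \<in> D \<Longrightarrow> B x \<in> D \<Longrightarrow> C1 x \<in> D"
    and C2_D: "x \<in> D \<Longrightarrow> B x \<in> D \<Longrightarrow> C2 x \<in> D"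
    and C1_C2: "x \<in> D \<Longrightarrow> B x \<in> D \<Longrightarrow> C1 (C2 x) = C2 (C1 x)"
    and B_C1: "x \<in> D \<Longrightarrow> B x \<in> D \<Longrightarrow> B (C1 x) = C1 (B x)"
    and B_C2: "x \<in> D \<Longrightarrow> B x \<in> D \<Longrightarrow> B (C2 x) = C2 (B x)"
    and S_sa: "self_adj D' S"
    and S_pos: "x \<in> D' \<Longrightarrow> 0 \<le> inner x (S x)"
    and S_dom: "(x \<in> D' \<and> S x \<in> D') \<longleftrightarrow> (x \<in> D \<and> B x \<in> D)"
    and S_sq: "x \<in> D \<Longrightarrow> B x \<in> D \<Longrightarrow> S (S x) = B (B x) + C1 (C2 x)"
begin

sublocale S: self_adj D' S by (rule S_sa)

lemmas C1_simps = lin_onD(2-6)[OF C1_lin]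
lemmas C2_simps = lin_onD(2-6)[OF C2_lin]

definition \<kappa> :: real where "\<kappa> = 1 / sqrt (1 - c1 * c2)"

lemma \<kappa>_pos: "\<kappa> > 0"
  using c_less by (simp add: \<kappa>_def)

lemma norm_product: "x \<in> D \<Longrightarrow> norm (C1 x) * norm (C2 x) \<le> (c1 * c2) * (norm (B x))\<^sup>2"
proof -
  assume x: "x \<in> D"
  have "norm (C1 x) * norm (C2 x) \<le> (c1 * norm (B x)) * (c2 * norm (B x))"
    using C1_bound[OF x] C2_bound[OF x] by (intro mult_mono) (auto intro: order_trans[OF norm_ge_zero])
  then show ?thesis by (simp add: power2_eq_square mult_ac)
qed

text \<open>Together with \<open>c1 * c2 < 1\<close> this makes the norms of \<open>S x\<close> and \<open>B x\<close> equivalent on \<open>D(B\<^sup>2) = D(S\<^sup>2)\<close>, a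
  core of both operators; \<open>\<kappa>\<close> is the constant in the bound of \<open>B x\<close> by \<open>S x\<close>.\<close>

lemma S_norm_core:
  assumes "x \<in> D" "B x \<in> D"
  shows "(norm (S x))\<^sup>2 = (norm (B x))\<^sup>2 - inner (C1 x) (C2 x)"
proof -
  have x: "x \<in> D'" "S x \<in> D'" using S_dom[of x] assms by auto
  have "inner (S x) (S x) = inner (B (B x) + C1 (C2 x)) x" using S.sym[OF x(2,1)] S_sq[OF assms] by simp
  also have "\<dots> = inner (B x) (B x) - inner (C1 x) (C2 x)"
    using assms C1_skew[OF assms(1) C2_D[OF assms]] sym[of "B x" x] inner_commute[of x "C1 (C2 x)"]
    by (simp add: inner_add_left)
  finally show ?thesis by (simp add: power2_norm_eq_inner)
qed

lemma S_bounds_core: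
  assumes "x \<in> D" "B x \<in> D"
  shows "norm (S x) \<le> 2 * norm (B x)" "norm (B x) \<le> \<kappa> * norm (S x)"
proof -
  note eq = S_norm_core[OF assms]
  have "\<bar>inner (C1 x) (C2 x)\<bar> \<le> norm (C1 x) * norm (C2 x)" by (rule Cauchy_Schwarz_ineq2)
  also have "\<dots> \<le> (c1 * c2) * (norm (B x))\<^sup>2" by (rule norm_product[OF assms(1)])
  finally have ab: "\<bar>inner (C1 x) (C2 x)\<bar> \<le> (c1 * c2) * (norm (B x))\<^sup>2" .
  have "(c1 * c2) * (norm (B x))\<^sup>2 \<le> 1 * (norm (B x))\<^sup>2" using c_less by (intro mult_right_mono) auto
  moreover have "(2 * norm (B x))\<^sup>2 = 4 * (norm (B x))\<^sup>2" by (simp add: power_mult_distrib)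
  ultimately have "(norm (S x))\<^sup>2 \<le> (2 * norm (B x))\<^sup>2"
    using eq ab zero_le_power2[of "norm (B x)"] by linarith
  then show "norm (S x) \<le> 2 * norm (B x)" by (rule power2_le_imp_le) simp
  have "(1 - c1 * c2) * (norm (B x))\<^sup>2 \<le> (norm (S x))\<^sup>2"
    using eq ab unfolding left_diff_distrib by linarith
  then have "(norm (B x))\<^sup>2 \<le> (norm (S x))\<^sup>2 / (1 - c1 * c2)"
    using c_less by (simp add: field_simps)
  also have "\<dots> = (\<kappa> * norm (S x))\<^sup>2" using c_less by (simp add: \<kappa>_def power_mult_distrib power_divide)
  finally show "norm (B x) \<le> \<kappa> * norm (S x)"
    by (rule power2_le_imp_le) (use \<kappa>_pos in simp)
qed

lemma core_sequence:
  assumes x: "x \<in> D"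
  obtains s where "\<And>n. s n \<in> D" "\<And>n. B (s n) \<in> D" "s \<longlonglongrightarrow> x" "(\<lambda>n. B (s n)) \<longlonglongrightarrow> B x"
    "x \<in> D'" "(\<lambda>n. S (s n)) \<longlonglongrightarrow> S x"
proof -
  have sub: "y \<in> D'" if "y \<in> D" "B y \<in> D" for y using S_dom[of y] that by auto
  have bnd: "norm (S y) \<le> 2 * (norm y + norm (B y))" if "y \<in> D" "B y \<in> D" for y
    using S_bounds_core(1)[OF that] norm_ge_zero[of y] unfolding distrib_left by linarith
  show ?thesis by (rule core_transfer[OF S_sa sub bnd x]) (auto intro: that)
qed

lemma D'_eq: "D' = D"
proof
  show "D \<subseteq> D'" using core_sequence by blast
  show "D' \<subseteq> D"
  proof
    fix x assume x: "x \<in> D'"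
    have sub: "y \<in> D" if "y \<in> D'" "S y \<in> D'" for y using S_dom[of y] that by auto
    have bnd: "norm (B y) \<le> \<kappa> * (norm y + norm (S y))" if "y \<in> D'" "S y \<in> D'" for y
    proof -
      have "norm (B y) \<le> \<kappa> * norm (S y)" using S_dom[of y] that S_bounds_core(2) by blast
      also have "\<dots> \<le> \<kappa> * (norm y + norm (S y))" using \<kappa>_pos by (intro mult_left_mono) auto
      finally show ?thesis .
    qed
    show "x \<in> D" by (rule S.core_transfer[OF self_adj_axioms sub bnd x]) auto
  qed
qed

lemma S_dom2: "x \<in> D \<Longrightarrow> S x \<in> D \<longleftrightarrow> B x \<in> D"
  using S_dom[of x] by (simp add: D'_eq)

lemma tendsto_C:
  assumes C: "lin_on D C" and bnd: "\<And>x. x \<in> D \<Longrightarrow> norm (C x) \<le> c * norm (B x)"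
    and s: "\<And>n. s n \<in> D" "u \<in> D" "(\<lambda>n. B (s n)) \<longlonglongrightarrow> B u"
  shows "(\<lambda>n. C (s n)) \<longlonglongrightarrow> C u"
proof -
  have lim: "(\<lambda>n. c * norm (B (s n) - B u)) \<longlonglongrightarrow> 0"
    using tendsto_mult_right_zero[OF tendsto_norm_zero[OF LIM_zero[OF s(3)]]] .
  have "(\<lambda>n. norm (C (s n) - C u)) \<longlonglongrightarrow> 0"
  proof (rule tendsto_sandwich[OF _ _ tendsto_const lim])
    show "\<forall>\<^sub>F n in sequentially. norm (C (s n) - C u) \<le> c * norm (B (s n) - B u)"
      using bnd[of "s _ - u"] s(1,2) by (simp add: D_closed lin_onD[OF C] S_simps)
  qed simp
  then show ?thesis by (simp add: LIM_zero_iff tendsto_norm_zero_iff)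
qed

lemma S_polarized:
  assumes x: "x \<in> D" and y: "y \<in> D"
  shows "inner (S x) (S y) = inner (B x) (B y) - inner (C1 x) (C2 y)"
proof -
  obtain s where s: "\<And>n. s n \<in> D" "\<And>n. B (s n) \<in> D" "s \<longlonglongrightarrow> y" "(\<lambda>n. B (s n)) \<longlonglongrightarrow> B y"
    "y \<in> D'" "(\<lambda>n. S (s n)) \<longlonglongrightarrow> S y" by (rule core_sequence[OF y]) (rule that)
  have eq: "inner (S x) (S (s n)) = inner (B x) (B (s n)) - inner (C1 x) (C2 (s n))" for n
  proof -
    have "inner (S x) (S (s n)) = inner x (S (S (s n)))"
      using S.sym[of x "S (s n)"] x s(1,2)[of n] S_dom2[of "s n"] by (simp add: D'_eq)
    also have "\<dots> = inner x (B (B (s n))) + inner x (C1 (C2 (s n)))"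
      using S_sq s(1,2) by (simp add: inner_add_right)
    finally show ?thesis
      using sym[OF x s(2)[of n]] C1_skew[OF x C2_D[OF s(1,2)[of n]]] by simp
  qed
  show ?thesis
  proof (rule LIMSEQ_unique)
    show "(\<lambda>n. inner (S x) (S (s n))) \<longlonglongrightarrow> inner (S x) (S y)" by (intro tendsto_intros s)
    show "(\<lambda>n. inner (S x) (S (s n))) \<longlonglongrightarrow> inner (B x) (B y) - inner (C1 x) (C2 y)"
      unfolding eq by (intro tendsto_intros s tendsto_C[OF C2_lin C2_bound s(1) y s(4)])
  qed
qed

lemma S_bounds:
  assumes x: "x \<in> D"
  shows "norm (S x) \<le> 2 * norm (B x)" "norm (B x) \<le> \<kappa> * norm (S x)"
proof -
  obtain s where s: "\<And>n. s n \<in> D" "\<And>n. B (s n) \<in> D" "s \<longlonglongrightarrow> x" "(\<lambda>n. B (s n)) \<longlonglongrightarrow> B x"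
    "x \<in> D'" "(\<lambda>n. S (s n)) \<longlonglongrightarrow> S x" by (rule core_sequence[OF x]) (rule that)
  show "norm (S x) \<le> 2 * norm (B x)"
    by (rule LIMSEQ_le[of "\<lambda>n. norm (S (s n))" _ "\<lambda>n. 2 * norm (B (s n))"])
      (use s S_bounds_core in \<open>auto intro!: tendsto_intros\<close>)
  show "norm (B x) \<le> \<kappa> * norm (S x)"
    by (rule LIMSEQ_le[of "\<lambda>n. norm (B (s n))" _ "\<lambda>n. \<kappa> * norm (S (s n))"])
      (use s S_bounds_core in \<open>auto intro!: tendsto_intros\<close>)
qed

lemma S_inj: "x \<in> D \<Longrightarrow> S x = 0 \<Longrightarrow> x = 0"
  using S_bounds(2)[of x] B_inj[of x] by simp

lemma S_bound_from_B:
  assumes "\<And>x. x \<in> D \<Longrightarrow> norm (C x) \<le> c * norm (B x)" "x \<in> D"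
  shows "norm (C x) \<le> (\<bar>c\<bar> * \<kappa>) * norm (S x)"
proof -
  have "norm (C x) \<le> c * norm (B x)" using assms by blast
  also have "\<dots> \<le> \<bar>c\<bar> * (\<kappa> * norm (S x))" using S_bounds(2)[OF assms(2)] by (intro mult_mono) auto
  finally show ?thesis by simp
qed

lemma C1_S: "x \<in> D \<Longrightarrow> norm (C1 x) \<le> (\<bar>c1\<bar> * \<kappa>) * norm (S x)"
  and C2_S: "x \<in> D \<Longrightarrow> norm (C2 x) \<le> (\<bar>c2\<bar> * \<kappa>) * norm (S x)"
  using S_bound_from_B[OF C1_bound] S_bound_from_B[OF C2_bound] by blast+

lemma B_C_weak:
  assumes C: "lin_on D C" and skew: "\<And>x y. x \<in> D \<Longrightarrow> y \<in> D \<Longrightarrow> inner (C x) y = - inner x (C y)"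
    and bnd: "\<And>x. x \<in> D \<Longrightarrow> norm (C x) \<le> c * norm (B x)"
    and CD: "\<And>x. x \<in> D \<Longrightarrow> B x \<in> D \<Longrightarrow> C x \<in> D"
    and BC: "\<And>x. x \<in> D \<Longrightarrow> B x \<in> D \<Longrightarrow> B (C x) = C (B x)"
    and x: "x \<in> D" and w: "w \<in> D"
  shows "inner (C x) (B w) = - inner (B x) (C w)"
proof -
  obtain s where s: "\<And>n. s n \<in> D" "\<And>n. B (s n) \<in> D" "s \<longlonglongrightarrow> x" "(\<lambda>n. B (s n)) \<longlonglongrightarrow> B x"
    "x \<in> D'" "(\<lambda>n. S (s n)) \<longlonglongrightarrow> S x" by (rule core_sequence[OF x]) (rule that)
  have eq: "inner (C (s n)) (B w) = - inner (B (s n)) (C w)" for n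
    using sym[OF CD[OF s(1,2)] w, of n] BC[OF s(1,2), of n] skew[OF s(2) w, of n] by simp
  show ?thesis
  proof (rule LIMSEQ_unique)
    show "(\<lambda>n. inner (C (s n)) (B w)) \<longlonglongrightarrow> inner (C x) (B w)"
      by (intro tendsto_intros tendsto_C[OF C bnd s(1) x s(4)])
    show "(\<lambda>n. inner (C (s n)) (B w)) \<longlonglongrightarrow> - inner (B x) (C w)"
      unfolding eq by (intro tendsto_intros s)
  qed
qed

text \<open>By \<open>S_polarized\<close> the form of \<open>S\<^sup>2\<close> is expressed by \<open>B\<close>, \<open>C1\<close> and \<open>C2\<close>, with all of which \<open>C\<close> commutes.
  This is the commutation with \<open>S\<^sup>2\<close> from which commutation with \<open>S\<close> follows.\<close>

lemma S_C_weak: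
  assumes C: "lin_on D C" and skew: "\<And>x y. x \<in> D \<Longrightarrow> y \<in> D \<Longrightarrow> inner (C x) y = - inner x (C y)"
    and bnd: "\<And>x. x \<in> D \<Longrightarrow> norm (C x) \<le> c * norm (B x)"
    and CD: "\<And>x. x \<in> D \<Longrightarrow> B x \<in> D \<Longrightarrow> C x \<in> D"
    and BC: "\<And>x. x \<in> D \<Longrightarrow> B x \<in> D \<Longrightarrow> B (C x) = C (B x)"
    and comm1: "\<And>x. x \<in> D \<Longrightarrow> B x \<in> D \<Longrightarrow> C1 (C x) = C (C1 x)"
    and comm2: "\<And>x. x \<in> D \<Longrightarrow> B x \<in> D \<Longrightarrow> C2 (C x) = C (C2 x)"
    and x: "x \<in> D" and y: "y \<in> D"
  shows "inner (S x) (C y) = - inner (C x) (S y)"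
proof (rule S.positive_sqrt_commute[where c = "\<bar>c\<bar> * \<kappa>"])
  fix y w assume "y \<in> D'" "S y \<in> D'" "w \<in> D'" "S w \<in> D'"
  then have y: "y \<in> D" "B y \<in> D" "S y \<in> D" and w: "w \<in> D" "B w \<in> D" "S w \<in> D"
    using S_dom2 by (auto simp: D'_eq)
  note Cy = CD[OF y(1,2)] and Cw = CD[OF w(1,2)]
  have "inner (C y) (S (S w)) = inner (B (C y)) (B w) - inner (C1 (C y)) (C2 w)"
    using S.sym[of "C y" "S w"] S_polarized[OF Cy w(1)] Cy w by (simp add: D'_eq)
  also have "\<dots> = - inner (B y) (C (B w)) + inner (C1 y) (C (C2 w))"
    using skew[OF y(2) w(2)] skew[OF C1_D[OF y(1,2)] C2_D[OF w(1,2)]] BC[OF y(1,2)] comm1[OF y(1,2)] by simp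
  also have "\<dots> = - (inner (B y) (B (C w)) - inner (C1 y) (C2 (C w)))"
    using BC[OF w(1,2)] comm2[OF w(1,2)] by simp
  also have "\<dots> = - inner (S (S y)) (C w)"
    using S.sym[of "S y" "C w"] S_polarized[OF y(1) Cw] Cw y by (simp add: D'_eq)
  finally show "inner (C y) (S (S w)) = - inner (S (S y)) (C w)" .
qed (use assms S_pos S_inj S_bound_from_B[OF bnd] in \<open>auto simp: D'_eq\<close>)

lemma S_C1: "x \<in> D \<Longrightarrow> y \<in> D \<Longrightarrow> inner (S x) (C1 y) = - inner (C1 x) (S y)"
  by (rule S_C_weak[OF C1_lin C1_skew C1_bound C1_D B_C1]) (auto simp: C1_C2)

lemma S_C2: "x \<in> D \<Longrightarrow> y \<in> D \<Longrightarrow> inner (S x) (C2 y) = - inner (C2 x) (S y)"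
  by (rule S_C_weak[OF C2_lin C2_skew C2_bound C2_D B_C2]) (auto simp: C1_C2)

abbreviation "Bbar \<equiv> bounded_ext \<iota> D B"
abbreviation "Sbar \<equiv> bounded_ext \<iota> D S"
abbreviation "C1bar \<equiv> bounded_ext \<iota> D C1"
abbreviation "C2bar \<equiv> bounded_ext \<iota> D C2"

lemma norm_\<iota>: "x \<in> D \<Longrightarrow> norm (\<iota> x) = norm (B x)"
  by (simp add: norm_eq_sqrt_inner \<iota>_inner)

lemma S_lin: "lin_on D S"
  using S.lin by (simp add: D'_eq)

lemma Bbar: "bounded_linear Bbar" "x \<in> D \<Longrightarrow> Bbar (\<iota> x) = B x"
  using bounded_ext[OF \<iota>_lin \<iota>_dense lin, of 1] by (auto simp: norm_\<iota>)

lemma Sbar: "bounded_linear Sbar" "x \<in> D \<Longrightarrow> Sbar (\<iota> x) = S x"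
  using bounded_ext[OF \<iota>_lin \<iota>_dense S_lin, of 2] S_bounds(1) by (auto simp: norm_\<iota>)

lemma C1bar: "bounded_linear C1bar" "x \<in> D \<Longrightarrow> C1bar (\<iota> x) = C1 x"
  using bounded_ext[OF \<iota>_lin \<iota>_dense C1_lin, of c1] C1_bound by (auto simp: norm_\<iota>)

lemma C2bar: "bounded_linear C2bar" "x \<in> D \<Longrightarrow> C2bar (\<iota> x) = C2 x"
  using bounded_ext[OF \<iota>_lin \<iota>_dense C2_lin, of c2] C2_bound by (auto simp: norm_\<iota>)

lemma S_range_dense: "closure (S ` D) = UNIV"
proof (rule dense_subspaceI)
  show "subspace (S ` D)"
    unfolding subspace_def
    using S.subspace_D S.S_simps by (auto simp: D'_eq subspace_0 subspace_add subspace_scale image_iff)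
      (metis subspace_0 subspace_add subspace_scale)+
  fix x assume *: "\<And>w. w \<in> S ` D \<Longrightarrow> inner x w = 0"
  have "x \<in> D' \<and> S x = 0" using S.adj[of x 0] * by (auto simp: D'_eq)
  then show "x = 0" using S_inj by (simp add: D'_eq)
qed

text \<open>The inverse of \<open>Sbar\<close> is itself a bounded extension, of \<open>S x \<mapsto> \<iota> x\<close>.\<close>

definition K :: "'a \<Rightarrow> 'b" where "K = bounded_ext S D \<iota>"

lemma K: "bounded_linear K" "x \<in> D \<Longrightarrow> K (S x) = \<iota> x"
  unfolding K_def
  using bounded_ext[OF S_lin S_range_dense \<iota>_lin, of \<kappa>] S_bounds(2) by (auto simp: norm_\<iota>)

lemma Sbar_K [simp]: "Sbar (K u) = u"
  by (rule dense_image_eq[OF S_range_dense, of "\<lambda>u. Sbar (K u)" "\<lambda>u. u"])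
    (auto simp: K Sbar intro: linear_continuous_on bounded_linear_compose[OF Sbar(1) K(1)])

lemma K_Sbar [simp]: "K (Sbar \<phi>) = \<phi>"
  by (rule dense_image_eq[OF \<iota>_dense, of "\<lambda>u. K (Sbar u)" "\<lambda>u. u"])
    (auto simp: K Sbar intro: linear_continuous_on bounded_linear_compose[OF K(1) Sbar(1)])

lemma inv_Sbar: "inv Sbar = K"
  by (rule inv_equality) simp_all

lemma Sbar_eq_iff: "Sbar \<phi> = Sbar \<phi>' \<longleftrightarrow> \<phi> = \<phi>'"
  by (metis K_Sbar)

lemma inner_ext_eq:
  assumes F: "bounded_linear F" and G: "bounded_linear G" and H: "bounded_linear H"
    and eq: "\<And>x. x \<in> D \<Longrightarrow> inner (F (\<iota> x)) a = inner (G (\<iota> x)) b + inner (H (\<iota> x)) c"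
  shows "inner (F \<phi>) a = inner (G \<phi>) b + inner (H \<phi>) c"
proof (rule dense_image_eq[OF \<iota>_dense, of "\<lambda>\<phi>. inner (F \<phi>) a" "\<lambda>\<phi>. inner (G \<phi>) b + inner (H \<phi>) c"])
  show "continuous_on UNIV (\<lambda>\<phi>. inner (F \<phi>) a)" "continuous_on UNIV (\<lambda>\<phi>. inner (G \<phi>) b + inner (H \<phi>) c)"
    by (intro continuous_on_add continuous_on_inner continuous_on_const linear_continuous_on F G H)+
qed (rule eq)

lemma Sbar_weak: "w \<in> D \<Longrightarrow> inner (Sbar \<phi>) (S w) = inner (Bbar \<phi>) (B w) + inner (C2bar \<phi>) (- C1 w)"
proof (rule inner_ext_eq[OF Sbar(1) Bbar(1) C2bar(1)])
  fix x assume "w \<in> D" "x \<in> D"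
  then show "inner (Sbar (\<iota> x)) (S w) = inner (Bbar (\<iota> x)) (B w) + inner (C2bar (\<iota> x)) (- C1 w)"
    using S_polarized[of w x] inner_commute[of "S w"] inner_commute[of "B w"] inner_commute[of "C1 w"]
    by (simp add: Sbar Bbar C2bar)
qed

lemma C2bar_B_weak: "w \<in> D \<Longrightarrow> inner (C2bar \<phi>) (B w) = inner (Bbar \<phi>) (- C2 w) + inner (Bbar \<phi>) 0"
  by (rule inner_ext_eq[OF C2bar(1) Bbar(1) Bbar(1)])
    (use B_C_weak[OF C2_lin C2_skew C2_bound C2_D B_C2] in \<open>simp add: Bbar C2bar\<close>)

lemma C2bar_S_weak: "w \<in> D \<Longrightarrow> inner (C2bar \<phi>) (S w) = inner (Sbar \<phi>) (- C2 w) + inner (Sbar \<phi>) 0"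
  by (rule inner_ext_eq[OF C2bar(1) Sbar(1) Sbar(1)]) (use S_C2 in \<open>simp add: Sbar C2bar\<close>)

lemma S_in_dom: "(\<And>w. w \<in> D \<Longrightarrow> inner x (S w) = inner y w) \<Longrightarrow> x \<in> D \<and> S x = y"
  using S.adj[of x y] by (simp add: D'_eq)

text \<open>The spaces of second order defined by \<open>Bbar\<close> and by \<open>Sbar\<close> agree. Each claim is first a weak identity
  against \<open>D\<close>, which holds on the completion by density, and then a strong one because \<open>B\<close> and \<open>S\<close> are
  self-adjoint.\<close>

lemma second_order:
  shows "Bbar \<phi> \<in> D \<longleftrightarrow> Sbar \<phi> \<in> D"
    and "Sbar \<phi> \<in> D \<Longrightarrow> C2bar \<phi> \<in> D"
    and "Sbar \<phi> \<in> D \<Longrightarrow> S (C2bar \<phi>) = C2 (Sbar \<phi>)"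
    and "Sbar \<phi> \<in> D \<Longrightarrow> S (Sbar \<phi>) = B (Bbar \<phi>) + C1 (C2bar \<phi>)"
proof -
  have C: "C2bar \<phi> \<in> D \<and> S (C2bar \<phi>) = C2 (Sbar \<phi>)" if S: "Sbar \<phi> \<in> D"
    by (rule S_in_dom) (simp add: C2bar_S_weak C2_skew[OF S])
  have B_to_S: "Sbar \<phi> \<in> D \<and> S (Sbar \<phi>) = B (Bbar \<phi>) + C1 (C2bar \<phi>)" if b: "Bbar \<phi> \<in> D"
  proof (rule S_in_dom)
    fix w assume w: "w \<in> D"
    have C2D: "C2bar \<phi> \<in> D"
      by (rule in_dom[of _ "C2 (Bbar \<phi>)"]) (simp add: C2bar_B_weak C2_skew[OF b])
    show "inner (Sbar \<phi>) (S w) = inner (B (Bbar \<phi>) + C1 (C2bar \<phi>)) w"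
      using Sbar_weak[OF w, of \<phi>] sym[OF b w] C1_skew[OF C2D w] by (simp add: inner_add_left)
  qed
  have S_to_B: "Bbar \<phi> \<in> D" if s: "Sbar \<phi> \<in> D"
  proof (rule in_dom)
    fix w assume w: "w \<in> D"
    show "inner (Bbar \<phi>) (B w) = inner (S (Sbar \<phi>) - C1 (C2bar \<phi>)) w"
      using Sbar_weak[OF w, of \<phi>] S.sym[of "Sbar \<phi>" w] C1_skew[of "C2bar \<phi>" w] C[OF s] s w
      by (simp add: D'_eq inner_diff_left)
  qed
  show "Bbar \<phi> \<in> D \<longleftrightarrow> Sbar \<phi> \<in> D" using B_to_S S_to_B by blast
  show "Sbar \<phi> \<in> D \<Longrightarrow> C2bar \<phi> \<in> D" "Sbar \<phi> \<in> D \<Longrightarrow> S (C2bar \<phi>) = C2 (Sbar \<phi>)"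
    "Sbar \<phi> \<in> D \<Longrightarrow> S (Sbar \<phi>) = B (Bbar \<phi>) + C1 (C2bar \<phi>)"
    using C B_to_S S_to_B by blast+
qed

lemma Bbar_norm: "norm (Bbar \<phi>) \<le> \<kappa> * norm (Sbar \<phi>)"
proof -
  have "closed {\<phi>. norm (Bbar \<phi>) \<le> \<kappa> * norm (Sbar \<phi>)}"
    by (intro closed_Collect_le continuous_intros linear_continuous_on Bbar(1) Sbar(1))
  then have "closure (\<iota> ` D) \<subseteq> {\<phi>. norm (Bbar \<phi>) \<le> \<kappa> * norm (Sbar \<phi>)}"
    by (intro closure_minimal) (auto simp: Bbar Sbar S_bounds)
  then show ?thesis using \<iota>_dense by auto
qed

text \<open>The trace is bounded for the norm built from \<open>B\<close>; this estimate turns the bound into one for the graph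
  norm of \<open>S\<close> in the coordinate \<open>u\<close>.\<close>

lemma B_Bbar_norm:
  assumes u: "u \<in> D"
  shows "norm (B (Bbar (K u))) + norm (Bbar (K u)) \<le>
    (1 + \<bar>c1\<bar> * \<kappa> * (\<bar>c2\<bar> * \<kappa>) + \<kappa>) * (norm u + norm (S u))"
proof -
  have sD: "Sbar (K u) \<in> D" using u by simp
  note so = second_order(2-4)[OF sD]
  let ?c = "C2bar (K u)"
  have "norm (C1 ?c) \<le> (\<bar>c1\<bar> * \<kappa>) * norm (S ?c)" by (rule C1_S[OF so(1)])
  also have "S ?c = C2 u" using so(2) by simp
  also have "(\<bar>c1\<bar> * \<kappa>) * norm (C2 u) \<le> (\<bar>c1\<bar> * \<kappa>) * ((\<bar>c2\<bar> * \<kappa>) * norm (S u))"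
    using C2_S[OF u] \<kappa>_pos by (intro mult_left_mono) auto
  finally have "norm (C1 ?c) \<le> \<bar>c1\<bar> * \<kappa> * (\<bar>c2\<bar> * \<kappa>) * norm (S u)" by (simp add: mult.assoc)
  moreover have "B (Bbar (K u)) = S u - C1 ?c" using so(3) by (simp add: algebra_simps)
  then have "norm (B (Bbar (K u))) \<le> norm (S u) + norm (C1 ?c)" by (simp add: norm_triangle_ineq4)
  moreover have "norm (Bbar (K u)) \<le> \<kappa> * norm u" using Bbar_norm[of "K u"] by simp
  moreover have "0 \<le> \<bar>c1\<bar> * \<kappa> * (\<bar>c2\<bar> * \<kappa>) * norm u" "0 \<le> \<kappa> * norm (S u)" "0 \<le> norm u"
    using \<kappa>_pos by simp_all
  ultimately show ?thesis unfolding distrib_left distrib_right by linarith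
qed

abbreviation "C \<equiv> \<lambda>x. C1 x + C2 x"

lemma C_lin: "lin_on D C"
  using C1_lin C2_lin by (auto simp: lin_on_def algebra_simps)

lemma C_skew: "x \<in> D \<Longrightarrow> y \<in> D \<Longrightarrow> inner (C x) y = - inner x (C y)"
  by (simp add: inner_add_left inner_add_right C1_skew C2_skew)

lemma C_bound: "x \<in> D \<Longrightarrow> norm (C x) \<le> (\<bar>c1\<bar> * \<kappa> + \<bar>c2\<bar> * \<kappa>) * norm (S x)"
  using norm_triangle_ineq[of "C1 x" "C2 x"] C1_S[of x] C2_S[of x] by (simp add: distrib_right)

lemma C_commute: "x \<in> D \<Longrightarrow> y \<in> D \<Longrightarrow> inner (S x) (C y) = - inner (C x) (S y)"
  by (simp add: inner_add_left inner_add_right S_C1 S_C2)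

text \<open>The factorised pencil is \<open>S\<^sup>2 - \<mu> (C1 + C2) + \<mu>\<^sup>2\<close>.\<close>

abbreviation "pencil \<mu> \<phi> \<equiv>
  B (B \<phi>) + (- C1 (- C2 \<phi> + \<mu> *\<^sub>R \<phi>) + \<mu> *\<^sub>R (- C2 \<phi> + \<mu> *\<^sub>R \<phi>))"

lemma pencil_eq:
  assumes "x \<in> D" "B x \<in> D"
  shows "pencil \<mu> x = S (S x) - \<mu> *\<^sub>R C x + \<mu>\<^sup>2 *\<^sub>R x"
proof -
  have "C1 (- C2 x + \<mu> *\<^sub>R x) = - C1 (C2 x) + \<mu> *\<^sub>R C1 x"
    using assms C2_D[OF assms] by (simp add: C1_simps D_closed)
  then show ?thesis using S_sq[OF assms] by (simp add: algebra_simps power2_eq_square)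
qed

lemma pencil_inverse:
  assumes \<mu>: "\<mu> \<noteq> 0"
  defines "p \<equiv> \<lambda>f. inv_into {x \<in> D. B x \<in> D} (pencil \<mu>) f"
  shows "p f \<in> D" "B (p f) \<in> D" "pencil \<mu> (p f) = f" "x \<in> D \<Longrightarrow> B x \<in> D \<Longrightarrow> p (pencil \<mu> x) = x"
proof -
  let ?H2 = "{x \<in> D. B x \<in> D}"
  have surj: "f \<in> pencil \<mu> ` ?H2" for f
  proof -
    have l: "lin_on D (inner f)" using subspace_D by (auto simp: lin_on_def inner_add_right)
    have lb: "\<bar>inner f w\<bar> \<le> norm f * (norm w + norm (S w))" for w
      using Cauchy_Schwarz_ineq2[of f w] by (simp add: algebra_simps add_increasing2)
    obtain q where q: "q \<in> D"
      "\<And>w. w \<in> D \<Longrightarrow> inner (S q) (S w) - \<mu> * inner (C q) w + \<mu>\<^sup>2 * inner q w = inner f w"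
      using S.form_solution[unfolded D'_eq, OF C_lin C_skew C_bound \<mu> l lb] by blast
    have "S q \<in> D \<and> S (S q) = f + \<mu> *\<^sub>R C q - \<mu>\<^sup>2 *\<^sub>R q"
    proof (rule S_in_dom)
      show "inner (S q) (S w) = inner (f + \<mu> *\<^sub>R C q - \<mu>\<^sup>2 *\<^sub>R q) w" if "w \<in> D" for w
        using q(2)[OF that] by (simp add: inner_diff_left inner_add_left)
    qed
    then show ?thesis
      using q(1) S_dom2[OF q(1)] pencil_eq[OF q(1), of \<mu>] by (intro rev_image_eqI[of q]) simp_all
  qed
  have inj: "inj_on (pencil \<mu>) ?H2"
  proof (rule inj_onI)
    fix x y assume xy: "x \<in> ?H2" "y \<in> ?H2" "pencil \<mu> x = pencil \<mu> y"
    define d where "d = x - y"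
    have d: "d \<in> D" "B d \<in> D" "S d \<in> D"
      using xy S_dom2[of d] by (auto simp: d_def D_closed S_simps)
    have Sx: "S x \<in> D" "S y \<in> D" using xy S_dom2 by auto
    have xD: "x \<in> D" "y \<in> D" "B x \<in> D" "B y \<in> D" using xy by auto
    have "S (S d) = S (S x) - S (S y)"
      using xD Sx S.S_simps(4)[of x y] S.S_simps(4)[of "S x" "S y"] by (simp add: D'_eq d_def)
    then have "S (S d) - \<mu> *\<^sub>R C d + \<mu>\<^sup>2 *\<^sub>R d = pencil \<mu> x - pencil \<mu> y"
      unfolding pencil_eq[OF xD(1,3)] pencil_eq[OF xD(2,4)]
      using xD by (simp add: d_def C1_simps C2_simps algebra_simps)
    then have "inner (S (S d) - \<mu> *\<^sub>R C d + \<mu>\<^sup>2 *\<^sub>R d) d = 0" using xy(3) by simp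
    moreover have "inner (C d) d = 0" using C_skew[OF d(1,1)] inner_commute[of d "C d"] by linarith
    ultimately have "inner (S d) (S d) + \<mu>\<^sup>2 * inner d d = 0"
      using S.sym[of "S d" d] d unfolding D'_eq
      by (simp only: inner_add_left inner_diff_left inner_scaleR_left)
    then have "\<mu>\<^sup>2 * inner d d = 0"
      using inner_ge_zero[of "S d"] mult_nonneg_nonneg[OF zero_le_power2[of \<mu>] inner_ge_zero[of d]] by linarith
    then show "x = y" using \<mu> by (simp add: d_def)
  qed
  have "p f \<in> ?H2" unfolding p_def by (rule inv_into_into[OF surj])
  then show "p f \<in> D" "B (p f) \<in> D" by auto
  show "pencil \<mu> (p f) = f" unfolding p_def by (rule f_inv_into_f[OF surj])
  show "x \<in> D \<Longrightarrow> B x \<in> D \<Longrightarrow> p (pencil \<mu> x) = x" unfolding p_def by (rule inv_into_f_f[OF inj]) simp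
qed

text \<open>If \<open>q\<close> solves the weak pencil equation with right-hand side \<open>\<langle>z, T \<cdot>\<rangle>\<close>, then \<open>S q\<close> is the
  value at \<open>z\<close> of the adjoint of \<open>T S\<close> composed with the inverse of the reflected pencil.\<close>

lemma adjoint_resolvent:
  assumes \<mu>: "\<mu> \<noteq> 0" and q: "q \<in> D"
    and pot: "\<And>w. w \<in> D \<Longrightarrow> inner (S q) (S w) - \<mu> * inner (C q) w + \<mu>\<^sup>2 * inner q w = inner z (T w)"
  shows "inner (S q) f = inner z (T (S (inv_into {x \<in> D. B x \<in> D} (pencil (- \<mu>)) f)))"
proof -
  define p where "p = inv_into {x \<in> D. B x \<in> D} (pencil (- \<mu>)) f"
  have p: "p \<in> D" "B p \<in> D" "pencil (- \<mu>) p = f"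
    using pencil_inverse(1-3)[of "- \<mu>" f] \<mu> by (simp_all add: p_def)
  have Sp: "S p \<in> D" using S_dom2 p by simp
  have f: "f = S (S p) + \<mu> *\<^sub>R C p + \<mu>\<^sup>2 *\<^sub>R p" using pencil_eq[OF p(1,2), of "- \<mu>"] p(3) by simp
  have "inner z (T (S p)) = inner (S q) (S (S p)) - \<mu> * inner (C q) (S p) + \<mu>\<^sup>2 * inner q (S p)"
    using pot[OF Sp] by simp
  also have "\<dots> = inner (S q) f"
    using C_commute[OF q p(1)] S.sym[of q p] q p(1) by (simp add: f D'_eq inner_add_right)
  finally show ?thesis by (simp add: p_def)
qed

end

section \<open>The regularised trace and the extension\<close>

text \<open>The hypotheses of the theorem after passage to real parts. Roughness and the limit conditions are
  stated for the trace in the coordinate \<open>u = Sbar \<phi>\<close>, that is for \<open>w \<mapsto> \<tau> (K w)\<close>.\<close>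

locale wave_trace = wave D B \<iota> C1 C2 c1 c2 D' S
  for D :: "'a::{real_inner,complete_space} set" and B and \<iota> :: "'a \<Rightarrow> 'b::{real_inner,complete_space}"
    and C1 C2 and c1 c2 :: real and D' and S +
  fixes \<tau> :: "'b \<Rightarrow> 'h::{real_inner,complete_space}" and t :: real and \<Theta> :: "'h \<Rightarrow> 'h"
    and J :: "real \<Rightarrow> 'a \<Rightarrow> 'a"
  assumes \<tau>_lin: "lin_on {\<phi>. Bbar \<phi> \<in> D} \<tau>"
    and \<tau>_bound: "Bbar \<phi> \<in> D \<Longrightarrow> norm (\<tau> \<phi>) \<le> t * (norm (B (Bbar \<phi>)) + norm (Bbar \<phi>))"
    and \<Theta>_bl: "bounded_linear \<Theta>"
    and \<Theta>_sym: "inner (\<Theta> x) y = inner x (\<Theta> y)"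
    and \<Theta>_pos: "0 \<le> inner (\<Theta> x) x"
    and \<Theta>_inj: "\<Theta> x = 0 \<Longrightarrow> x = 0"
    and J_lin: "\<nu> > 0 \<Longrightarrow> lin_on UNIV (J \<nu>)"
    and J_sym: "\<nu> > 0 \<Longrightarrow> inner (J \<nu> a) b = inner a (J \<nu> b)"
    and J_D: "\<nu> > 0 \<Longrightarrow> J \<nu> a \<in> D"
    and J_bound: "\<nu> > 0 \<Longrightarrow> \<exists>K. \<forall>a. norm (J \<nu> a) \<le> K * norm a \<and> norm (B (J \<nu> a)) \<le> K * norm a"
    and J_S: "\<nu> > 0 \<Longrightarrow> a \<in> D \<Longrightarrow> J \<nu> (S a) = S (J \<nu> a)"
    and J_C: "\<nu> > 0 \<Longrightarrow> a \<in> D \<Longrightarrow> J \<nu> (C a) = C (J \<nu> a)"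
    and J_lim: "((\<lambda>\<nu>. J \<nu> a) \<longlongrightarrow> a) (at_right 0)"
    and range_full: "\<exists>\<phi> z. Bbar \<phi> \<in> D \<and> \<tau> \<phi> - \<Theta> z = y"
    and rough: "(\<And>w. w \<in> D \<Longrightarrow> inner z (\<tau> (K w)) = inner a w) \<Longrightarrow> z = 0"
    and lim_C1: "\<mu> \<noteq> 0 \<Longrightarrow> q \<in> D \<Longrightarrow>
      (\<And>w. w \<in> D \<Longrightarrow> inner (S q) (S w) - \<mu> * inner (C q) w + \<mu>\<^sup>2 * inner q w = inner z (\<tau> (K w))) \<Longrightarrow>
      \<exists>l. ((\<lambda>\<nu>. \<tau> (bounded_ext \<iota> D (\<lambda>\<phi>. \<iota> (J \<nu> \<phi>)) (- K (C1 q)))) \<longlongrightarrow> l) (at_right 0)"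
    and lim_C2: "\<mu> \<noteq> 0 \<Longrightarrow> q \<in> D \<Longrightarrow>
      (\<And>w. w \<in> D \<Longrightarrow> inner (S q) (S w) - \<mu> * inner (C q) w + \<mu>\<^sup>2 * inner q w = inner z (\<tau> (K w))) \<Longrightarrow>
      \<exists>l. ((\<lambda>\<nu>. \<tau> (bounded_ext \<iota> D (\<lambda>\<phi>. \<iota> (J \<nu> \<phi>)) (- K (C2 q)))) \<longlongrightarrow> l) (at_right 0)"
begin

abbreviation "Jbar \<nu> \<equiv> bounded_ext \<iota> D (\<lambda>\<phi>. \<iota> (J \<nu> \<phi>))"
abbreviation "T \<equiv> \<lambda>u. \<tau> (K u)"

lemma S_J_bound: "\<nu> > 0 \<Longrightarrow> \<exists>K. \<forall>a. norm (S (J \<nu> a)) \<le> K * norm a"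
proof -
  assume \<nu>: "\<nu> > 0"
  obtain K where "\<And>a. norm (B (J \<nu> a)) \<le> K * norm a" using J_bound[OF \<nu>] by blast
  then have "norm (S (J \<nu> a)) \<le> (2 * K) * norm a" for a
    using order_trans[OF S_bounds(1)[OF J_D[OF \<nu>, of a]] mult_left_mono[of _ "K * norm a" 2]] by simp
  then show ?thesis by blast
qed

lemma J_bl: "\<nu> > 0 \<Longrightarrow> bounded_linear (J \<nu>)"
proof -
  assume \<nu>: "\<nu> > 0"
  obtain K where "\<And>a. norm (J \<nu> a) \<le> K * norm a" using J_bound[OF \<nu>] by blast
  with J_lin[OF \<nu>] show ?thesis by (rule bounded_linearI_lin_on)
qed

lemma Jbar:
  assumes \<nu>: "\<nu> > 0"
  shows "bounded_linear (Jbar \<nu>)" "Jbar \<nu> \<phi> = K (J \<nu> (Sbar \<phi>))"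
proof -
  note J' = lin_onD[OF J_lin[OF \<nu>]] and \<iota>' = lin_onD[OF \<iota>_lin]
  have lin: "lin_on D (\<lambda>\<phi>. \<iota> (J \<nu> \<phi>))"
    using subspace_D J_D[OF \<nu>] by (auto simp: lin_on_def J' \<iota>')
  obtain c where c: "\<And>a. norm (B (J \<nu> a)) \<le> c * norm a" using J_bound[OF \<nu>] by blast
  obtain c' where c': "\<And>a. norm (J \<nu> a) \<le> c' * norm a" using J_bound[OF \<nu>] by blast
  have bnd: "norm (\<iota> (J \<nu> x)) \<le> (\<kappa> * (\<bar>c'\<bar> * 2)) * norm (\<iota> x)" if x: "x \<in> D" for x
  proof -
    have "norm (B (J \<nu> x)) \<le> \<kappa> * norm (S (J \<nu> x))" by (rule S_bounds(2)[OF J_D[OF \<nu>]])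
    also have "S (J \<nu> x) = J \<nu> (S x)" using J_S[OF \<nu> x] by simp
    also have "norm (J \<nu> (S x)) \<le> c' * norm (S x)" by (rule c')
    also have "\<dots> \<le> \<bar>c'\<bar> * (2 * norm (B x))" by (intro mult_mono S_bounds(1) x) auto
    finally show ?thesis using \<kappa>_pos by (simp add: norm_\<iota> J_D[OF \<nu>] x mult_ac)
  qed
  show bl: "bounded_linear (Jbar \<nu>)" by (rule bounded_linear_bounded_ext[OF \<iota>_lin \<iota>_dense lin bnd])
  show "Jbar \<nu> \<phi> = K (J \<nu> (Sbar \<phi>))"
  proof (rule dense_image_eq[OF \<iota>_dense, of "Jbar \<nu>" "\<lambda>\<phi>. K (J \<nu> (Sbar \<phi>))"])
    have "bounded_linear (\<lambda>\<phi>. K (J \<nu> (Sbar \<phi>)))"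
      by (intro bounded_linear_compose[OF K(1)] bounded_linear_compose[OF J_bl[OF \<nu>]] Sbar(1))
    then show "continuous_on UNIV (\<lambda>\<phi>. K (J \<nu> (Sbar \<phi>)))" by (rule linear_continuous_on)
    show "Jbar \<nu> (\<iota> x) = K (J \<nu> (Sbar (\<iota> x)))" if "x \<in> D" for x
      using bounded_ext_apply[OF \<iota>_lin \<iota>_dense lin bnd that] J_D[OF \<nu>] that
      by (simp add: Sbar J_S[OF \<nu>] K(2))
  qed (rule linear_continuous_on[OF bl])
qed

lemma K_simps: "K (x + y) = K x + K y" "K (x - y) = K x - K y" "K (r *\<^sub>R x) = r *\<^sub>R K x" "K (- x) = - K x" "K 0 = 0"
  using bounded_linear.linear[OF K(1)] by (simp_all add: linear_add linear_diff linear_scale linear_neg linear_0)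

lemma Sbar_simps: "Sbar (x + y) = Sbar x + Sbar y" "Sbar (x - y) = Sbar x - Sbar y"
    "Sbar (r *\<^sub>R x) = r *\<^sub>R Sbar x" "Sbar 0 = 0"
  using bounded_linear.linear[OF Sbar(1)] by (simp_all add: linear_add linear_diff linear_scale linear_0)

lemma C2bar_simps: "C2bar (x + y) = C2bar x + C2bar y" "C2bar (x - y) = C2bar x - C2bar y"
    "C2bar (r *\<^sub>R x) = r *\<^sub>R C2bar x" "C2bar 0 = 0"
  using bounded_linear.linear[OF C2bar(1)] by (simp_all add: linear_add linear_diff linear_scale linear_0)

lemma Bbar_K_D: "u \<in> D \<Longrightarrow> Bbar (K u) \<in> D"
  by (simp add: second_order(1))

lemma T_lin: "lin_on D T"
  using subspace_D lin_onD[OF \<tau>_lin] Bbar_K_D by (auto simp: lin_on_def K_simps)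

lemma T_J_lim:
  assumes "x \<in> D" "\<exists>l. ((\<lambda>\<nu>. \<tau> (Jbar \<nu> (- K (A x)))) \<longlongrightarrow> l) (at_right 0)"
  shows "\<exists>l. ((\<lambda>\<nu>. T (J \<nu> (A x))) \<longlongrightarrow> l) (at_right 0)"
proof -
  obtain l where l: "((\<lambda>\<nu>. \<tau> (Jbar \<nu> (- K (A x)))) \<longlongrightarrow> l) (at_right 0)" using assms by blast
  have "eventually (\<lambda>\<nu>::real. \<nu> > 0) (at_right 0)" by (auto simp: eventually_at_filter)
  then have "eventually (\<lambda>\<nu>. - \<tau> (Jbar \<nu> (- K (A x))) = T (J \<nu> (A x))) (at_right 0)"
  proof eventually_elim
    case (elim \<nu>)
    have "Jbar \<nu> (- K (A x)) = - K (J \<nu> (A x))"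
      using linear_neg[OF bounded_linear.linear[OF Jbar(1)[OF elim]]] by (simp add: Jbar[OF elim])
    then show ?case
      using lin_onD(4)[OF \<tau>_lin, of "K (J \<nu> (A x))"] Bbar_K_D[OF J_D[OF elim]] by simp
  qed
  from Lim_transform_eventually[OF tendsto_minus[OF l] this] show ?thesis by (rule exI)
qed

sublocale coupled: coupled D S C "\<bar>c1\<bar> * \<kappa> + \<bar>c2\<bar> * \<kappa>" T
  "\<bar>t\<bar> * (1 + \<bar>c1\<bar> * \<kappa> * (\<bar>c2\<bar> * \<kappa>) + \<kappa>)" \<Theta> J
proof (intro_locales)
  show "self_adj D S" using S_sa by (simp add: D'_eq)
  show "coupled_axioms D S C (\<bar>c1\<bar> * \<kappa> + \<bar>c2\<bar> * \<kappa>) T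
    (\<bar>t\<bar> * (1 + \<bar>c1\<bar> * \<kappa> * (\<bar>c2\<bar> * \<kappa>) + \<kappa>)) \<Theta> J"
  proof (rule coupled_axioms.intro)
    show "norm (T x) \<le> \<bar>t\<bar> * (1 + \<bar>c1\<bar> * \<kappa> * (\<bar>c2\<bar> * \<kappa>) + \<kappa>) * (norm x + norm (S x))" if "x \<in> D" for x
    proof -
      have "norm (T x) \<le> t * (norm (B (Bbar (K x))) + norm (Bbar (K x)))"
        by (rule \<tau>_bound[OF Bbar_K_D[OF that]])
      also have "\<dots> \<le> \<bar>t\<bar> * ((1 + \<bar>c1\<bar> * \<kappa> * (\<bar>c2\<bar> * \<kappa>) + \<kappa>) * (norm x + norm (S x)))"
        using B_Bbar_norm[OF that] by (intro mult_mono) auto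
      finally show ?thesis by (simp add: mult.assoc)
    qed
    show "\<exists>w\<in>D. \<exists>z. T w - \<Theta> z = y" for y
    proof -
      obtain \<phi> z where "Bbar \<phi> \<in> D" "\<tau> \<phi> - \<Theta> z = y" using range_full by blast
      then show ?thesis by (intro bexI[of _ "Sbar \<phi>"]) (auto simp: second_order(1))
    qed
    show "\<exists>l. ((\<lambda>\<nu>. T (J \<nu> (C q))) \<longlongrightarrow> l) (at_right 0)"
      if h: "\<mu> \<noteq> 0" "q \<in> D"
        "\<And>w. w \<in> D \<Longrightarrow> inner (S q) (S w) - \<mu> * inner (C q) w + \<mu>\<^sup>2 * inner q w = inner z (T w)" for \<mu> z q
    proof -
      obtain l1 where l1: "((\<lambda>\<nu>. T (J \<nu> (C1 q))) \<longlongrightarrow> l1) (at_right 0)"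
        using T_J_lim[where A = C1, OF h(2) lim_C1[OF h]] by blast
      obtain l2 where l2: "((\<lambda>\<nu>. T (J \<nu> (C2 q))) \<longlongrightarrow> l2) (at_right 0)"
        using T_J_lim[where A = C2, OF h(2) lim_C2[OF h]] by blast
      have "eventually (\<lambda>\<nu>::real. \<nu> > 0) (at_right 0)" by (auto simp: eventually_at_filter)
      then have "eventually (\<lambda>\<nu>. T (J \<nu> (C1 q)) + T (J \<nu> (C2 q)) = T (J \<nu> (C q))) (at_right 0)"
        by eventually_elim (use lin_onD(2)[OF J_lin] lin_onD(2)[OF T_lin] J_D in simp)
      from Lim_transform_eventually[OF tendsto_add[OF l1 l2] this] show ?thesis by (rule exI)
    qed
    show "z = 0" if "\<And>w. w \<in> D \<Longrightarrow> inner z (T w) = inner x w" for z x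
      using that by (rule rough)
  qed (use C_lin C_skew C_bound C_commute T_lin \<Theta>_bl \<Theta>_sym \<Theta>_pos \<Theta>_inj J_bl J_sym J_D S_J_bound J_S J_C J_lim
      in \<open>simp_all\<close>)
qed

text \<open>In the coordinates \<open>u = Sbar \<phi>\<close>, \<open>v = \<psi> + C2bar \<phi>\<close> the energy product is the product of
  \<open>H\<^sub>0 \<times> H\<^sub>0\<close> and the wave operator is the block operator with rows \<open>0, S\<close> and \<open>- S, C1 + C2\<close>.\<close>

definition coords :: "'b \<times> 'a \<times> 'h \<Rightarrow> 'a \<times> 'a \<times> 'h"
  where "coords = (\<lambda>(\<phi>, \<psi>, z). (Sbar \<phi>, \<psi> + C2bar \<phi>, z))"

lemma coords_simps: "coords (x + y) = coords x + coords y" "coords (x - y) = coords x - coords y"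
    "coords (r *\<^sub>R x) = r *\<^sub>R coords x" "coords 0 = 0" "coords (- x) = - coords x"
proof -
  have "linear coords"
    by (rule linearI) (auto simp: coords_def Sbar_simps C2bar_simps algebra_simps)
  then show "coords (x + y) = coords x + coords y" "coords (x - y) = coords x - coords y"
    "coords (r *\<^sub>R x) = r *\<^sub>R coords x" "coords 0 = 0" "coords (- x) = - coords x"
    by (simp_all add: linear_add linear_diff linear_scale linear_0 linear_neg)
qed

lemma coords_inj: "coords x = coords y \<longleftrightarrow> x = y"
  by (cases x, cases y) (auto simp: coords_def Sbar_eq_iff)

lemma coords_surj: "coords (K u, v - C2bar (K u), z) = (u, v, z)"
  by (simp add: coords_def)

text \<open>The operator of the theorem, with the potential \<open>q\<close> in place of \<open>B\<^sub>C\<^sup>-\<^sup>1 G \<lambda> z\<close> and the regularised trace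
  written as a limit.\<close>

definition extension :: "real \<Rightarrow> (('b \<times> 'a \<times> 'h) \<times> ('b \<times> 'a \<times> 'h)) set"
  where "extension \<mu> = {((\<phi>0, \<psi>0, \<zeta>),
      (\<iota> (C2bar \<phi> + \<psi>) - \<mu> *\<^sub>R K (- C q + \<mu> *\<^sub>R q),
       C1 \<psi> - B (Bbar \<phi>) + \<mu> *\<^sub>R C2bar (K (- C q + \<mu> *\<^sub>R q)), z)) | \<phi>0 \<psi>0 \<zeta> \<phi> \<psi> z q.
    Bbar \<phi> \<in> D \<and> \<psi> \<in> D \<and> q = coupled.Q \<mu> z \<and> \<phi>0 = \<phi> + K (C q) \<and>
    \<psi>0 = \<psi> + (S q - C2bar (K (C q))) \<and> ((\<lambda>\<nu>. \<tau> (Jbar \<nu> \<phi>0)) \<longlongrightarrow> \<Theta> \<zeta>) (at_right 0)}"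

lemma regularized_trace: "((\<lambda>\<nu>. \<tau> (Jbar \<nu> \<phi>)) \<longlongrightarrow> l) (at_right 0) \<longleftrightarrow>
    ((\<lambda>\<nu>. T (J \<nu> (Sbar \<phi>))) \<longlongrightarrow> l) (at_right 0)"
proof (rule tendsto_cong)
  have "eventually (\<lambda>\<nu>::real. \<nu> > 0) (at_right 0)" by (auto simp: eventually_at_filter)
  then show "eventually (\<lambda>\<nu>. \<tau> (Jbar \<nu> \<phi>) = T (J \<nu> (Sbar \<phi>))) (at_right 0)"
    by eventually_elim (simp add: Jbar)
qed

text \<open>In coordinates the defining data become the regular parts \<open>Sbar \<phi>\<close> and \<open>\<psi> + C2bar \<phi>\<close> of \<open>W_explicit\<close>. In
  the second component of the image the terms with factor \<open>\<mu>\<close> cancel against those which the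
  coordinate change contributes.\<close>

lemma extension_iff:
  assumes \<mu>: "\<mu> \<noteq> 0"
  shows "(x, y) \<in> extension \<mu> \<longleftrightarrow> (coords x, coords y) \<in> coupled.W"
proof -
  have target: "coords (\<iota> (C2bar \<phi> + \<psi>) - \<mu> *\<^sub>R K (- C q + \<mu> *\<^sub>R q),
       C1 \<psi> - B (Bbar \<phi>) + \<mu> *\<^sub>R C2bar (K (- C q + \<mu> *\<^sub>R q)), z) =
      (S (\<psi> + C2bar \<phi>) + \<mu> *\<^sub>R C q - \<mu>\<^sup>2 *\<^sub>R q, C (\<psi> + C2bar \<phi>) - S (Sbar \<phi>), z)"
    if \<phi>: "Bbar \<phi> \<in> D" and \<psi>: "\<psi> \<in> D" for \<phi> \<psi> q z
  proof -
    have s: "Sbar \<phi> \<in> D" using \<phi> by (simp add: second_order(1))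
    note so = second_order(2-4)[OF s]
    have D: "C2bar \<phi> + \<psi> \<in> D" using so(1) \<psi> by (simp add: D_closed)
    show ?thesis
      unfolding coords_def using D \<psi> so
      by (simp add: Sbar_simps C2bar_simps Sbar C2bar C1_simps add.commute[of "C2bar \<phi>"] power2_eq_square
          algebra_simps)
  qed
  have source: "coords (\<phi> + K (C q), \<psi> + (S q - C2bar (K (C q))), \<zeta>) =
      (Sbar \<phi> + C q, (\<psi> + C2bar \<phi>) + S q, \<zeta>)" for \<phi> \<psi> q \<zeta>
    by (simp add: coords_def Sbar_simps C2bar_simps)
  obtain \<phi>0 \<psi>0 \<zeta> where x: "x = (\<phi>0, \<psi>0, \<zeta>)" by (metis surj_pair)
  obtain u v z u' v' z' where c: "coords x = (u, v, z)" "coords y = (u', v', z')" by (metis surj_pair)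
  show ?thesis
  proof
    assume "(x, y) \<in> extension \<mu>"
    then obtain \<phi> \<psi> z q where *: "Bbar \<phi> \<in> D" "\<psi> \<in> D" "q = coupled.Q \<mu> z" "\<phi>0 = \<phi> + K (C q)"
      "\<psi>0 = \<psi> + (S q - C2bar (K (C q)))" "((\<lambda>\<nu>. \<tau> (Jbar \<nu> \<phi>0)) \<longlongrightarrow> \<Theta> \<zeta>) (at_right 0)"
      "y = (\<iota> (C2bar \<phi> + \<psi>) - \<mu> *\<^sub>R K (- C q + \<mu> *\<^sub>R q),
         C1 \<psi> - B (Bbar \<phi>) + \<mu> *\<^sub>R C2bar (K (- C q + \<mu> *\<^sub>R q)), z)"
      unfolding extension_def x by blast
    have s: "Sbar \<phi> \<in> D" using *(1) by (simp add: second_order(1))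
    have v: "\<psi> + C2bar \<phi> \<in> D" using *(2) second_order(2)[OF s] by (simp add: D_closed)
    have "((\<lambda>\<nu>. T (J \<nu> (Sbar \<phi> + C q))) \<longlongrightarrow> \<Theta> \<zeta>) (at_right 0)"
      using *(6) by (simp add: regularized_trace *(4) Sbar_simps)
    then show "(coords x, coords y) \<in> coupled.W"
      unfolding x *(4,5,7) source target[OF *(1,2)] coupled.W_explicit[OF \<mu>] *(3)[symmetric]
      using s v by blast
  next
    assume "(coords x, coords y) \<in> coupled.W"
    then obtain ul vl where *: "ul \<in> D" "vl \<in> D" "u = ul + C (coupled.Q \<mu> z')" "v = vl + S (coupled.Q \<mu> z')"
      "u' = S vl + \<mu> *\<^sub>R C (coupled.Q \<mu> z') - \<mu>\<^sup>2 *\<^sub>R coupled.Q \<mu> z'" "v' = C vl - S ul"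
      "((\<lambda>\<nu>. T (J \<nu> u)) \<longlongrightarrow> \<Theta> z) (at_right 0)"
      unfolding c coupled.W_explicit[OF \<mu>] by blast
    define q where "q = coupled.Q \<mu> z'"
    define \<phi> where "\<phi> = K ul"
    define \<psi> where "\<psi> = vl - C2bar \<phi>"
    have s: "Sbar \<phi> = ul" by (simp add: \<phi>_def)
    have \<phi>: "Bbar \<phi> \<in> D" using *(1) by (simp add: second_order(1) s)
    have \<psi>: "\<psi> \<in> D" using *(1,2) second_order(2)[of \<phi>] by (simp add: \<psi>_def s D_closed)
    have "coords x = coords (\<phi> + K (C q), \<psi> + (S q - C2bar (K (C q))), \<zeta>)"
      using c(1) *(3,4) unfolding source q_def by (simp add: x coords_def s \<psi>_def)
    then have x': "x = (\<phi> + K (C q), \<psi> + (S q - C2bar (K (C q))), \<zeta>)" by (simp only: coords_inj)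
    have z: "z = \<zeta>" using c(1) by (simp add: x coords_def)
    have "coords y = coords (\<iota> (C2bar \<phi> + \<psi>) - \<mu> *\<^sub>R K (- C q + \<mu> *\<^sub>R q),
         C1 \<psi> - B (Bbar \<phi>) + \<mu> *\<^sub>R C2bar (K (- C q + \<mu> *\<^sub>R q)), z')"
      unfolding target[OF \<phi> \<psi>] c(2) *(5,6) q_def by (simp add: \<psi>_def s)
    then have y': "y = (\<iota> (C2bar \<phi> + \<psi>) - \<mu> *\<^sub>R K (- C q + \<mu> *\<^sub>R q),
         C1 \<psi> - B (Bbar \<phi>) + \<mu> *\<^sub>R C2bar (K (- C q + \<mu> *\<^sub>R q)), z')" by (simp only: coords_inj)
    have lim: "((\<lambda>\<nu>. \<tau> (Jbar \<nu> (\<phi> + K (C q)))) \<longlongrightarrow> \<Theta> \<zeta>) (at_right 0)"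
      using *(3,7) by (simp add: regularized_trace Sbar_simps s q_def z)
    show "(x, y) \<in> extension \<mu>"
      unfolding extension_def x' y' using \<phi> \<psi> lim q_def by blast
  qed
qed

definition constraint :: "('b \<times> 'a \<times> 'h) set"
  where "constraint = {(\<phi>, \<psi>, z). Bbar \<phi> \<in> D \<and> \<psi> \<in> D \<and> \<tau> \<phi> = \<Theta> z}"

lemma constraint_coords: "coords x = (u, v, z) \<Longrightarrow> x \<in> constraint \<longleftrightarrow> u \<in> D \<and> v \<in> D \<and> T u = \<Theta> z"
proof -
  assume u: "coords x = (u, v, z)"
  obtain \<phi> \<psi> \<zeta> where x: "x = (\<phi>, \<psi>, \<zeta>)" by (metis surj_pair)
  have "\<psi> \<in> D \<longleftrightarrow> \<psi> + C2bar \<phi> \<in> D" if "Sbar \<phi> \<in> D"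
    using second_order(2)[OF that] D_closed(1)[of \<psi> "C2bar \<phi>"] D_closed(2)[of "\<psi> + C2bar \<phi>" "C2bar \<phi>"] by auto
  then show ?thesis using u by (auto simp: x constraint_def coords_def second_order(1))
qed

lemma constraint_dense:
  assumes "e > 0"
  shows "\<exists>y\<in>constraint. coupled.form (coords (x - y)) (coords (x - y)) < e"
proof -
  obtain u v z where n: "u \<in> D" "v \<in> D" "T u = \<Theta> z"
    "coupled.form (coords x - (u, v, z)) (coords x - (u, v, z)) < e"
    using coupled.dense_constraint[OF assms, of "coords x"] by auto
  have "(K u, v - C2bar (K u), z) \<in> constraint" using n constraint_coords[OF coords_surj] by blast
  then show ?thesis using n(4) by (intro bexI) (simp_all add: coords_simps coords_surj)
qed

lemma restriction_subset:
  assumes \<mu>: "\<mu> \<noteq> 0" and x: "(\<phi>, \<psi>, z) \<in> constraint"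
  shows "((\<phi>, \<psi>, z), (\<iota> (C2bar \<phi> + \<psi>), C1 \<psi> - B (Bbar \<phi>), 0)) \<in> extension \<mu>"
proof -
  have Q0: "coupled.Q \<mu> 0 = 0" using coupled.Q_scale[OF \<mu>, of 0 0] by simp
  have *: "Bbar \<phi> \<in> D" "\<psi> \<in> D" "\<tau> \<phi> = \<Theta> z" using x by (auto simp: constraint_def)
  have s: "Sbar \<phi> \<in> D" using *(1) by (simp add: second_order(1))
  have "((\<lambda>\<nu>. \<tau> (Jbar \<nu> \<phi>)) \<longlongrightarrow> \<Theta> z) (at_right 0)"
    unfolding regularized_trace using coupled.T_smooth[OF s] *(3) by simp
  moreover have "C1 0 = 0" "C2 0 = 0" "S 0 = 0" using C1_simps C2_simps coupled.S_simps by auto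
  ultimately show ?thesis
    unfolding extension_def using *(1,2)
    by (auto simp: Q0 K_simps C2bar_simps intro!: exI[of _ \<phi>] exI[of _ \<psi>] exI[of _ "0::'h"])
qed

end

section \<open>Skew-adjointness of the extension\<close>

theorem theorem4p8:
  fixes scale0 :: "'k::rc_field \<Rightarrow> 'a::{real_inner,complete_space} \<Rightarrow> 'a" and ip0 :: "'a \<Rightarrow> 'a \<Rightarrow> 'k"
    and DB :: "'a set" and B :: "'a \<Rightarrow> 'a"
    and scale1 :: "'k \<Rightarrow> 'b::{real_inner,complete_space} \<Rightarrow> 'b" and ip1 :: "'b \<Rightarrow> 'b \<Rightarrow> 'k"
    and \<iota> :: "'a \<Rightarrow> 'b"
    and E :: "nat \<Rightarrow> 'a set" and R :: "nat \<Rightarrow> 'a \<Rightarrow> 'a"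
    and scalem1 :: "'k \<Rightarrow> 'm1::{real_inner,complete_space} \<Rightarrow> 'm1" and ipm1 :: "'m1 \<Rightarrow> 'm1 \<Rightarrow> 'k"
    and \<iota>m1 :: "'a \<Rightarrow> 'm1"
    and scalem2 :: "'k \<Rightarrow> 'm2::{real_inner,complete_space} \<Rightarrow> 'm2" and ipm2 :: "'m2 \<Rightarrow> 'm2 \<Rightarrow> 'k"
    and \<iota>m2 :: "'a \<Rightarrow> 'm2"
    and scaleh :: "'k \<Rightarrow> 'h::{real_inner,complete_space} \<Rightarrow> 'h" and iph :: "'h \<Rightarrow> 'h \<Rightarrow> 'k"
    and \<Theta> :: "'h \<Rightarrow> 'h" and \<tau> :: "'b \<Rightarrow> 'h"
    and C1 C2 :: "'a \<Rightarrow> 'a" and c1 c2 :: real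
    and DBC :: "'a set" and BC :: "'a \<Rightarrow> 'a"
    and J :: "real \<Rightarrow> 'a \<Rightarrow> 'a" and lam :: real
  defines "H \<equiv> \<lambda>k. dom_pow DB B k"
  defines "Bbar \<equiv> bounded_ext \<iota> (H 1) B"
  defines "Hbar \<equiv> \<lambda>k. {\<phi>. Bbar \<phi> \<in> H (k - 1)}"
  defines "Rinv \<equiv> \<lambda>k. inv_into (E k) (R k)"
  defines "Rinvbar2 \<equiv> bounded_ext \<iota>m2 UNIV (Rinv 2)"
  defines "incl \<equiv> bounded_ext \<iota>m1 UNIV \<iota>m2"
  defines "tau_star \<equiv> \<lambda>\<zeta>. THE \<eta>. \<forall>\<phi>\<in>H 2. ip0 (Rinvbar2 \<eta>) (R 2 \<phi>) = iph \<zeta> (\<tau> (\<iota> \<phi>))"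
  defines "BbarC \<equiv> bounded_ext \<iota> (H 1) BC"
  defines "BbarCinv \<equiv> inv BbarC"
  defines "BCinv \<equiv> inv_into DBC BC"
  defines "Cbar1 \<equiv> bounded_ext \<iota> (H 1) C1"
  defines "Cbar2 \<equiv> bounded_ext \<iota> (H 1) C2"
  defines "Cstar1 \<equiv> \<lambda>\<phi>. - BbarCinv (Cbar1 (BbarCinv \<phi>))"
  defines "Cstar2 \<equiv> \<lambda>\<phi>. - BbarCinv (Cbar2 (BbarCinv \<phi>))"
  defines "Jbar \<equiv> \<lambda>\<nu>. bounded_ext \<iota> (H 1) (\<lambda>\<phi>. \<iota> (J \<nu> \<phi>))"
  defines "Dtaubar \<equiv> {\<phi>. \<exists>z. ((\<lambda>\<nu>. \<tau> (Jbar \<nu> \<phi>)) \<longlongrightarrow> z) (at_right 0)}"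
  defines "taubar \<equiv> \<lambda>\<phi>. Lim (at_right 0) (\<lambda>\<nu>. \<tau> (Jbar \<nu> \<phi>))"
  defines "L \<equiv> \<lambda>\<mu> \<phi>. B (B \<phi>) + (- C1 (- C2 \<phi> + \<mu> *\<^sub>R \<phi>) + \<mu> *\<^sub>R (- C2 \<phi> + \<mu> *\<^sub>R \<phi>))"
  defines "Gbreve \<equiv> \<lambda>\<mu> \<psi>. \<tau> (\<iota> (inv_into (H 2) (L \<mu>) \<psi>))"
  defines "G \<equiv> \<lambda>\<mu>. bounded_adjoint ip0 iph (Gbreve (- \<mu>))"
  defines "scaleT \<equiv> \<lambda>c (\<phi>, \<psi>, \<zeta>). (scale1 c \<phi>, scale0 c \<psi>, scaleh c \<zeta>)"
  defines "ipT \<equiv> \<lambda>(\<phi>1, \<psi>1, \<zeta>1) (\<phi>2, \<psi>2, \<zeta>2).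
      ip0 (BbarC \<phi>1) (BbarC \<phi>2) + ip0 (\<psi>1 + Cbar2 \<phi>1) (\<psi>2 + Cbar2 \<phi>2) + iph (\<Theta> \<zeta>1) \<zeta>2"
  defines "Wg \<equiv> \<lambda>(\<phi>, \<psi>, \<zeta>::'h). (\<iota> (Cbar2 \<phi> + \<psi>), C1 \<psi> - B (Bbar \<phi>), 0::'h)"
  defines "N\<Theta> \<equiv> {(\<phi>, \<psi>, \<zeta>). \<phi> \<in> Hbar 2 \<and> \<psi> \<in> H 1 \<and> \<tau> \<phi> = \<Theta> \<zeta>}"
  defines "W\<Theta> \<equiv> {((\<phi>0, \<psi>0, \<zeta>\<phi>),
        (\<iota> (Cbar2 \<phi>l + \<psi>l) - lam *\<^sub>R BbarCinv (- (C1 q + C2 q) + lam *\<^sub>R q),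
         C1 \<psi>l - B (Bbar \<phi>l) + lam *\<^sub>R Cbar2 (BbarCinv (- (C1 q + C2 q) + lam *\<^sub>R q)),
         \<zeta>\<psi>)) | \<phi>0 \<psi>0 \<zeta>\<phi> \<phi>l \<psi>l \<zeta>\<psi> q.
      \<phi>l \<in> Hbar 2 \<and> \<psi>l \<in> H 1 \<and> q = BCinv (G lam \<zeta>\<psi>) \<and>
      \<phi>0 = \<phi>l + BbarCinv (C1 q + C2 q) \<and>
      \<psi>0 = \<psi>l + (G lam \<zeta>\<psi> - Cbar2 (BbarCinv (C1 q + C2 q))) \<and>
      \<phi>0 \<in> Dtaubar \<and> \<Theta> \<zeta>\<phi> = taubar \<phi>0}"
  assumes "hilbert_space scale0 ip0"
    and "self_adjoint scale0 ip0 (op_graph DB B)"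
    and "\<And>\<phi>. \<phi> \<in> DB \<Longrightarrow> B \<phi> = 0 \<Longrightarrow> \<phi> = 0"
    and Hbar1: "hilbert_completion scale0 (H 1) (\<lambda>\<phi>1 \<phi>2. ip0 (B \<phi>1) (B \<phi>2)) scale1 ip1 \<iota>"
    and R: "\<And>k. k \<in> {1, 2} \<Longrightarrow>
      positive_sqrt scale0 ip0 (H (2 * k)) (\<lambda>\<phi>. (B ^^ (2 * k)) \<phi> + \<phi>) (E k) (R k)"
    and Hm1: "hilbert_completion scale0 UNIV (\<lambda>\<phi>1 \<phi>2. ip0 (Rinv 1 \<phi>1) (Rinv 1 \<phi>2)) scalem1 ipm1 \<iota>m1"
    and Hm2: "hilbert_completion scale0 UNIV (\<lambda>\<phi>1 \<phi>2. ip0 (Rinv 2 \<phi>1) (Rinv 2 \<phi>2)) scalem2 ipm2 \<iota>m2"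
    and "hilbert_space scaleh iph"
    and "bounded_linear \<Theta>" and "self_adjoint scaleh iph (op_graph UNIV \<Theta>)"
    and "\<And>\<zeta>. 0 \<le> kre (iph (\<Theta> \<zeta>) \<zeta>)" and "inj \<Theta>"
    and "bounded_between scale1 (Hbar 2) (\<lambda>\<phi>. pow_norm B 1 (Bbar \<phi>)) scaleh UNIV norm \<tau>"
    and "skew_adjoint scale0 ip0 (op_graph (H 1) C1)"
    and "skew_adjoint scale0 ip0 (op_graph (H 1) C2)"
    and BC: "positive_sqrt scale0 ip0 (H 2) (\<lambda>\<phi>. B (B \<phi>) + C1 (C2 \<phi>)) DBC BC"
    and J_self_adjoint: "\<And>\<nu>. \<nu> > 0 \<Longrightarrow> self_adjoint scale0 ip0 (op_graph UNIV (J \<nu>))"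
    and J1: "\<And>\<nu> k. \<nu> > 0 \<Longrightarrow>
      bounded_between scale0 (H k) (pow_norm B k) scale0 (H (k + 1)) (pow_norm B (k + 1)) (J \<nu>)"
    and J2: "\<And>\<nu> \<phi>. \<nu> > 0 \<Longrightarrow> \<phi> \<in> H 1 \<Longrightarrow>
      J \<nu> (BC \<phi>) = BC (J \<nu> \<phi>) \<and> J \<nu> (C1 \<phi> + C2 \<phi>) = C1 (J \<nu> \<phi>) + C2 (J \<nu> \<phi>)"
    and J3: "\<And>\<phi>. ((\<lambda>\<nu>. norm (J \<nu> \<phi> - \<phi>)) \<longlongrightarrow> 0) (at_right 0)"
    and H3_0: "{\<tau> \<phi> - \<Theta> \<zeta> | \<phi> \<zeta>. \<phi> \<in> Hbar 2} = UNIV"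
    and H3_1: "range tau_star \<inter> range incl = {0}"
    and tau_star_injective: "\<And>\<zeta>. tau_star \<zeta> = 0 \<Longrightarrow> \<zeta> = 0"
    and H4_1_1: "\<And>\<phi>. \<phi> \<in> H 1 \<Longrightarrow> norm (C1 \<phi>) \<le> c1 * norm (B \<phi>)"
      "\<And>\<phi>. \<phi> \<in> H 1 \<Longrightarrow> norm (C2 \<phi>) \<le> c2 * norm (B \<phi>)" "c1 * c2 < 1"
    and H4_2_1: "C1 ` H 2 \<subseteq> H 1" "C2 ` H 2 \<subseteq> H 1"
      "\<And>\<phi>. \<phi> \<in> H 2 \<Longrightarrow> C1 (C2 \<phi>) = C2 (C1 \<phi>)"
      "\<And>\<phi>. \<phi> \<in> H 2 \<Longrightarrow> B (C1 \<phi>) = C1 (B \<phi>)"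
      "\<And>\<phi>. \<phi> \<in> H 2 \<Longrightarrow> B (C2 \<phi>) = C2 (B \<phi>)"
    and H4_3_1: "\<And>\<mu>. \<mu> \<noteq> 0 \<Longrightarrow> range (Cstar1 \<circ> G \<mu>) \<subseteq> Dtaubar"
      "\<And>\<mu>. \<mu> \<noteq> 0 \<Longrightarrow> range (Cstar2 \<circ> G \<mu>) \<subseteq> Dtaubar"
    and "lam \<noteq> 0"
  shows "dense_wrt ipT N\<Theta> \<and> skew_adjoint scaleT ipT W\<Theta> \<and> op_graph N\<Theta> Wg \<subseteq> W\<Theta>"
proof -
  interpret h0: hilbert_space scale0 ip0 by fact
  interpret hh: hilbert_space scaleh iph by fact
  interpret h1: hilbert_space scale1 ip1 using Hbar1 by (simp add: hilbert_completion_def)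
  interpret hm1: hilbert_space scalem1 ipm1 using Hm1 by (simp add: hilbert_completion_def)
  interpret hm2: hilbert_space scalem2 ipm2 using Hm2 by (simp add: hilbert_completion_def)
  have H0: "H 0 = UNIV" and H1: "H 1 = DB" and H1': "H (Suc 0) = DB"
    by (auto simp: H_def dom_pow_def)
  have H2: "H 2 = {x \<in> DB. B x \<in> DB}"
    by (auto simp: H_def dom_pow_def numeral_2_eq_2 less_Suc_eq)
  have H4: "H 4 = {x \<in> DB. B x \<in> DB \<and> B (B x) \<in> DB \<and> B (B (B x)) \<in> DB}"
    by (auto simp: H_def dom_pow_def numeral_eq_Suc less_Suc_eq)
  have pow0: "pow_norm B 0 x = norm x" for x by (simp add: pow_norm_def)
  have pow1: "pow_norm B 1 x = sqrt ((norm (B x))\<^sup>2 + (norm x)\<^sup>2)" for x by (simp add: pow_norm_def)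

  note B = h0.self_adjointD[OF \<open>self_adjoint scale0 ip0 (op_graph DB B)\<close>]
  interpret B: self_adj DB B by (rule B(1))
  note C1 = h0.skew_adjointD[OF \<open>skew_adjoint scale0 ip0 (op_graph (H 1) C1)\<close>, unfolded H1]
  note C2 = h0.skew_adjointD[OF \<open>skew_adjoint scale0 ip0 (op_graph (H 1) C2)\<close>, unfolded H1]
  note S = h0.positive_sqrtD[OF BC, unfolded H2]
  have \<iota>_k: "klinear_on scale0 scale1 DB \<iota>" and \<iota>_ip: "\<And>x y. x \<in> DB \<Longrightarrow> y \<in> DB \<Longrightarrow> ip1 (\<iota> x) (\<iota> y) = ip0 (B x) (B y)"
    and \<iota>_dense: "closure (\<iota> ` DB) = UNIV"
    using Hbar1 unfolding hilbert_completion_def H1 by auto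
  have \<iota>_sc: "\<iota> (scale0 c x) = scale1 c (\<iota> x)" if "x \<in> DB" for c x
    using \<iota>_k that by (auto simp: klinear_on_def)
  interpret W: wave DB B \<iota> C1 C2 c1 c2 DBC BC
  proof (intro_locales, rule wave_axioms.intro)
    show "lin_on DB \<iota>"
      by (rule klinear_on_lin_on[OF h0.hilbert_space_axioms h1.hilbert_space_axioms \<iota>_k B.subspace_D])
    show "inner (\<iota> x) (\<iota> y) = inner (B x) (B y)" if "x \<in> DB" "y \<in> DB" for x y
      using \<iota>_ip[OF that] by (simp flip: h1.kre_ip h0.kre_ip)
    show "C1 x \<in> DB" "C2 x \<in> DB" "C1 (C2 x) = C2 (C1 x)" "B (C1 x) = C1 (B x)" "B (C2 x) = C2 (B x)"
      if "x \<in> DB" "B x \<in> DB" for x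
      using H4_2_1 that unfolding H1 H2 by auto
    show "(x \<in> DBC \<and> BC x \<in> DBC) = (x \<in> DB \<and> B x \<in> DB)" for x using S(3)[of x] by simp
    show "BC (BC x) = B (B x) + C1 (C2 x)" if "x \<in> DB" "B x \<in> DB" for x using S(4)[of x] that by simp
    show "norm (C1 x) \<le> c1 * norm (B x)" "norm (C2 x) \<le> c2 * norm (B x)" if "x \<in> DB" for x
      using H4_1_1(1,2)[of x] that unfolding H1 by auto
  qed (use \<iota>_dense C1 C2 S H4_1_1(3) assms in auto)

  have Bbar: "Bbar = W.Bbar" and BbarC: "BbarC = W.Sbar" and Cbar1: "Cbar1 = W.C1bar" and Cbar2: "Cbar2 = W.C2bar"
    unfolding Bbar_def BbarC_def Cbar1_def Cbar2_def H1 by (rule refl)+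
  have BbarCinv: "BbarCinv = W.K" unfolding BbarCinv_def BbarC by (rule W.inv_Sbar)
  have Hbar2: "Hbar 2 = {\<phi>. W.Bbar \<phi> \<in> DB}" by (simp add: Hbar_def Bbar H1')
  have BCinv: "BCinv (BC x) = x" if "x \<in> DB" for x
  proof -
    have "inj_on BC DBC"
      using W.S_inj[of "_ - _"] W.S.S_simps(4) B.D_closed(2) by (intro inj_onI) (force simp: W.D'_eq)
    then show ?thesis unfolding BCinv_def using that by (simp add: W.D'_eq)
  qed

  have BC_sc: "scale0 c x \<in> DB" "BC (scale0 c x) = scale0 c (BC x)" if "x \<in> DB" for c x
    using S(5,6)[of x c] that by (simp_all add: W.D'_eq)
  have sc_cont: "continuous_on UNIV (\<lambda>x. scale0 c (f x))" if "bounded_linear f" for c and f :: "'b \<Rightarrow> 'a"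
    using bounded_linear_compose[OF h0.sc_bl that] by (rule linear_continuous_on)
  have sc1_cont: "continuous_on UNIV (\<lambda>x. f (scale1 c x))" if "bounded_linear f" for c and f :: "'b \<Rightarrow> 'a"
    using bounded_linear_compose[OF that h1.sc_bl] by (rule linear_continuous_on)
  have ext_sc: "F (scale1 c \<phi>) = scale0 c (F \<phi>)"
    if "bounded_linear F" "\<And>x. x \<in> DB \<Longrightarrow> F (\<iota> x) = f x" "\<And>x. x \<in> DB \<Longrightarrow> f (scale0 c x) = scale0 c (f x)" for F f c \<phi>
  proof (rule dense_image_eq[OF \<iota>_dense, of "\<lambda>\<phi>. F (scale1 c \<phi>)" "\<lambda>\<phi>. scale0 c (F \<phi>)"])
    show "F (scale1 c (\<iota> x)) = scale0 c (F (\<iota> x))" if "x \<in> DB" for x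
      using that \<open>\<And>x. x \<in> DB \<Longrightarrow> F (\<iota> x) = f x\<close> \<open>\<And>x. x \<in> DB \<Longrightarrow> f (scale0 c x) = scale0 c (f x)\<close> BC_sc(1)
      by (simp flip: \<iota>_sc)
  qed (use sc_cont[OF that(1)] sc1_cont[OF that(1)] in auto)
  have Sbar_sc: "W.Sbar (scale1 c \<phi>) = scale0 c (W.Sbar \<phi>)" for c \<phi>
    by (rule ext_sc[OF W.Sbar]) (auto simp: BC_sc)
  have C2bar_sc: "W.C2bar (scale1 c \<phi>) = scale0 c (W.C2bar \<phi>)" for c \<phi>
    by (rule ext_sc[OF W.C2bar]) (auto simp: C2)
  have K_sc: "W.K (scale0 c u) = scale1 c (W.K u)" for c u
    by (metis Sbar_sc W.K_Sbar W.Sbar_K)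

  have \<tau>_k: "klinear_on scale1 scaleh {\<phi>. W.Bbar \<phi> \<in> DB} \<tau>"
    and "\<exists>c. \<forall>\<phi>\<in>{\<phi>. W.Bbar \<phi> \<in> DB}. norm (\<tau> \<phi>) \<le> c * pow_norm B 1 (W.Bbar \<phi>)"
    using \<open>bounded_between scale1 (Hbar 2) _ scaleh UNIV norm \<tau>\<close>
    unfolding bounded_between_def Hbar2 Bbar by auto
  then obtain t where t: "\<And>\<phi>. W.Bbar \<phi> \<in> DB \<Longrightarrow> norm (\<tau> \<phi>) \<le> t * pow_norm B 1 (W.Bbar \<phi>)" by auto
  have \<tau>_bound: "norm (\<tau> \<phi>) \<le> \<bar>t\<bar> * (norm (B (W.Bbar \<phi>)) + norm (W.Bbar \<phi>))" if "W.Bbar \<phi> \<in> DB" for \<phi>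
  proof -
    have "norm (\<tau> \<phi>) \<le> t * pow_norm B 1 (W.Bbar \<phi>)" by (rule t[OF that])
    also have "\<dots> \<le> \<bar>t\<bar> * (norm (B (W.Bbar \<phi>)) + norm (W.Bbar \<phi>))"
      unfolding pow1 by (intro mult_mono sqrt_sum_squares_le_sum) auto
    finally show ?thesis .
  qed
  have \<tau>_sc: "\<tau> (scale1 c \<phi>) = scaleh c (\<tau> \<phi>)" if "W.Bbar \<phi> \<in> DB" for c \<phi>
    using \<tau>_k that by (auto simp: klinear_on_def)
  have sub: "subspace {\<phi>. W.Bbar \<phi> \<in> DB}"
    using B.subspace_D bounded_linear.linear[OF W.Bbar(1)]
    by (auto simp: subspace_def linear_0 linear_add linear_scale)
  have T_sc: "\<tau> (W.K (scale0 c u)) = scaleh c (\<tau> (W.K u))" if "u \<in> DB" for c u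
    using that by (simp add: K_sc \<tau>_sc W.second_order(1))
  note \<Theta> = hh.self_adjointD[OF \<open>self_adjoint scaleh iph (op_graph UNIV \<Theta>)\<close>]
  interpret \<Theta>: self_adj UNIV \<Theta> by (rule \<Theta>(1))
  have J_sc: "J \<nu> (scale0 c x) = scale0 c (J \<nu> x)" if "\<nu> > 0" for \<nu> c x
    using h0.self_adjointD(3)[OF J_self_adjoint[OF that]] by blast

  \<comment> \<open>\<open>G \<mu> z\<close> is an adjoint chosen by a description; real parts suffice to identify it because the
    operator whose adjoint is taken commutes with scalars.\<close>
  have G: "G \<mu> z = BC q"
    if \<mu>: "\<mu> \<noteq> 0" and q: "q \<in> DB"
      and pot: "\<And>w. w \<in> DB \<Longrightarrow> inner (BC q) (BC w) - \<mu> * inner (W.C q) w + \<mu>\<^sup>2 * inner q w = inner z (\<tau> (W.K w))" for \<mu> z q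
  proof -
    define p where "p = inv_into {x \<in> DB. B x \<in> DB} (W.pencil (- \<mu>))"
    have p: "p f \<in> DB" "B (p f) \<in> DB" "W.pencil (- \<mu>) (p f) = f" "x \<in> DB \<Longrightarrow> B x \<in> DB \<Longrightarrow> p (W.pencil (- \<mu>) x) = x" for f x
      using W.pencil_inverse[of "- \<mu>"] \<mu> unfolding p_def by auto
    have Gb: "Gbreve (- \<mu>) f = \<tau> (W.K (BC (p f)))" for f
      unfolding Gbreve_def L_def H2 p_def[symmetric] by (simp add: W.K(2) p)
    have p_sc: "p (scale0 c f) = scale0 c (p f)" for c f
    proof -
      have D: "p f \<in> DB" "B (p f) \<in> DB" "BC (p f) \<in> DB" using p W.S_dom2 by auto
      have 1: "scale0 c (p f) \<in> DB" "B (scale0 c (p f)) \<in> DB" using D B(2,3) by auto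
      have "W.pencil (- \<mu>) (scale0 c (p f)) = scale0 c (W.pencil (- \<mu>) (p f))"
        unfolding W.pencil_eq[OF D(1,2)] W.pencil_eq[OF 1]
        using D by (simp add: BC_sc C1(3) C2(3) h0.scale_right_distrib h0.scale_right_diff_distrib
            linear_scale[OF bounded_linear.linear[OF h0.sc_bl]])
      then show ?thesis using p(3)[of f] p(4)[OF 1] by simp
    qed
    have ip: "ip0 (BC q) f = iph z (Gbreve (- \<mu>) f)" for f
    proof (rule kre_mult_eqI)
      fix c
      have D: "BC (p f) \<in> DB" using p W.S_dom2 by auto
      have "inner (BC q) (scale0 c f) = inner z (scaleh c (\<tau> (W.K (BC (p f)))))"
        using W.adjoint_resolvent[OF \<mu> q pot, of "scale0 c f"]
        unfolding p_def[symmetric] p_sc by (simp add: BC_sc p(1) T_sc[OF D])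
      then show "kre (c * ip0 (BC q) f) = kre (c * iph z (Gbreve (- \<mu>) f))"
        unfolding Gb by (simp flip: h0.ip_scale_right hh.ip_scale_right add: h0.kre_ip hh.kre_ip)
    qed
    show ?thesis
      unfolding G_def bounded_adjoint_def
    proof (rule the_equality)
      fix x assume "\<forall>u. ip0 x u = iph z (Gbreve (- \<mu>) u)"
      then have eq: "inner x u = inner (BC q) u" for u using ip by (simp flip: h0.kre_ip)
      show "x = BC q" by (rule dense_inner_eq[OF closure_UNIV]) (rule eq)
    qed (use ip in blast)
  qed

  \<comment> \<open>If \<open>z\<close> paired with the trace is bounded for the norm of \<open>H\<^sub>0\<close> in the coordinate \<open>u = S \<phi>\<close>, then it
    is bounded for the norm of \<open>D(B)\<close> in \<open>\<phi>\<close>. So the image of \<open>z\<close> under the adjoint trace has order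
    \<open>-1\<close>, hence vanishes.\<close>
  have rough: "z = 0" if za: "\<And>w. w \<in> DB \<Longrightarrow> inner z (\<tau> (W.K w)) = inner a w" for z a
  proof -
    have B2: "(B ^^ 2) x = B (B x)" and B4: "(B ^^ 4) x = B (B (B (B x)))" for x
      by (simp_all add: numeral_eq_Suc)
    have m: "(2::nat) * 1 = 2" "(2::nat) * 2 = 4" by simp_all
    note R1 = h0.positive_sqrtD[OF R[of 1], unfolded m H2 B2, OF insertI1]
    note R2 = h0.positive_sqrtD[OF R[of 2], unfolded m H4 B4, OF insertI2[OF insertI1]]
    have k1: "klinear_on scale0 scalem1 UNIV \<iota>m1" and k2: "klinear_on scale0 scalem2 UNIV \<iota>m2"
      and d1: "closure (range \<iota>m1) = UNIV" and d2: "closure (range \<iota>m2) = UNIV"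
      and i1: "\<And>x y. ipm1 (\<iota>m1 x) (\<iota>m1 y) = ip0 (Rinv 1 x) (Rinv 1 y)"
      and i2: "\<And>x y. ipm2 (\<iota>m2 x) (\<iota>m2 y) = ip0 (Rinv 2 x) (Rinv 2 y)"
      using Hm1 Hm2 unfolding hilbert_completion_def by auto
    interpret N: negative_orders DB B "E 1" "E 2" "R 1" "R 2" \<iota>m1 \<iota>m2
    proof (intro_locales, rule negative_orders_axioms.intro)
      show "lin_on UNIV \<iota>m1"
        by (rule klinear_on_lin_on[OF h0.hilbert_space_axioms hm1.hilbert_space_axioms k1 subspace_UNIV])
      show "lin_on UNIV \<iota>m2"
        by (rule klinear_on_lin_on[OF h0.hilbert_space_axioms hm2.hilbert_space_axioms k2 subspace_UNIV])
      show "inner (\<iota>m1 x) (\<iota>m1 y) = inner (inv_into (E 1) (R 1) x) (inv_into (E 1) (R 1) y)" for x y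
        using i1[of x y] unfolding Rinv_def by (simp flip: hm1.kre_ip h0.kre_ip)
      show "inner (\<iota>m2 x) (\<iota>m2 y) = inner (inv_into (E 2) (R 2) x) (inv_into (E 2) (R 2) y)" for x y
        using i2[of x y] unfolding Rinv_def by (simp flip: hm2.kre_ip h0.kre_ip)
      show "(x \<in> E 1 \<and> R 1 x \<in> E 1) = (x \<in> DB \<and> B x \<in> DB)" for x using R1(3)[of x] by simp
      show "R 1 (R 1 x) = B (B x) + x" if "x \<in> DB" "B x \<in> DB" for x using R1(4)[of x] that by simp
      show "(x \<in> E 2 \<and> R 2 x \<in> E 2) = (x \<in> DB \<and> B x \<in> DB \<and> B (B x) \<in> DB \<and> B (B (B x)) \<in> DB)" for x
        using R2(3)[of x] by simp
      show "R 2 (R 2 x) = B (B (B (B x))) + x"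
        if "x \<in> DB" "B x \<in> DB" "B (B x) \<in> DB" "B (B (B x)) \<in> DB" for x using R2(4)[of x] that by simp
    qed (rule R1(1) R2(1) d1 d2)+
    have Rinvbar2: "Rinvbar2 = N.Rinvbar2" and incl: "incl = N.incl"
      unfolding Rinvbar2_def incl_def Rinv_def by (rule refl)+
    have l: "lin_on {x \<in> DB. B x \<in> DB} (\<lambda>\<phi>. inner a (BC \<phi>))"
      using B.self_adj_square W.S.S_simps unfolding W.D'_eq
      by (auto simp: lin_on_def self_adj_def inner_add_right)
    have "\<bar>inner a (BC \<phi>)\<bar> \<le> (2 * norm a) * (norm \<phi> + norm (B \<phi>))" if "\<phi> \<in> DB" for \<phi>
    proof -
      have "\<bar>inner a (BC \<phi>)\<bar> \<le> norm a * norm (BC \<phi>)" by (rule Cauchy_Schwarz_ineq2)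
      also have "\<dots> \<le> norm a * (2 * (norm \<phi> + norm (B \<phi>)))"
      proof (intro mult_left_mono norm_ge_zero)
        show "norm (BC \<phi>) \<le> 2 * (norm \<phi> + norm (B \<phi>))"
          using W.S_bounds(1)[OF that] norm_ge_zero[of \<phi>] unfolding distrib_left by linarith
      qed
      finally show ?thesis by (simp add: mult_ac)
    qed
    then obtain \<eta> where \<eta>: "\<eta> \<in> range N.incl"
      "\<And>x. x \<in> DB \<Longrightarrow> B x \<in> DB \<Longrightarrow> inner (N.Rinvbar2 \<eta>) (R 2 x) = inner a (BC x)"
      by (rule N.lower_order_functional[OF l]) auto
    have pair: "inner a (BC x) = inner z (\<tau> (\<iota> x))" if "x \<in> DB" "B x \<in> DB" for x
      using za[of "BC x"] that W.S_dom2 W.K(2) by simp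
    have ip: "ip0 (Rinvbar2 \<eta>) (R 2 x) = iph z (\<tau> (\<iota> x))" if x: "x \<in> DB" "B x \<in> DB" for x
    proof (rule kre_mult_eqI)
      fix c
      have D: "scale0 c x \<in> DB" "B (scale0 c x) \<in> DB" using x B(2,3) by auto
      have "W.Bbar (\<iota> x) \<in> DB" using x by (simp add: W.Bbar)
      then have "\<tau> (\<iota> (scale0 c x)) = scaleh c (\<tau> (\<iota> x))" by (simp add: \<iota>_sc x \<tau>_sc)
      moreover have "R 2 (scale0 c x) = scale0 c (R 2 x)" using R2(6) N.dom_square_subset_E2[OF x] by blast
      ultimately have "inner (Rinvbar2 \<eta>) (scale0 c (R 2 x)) = inner z (scaleh c (\<tau> (\<iota> x)))"
        using \<eta>(2)[OF D] pair[OF D] by (simp add: Rinvbar2)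
      then show "kre (c * ip0 (Rinvbar2 \<eta>) (R 2 x)) = kre (c * iph z (\<tau> (\<iota> x)))"
        by (simp flip: h0.ip_scale_right hh.ip_scale_right add: h0.kre_ip hh.kre_ip)
    qed
    have "tau_star z = \<eta>"
      unfolding tau_star_def
    proof (rule the_equality)
      fix \<eta>' assume *: "\<forall>\<phi>\<in>H 2. ip0 (Rinvbar2 \<eta>') (R 2 \<phi>) = iph z (\<tau> (\<iota> \<phi>))"
      show "\<eta>' = \<eta>"
      proof (rule N.pairing_unique)
        fix x assume "x \<in> DB" "B x \<in> DB"
        then have "ip0 (Rinvbar2 \<eta>') (R 2 x) = ip0 (Rinvbar2 \<eta>) (R 2 x)" using * ip by (simp add: H2)
        then show "inner (N.Rinvbar2 \<eta>') (R 2 x) = inner (N.Rinvbar2 \<eta>) (R 2 x)"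
          by (simp add: Rinvbar2 flip: h0.kre_ip)
      qed
    qed (use ip in \<open>simp add: H2\<close>)
    then have "tau_star z \<in> range tau_star \<inter> range incl" using \<eta>(1) by (auto simp: incl)
    then have "tau_star z = 0" using H3_1 by auto
    then show "z = 0" by (rule tau_star_injective)
  qed

  interpret T: wave_trace DB B \<iota> C1 C2 c1 c2 DBC BC \<tau> "\<bar>t\<bar>" \<Theta> J
  proof (intro_locales, rule wave_trace_axioms.intro)
    show "lin_on {\<phi>. W.Bbar \<phi> \<in> DB} \<tau>"
      by (rule klinear_on_lin_on[OF h1.hilbert_space_axioms hh.hilbert_space_axioms \<tau>_k sub])
    show "0 \<le> inner (\<Theta> x) x" for x
      using \<open>\<And>\<zeta>. 0 \<le> kre (iph (\<Theta> \<zeta>) \<zeta>)\<close> by (simp add: hh.kre_ip)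
    show "x = 0" if "\<Theta> x = 0" for x
      using that \<open>inj \<Theta>\<close> \<Theta>.S_simps(5) by (metis injD)
    show "lin_on UNIV (J \<nu>)" if "\<nu> > 0" for \<nu>
      using h0.self_adjointD(1)[OF J_self_adjoint[OF that]] by (simp add: self_adj_def)
    show "inner (J \<nu> a) b = inner a (J \<nu> b)" if "\<nu> > 0" for \<nu> a b
      using self_adj.sym[OF h0.self_adjointD(1)[OF J_self_adjoint[OF that]]] by simp
    have J0: "J \<nu> ` UNIV \<subseteq> DB" "\<exists>c. \<forall>x. pow_norm B 1 (J \<nu> x) \<le> c * norm x" if "\<nu> > 0" for \<nu>
      using J1[OF that, of 0] unfolding bounded_between_def H0 pow0 by (auto simp: H1')
    show "J \<nu> a \<in> DB" if "\<nu> > 0" for \<nu> a using J0[OF that] by auto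
    show "\<exists>K. \<forall>a. norm (J \<nu> a) \<le> K * norm a \<and> norm (B (J \<nu> a)) \<le> K * norm a" if \<nu>: "\<nu> > 0" for \<nu>
    proof -
      obtain c where c: "\<And>x. pow_norm B 1 (J \<nu> x) \<le> c * norm x" using J0(2)[OF \<nu>] by blast
      have "norm (J \<nu> a) \<le> c * norm a" "norm (B (J \<nu> a)) \<le> c * norm a" for a
        using c[of a] real_sqrt_sum_squares_ge1[of "norm (B (J \<nu> a))" "norm (J \<nu> a)"]
          real_sqrt_sum_squares_ge2[of "norm (J \<nu> a)" "norm (B (J \<nu> a))"]
        unfolding pow1 by linarith+
      then show ?thesis by blast
    qed
    show "J \<nu> (BC a) = BC (J \<nu> a)" "J \<nu> (W.C a) = W.C (J \<nu> a)" if "\<nu> > 0" "a \<in> DB" for \<nu> a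
      using J2[OF that(1), of a] that(2) unfolding H1 by auto
    show "((\<lambda>\<nu>. J \<nu> a) \<longlongrightarrow> a) (at_right 0)" for a
      using J3[of a] by (simp add: LIM_zero_iff tendsto_norm_zero_iff)
    show "\<exists>\<phi> z. W.Bbar \<phi> \<in> DB \<and> \<tau> \<phi> - \<Theta> z = y" for y
    proof -
      have "y \<in> {\<tau> \<phi> - \<Theta> \<zeta> |\<phi> \<zeta>. \<phi> \<in> Hbar 2}" using H3_0 by simp
      then show ?thesis unfolding Hbar2 by blast
    qed
    show "z = 0" if "\<And>w. w \<in> DB \<Longrightarrow> inner z (\<tau> (W.K w)) = inner a w" for z a
      using that by (rule rough)
    have Cstar: "Cstar1 (G \<mu> z) = - W.K (C1 q)" "Cstar2 (G \<mu> z) = - W.K (C2 q)"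
      if "\<mu> \<noteq> 0" "q \<in> DB"
        "\<And>w. w \<in> DB \<Longrightarrow> inner (BC q) (BC w) - \<mu> * inner (W.C q) w + \<mu>\<^sup>2 * inner q w = inner z (\<tau> (W.K w))" for \<mu> q z
    proof -
      have "G \<mu> z = BC q" using that by (rule G)
      then show "Cstar1 (G \<mu> z) = - W.K (C1 q)" "Cstar2 (G \<mu> z) = - W.K (C2 q)"
        unfolding Cstar1_def Cstar2_def BbarCinv Cbar1 Cbar2
        using that(2) by (simp_all add: W.K(2) W.C1bar W.C2bar)
    qed
    have Jbar: "Jbar = (\<lambda>\<nu>. bounded_ext \<iota> DB (\<lambda>\<phi>. \<iota> (J \<nu> \<phi>)))" unfolding Jbar_def H1 ..
    show "\<exists>l. ((\<lambda>\<nu>. \<tau> (bounded_ext \<iota> DB (\<lambda>\<phi>. \<iota> (J \<nu> \<phi>)) (- W.K (C1 q)))) \<longlongrightarrow> l) (at_right 0)"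
      if h: "\<mu> \<noteq> 0" "q \<in> DB"
        "\<And>w. w \<in> DB \<Longrightarrow> inner (BC q) (BC w) - \<mu> * inner (W.C q) w + \<mu>\<^sup>2 * inner q w = inner z (\<tau> (W.K w))" for \<mu> q z
    proof -
      have "Cstar1 (G \<mu> z) \<in> Dtaubar" using H4_3_1(1)[OF h(1)] by auto
      moreover have "Cstar1 (G \<mu> z) = - W.K (C1 q)" using h by (rule Cstar)
      ultimately show ?thesis unfolding Dtaubar_def Jbar by simp
    qed
    show "\<exists>l. ((\<lambda>\<nu>. \<tau> (bounded_ext \<iota> DB (\<lambda>\<phi>. \<iota> (J \<nu> \<phi>)) (- W.K (C2 q)))) \<longlongrightarrow> l) (at_right 0)"
      if h: "\<mu> \<noteq> 0" "q \<in> DB"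
        "\<And>w. w \<in> DB \<Longrightarrow> inner (BC q) (BC w) - \<mu> * inner (W.C q) w + \<mu>\<^sup>2 * inner q w = inner z (\<tau> (W.K w))" for \<mu> q z
    proof -
      have "Cstar2 (G \<mu> z) \<in> Dtaubar" using H4_3_1(2)[OF h(1)] by auto
      moreover have "Cstar2 (G \<mu> z) = - W.K (C2 q)" using h by (rule Cstar)
      ultimately show ?thesis unfolding Dtaubar_def Jbar by simp
    qed
  qed (use \<tau>_bound \<open>bounded_linear \<Theta>\<close> \<Theta>.sym in auto)

  have Jbar: "Jbar = T.Jbar" unfolding Jbar_def H1 ..
  have GQ: "G lam z = BC (T.coupled.Q lam z)" and BCQ: "BCinv (G lam z) = T.coupled.Q lam z" for z
  proof -
    show 1: "G lam z = BC (T.coupled.Q lam z)"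
      by (rule G[OF \<open>lam \<noteq> 0\<close> T.coupled.Q_D[OF \<open>lam \<noteq> 0\<close>] T.coupled.potentialD(2)[OF T.coupled.Q[OF \<open>lam \<noteq> 0\<close>]]])
    show "BCinv (G lam z) = T.coupled.Q lam z"
      unfolding 1 by (rule BCinv[OF T.coupled.Q_D[OF \<open>lam \<noteq> 0\<close>]])
  qed
  \<comment> \<open>\<open>Lim\<close> has a meaningful value only where the limit exists, which membership in the domain of the
    regularised trace guarantees.\<close>
  have trace: "(\<phi> \<in> Dtaubar \<and> z = taubar \<phi>) \<longleftrightarrow> ((\<lambda>\<nu>. \<tau> (T.Jbar \<nu> \<phi>)) \<longlongrightarrow> z) (at_right 0)" for \<phi> z
    unfolding Dtaubar_def taubar_def Jbar using tendsto_Lim[OF trivial_limit_at_right_real] by blast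
  have W\<Theta>: "W\<Theta> = T.extension lam"
    unfolding W\<Theta>_def T.extension_def
  proof (intro Collect_cong iff_exI)
    fix X \<phi>0 \<psi>0 \<zeta>\<phi> \<phi>l \<psi>l \<zeta>\<psi> q
    show "(X = ((\<phi>0, \<psi>0, \<zeta>\<phi>),
        (\<iota> (Cbar2 \<phi>l + \<psi>l) - lam *\<^sub>R BbarCinv (- (C1 q + C2 q) + lam *\<^sub>R q),
         C1 \<psi>l - B (Bbar \<phi>l) + lam *\<^sub>R Cbar2 (BbarCinv (- (C1 q + C2 q) + lam *\<^sub>R q)), \<zeta>\<psi>)) \<and>
      \<phi>l \<in> Hbar 2 \<and> \<psi>l \<in> H 1 \<and> q = BCinv (G lam \<zeta>\<psi>) \<and>
      \<phi>0 = \<phi>l + BbarCinv (C1 q + C2 q) \<and>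
      \<psi>0 = \<psi>l + (G lam \<zeta>\<psi> - Cbar2 (BbarCinv (C1 q + C2 q))) \<and>
      \<phi>0 \<in> Dtaubar \<and> \<Theta> \<zeta>\<phi> = taubar \<phi>0) \<longleftrightarrow>
     (X = ((\<phi>0, \<psi>0, \<zeta>\<phi>), (\<iota> (W.C2bar \<phi>l + \<psi>l) - lam *\<^sub>R W.K (- W.C q + lam *\<^sub>R q),
         C1 \<psi>l - B (W.Bbar \<phi>l) + lam *\<^sub>R W.C2bar (W.K (- W.C q + lam *\<^sub>R q)), \<zeta>\<psi>)) \<and>
      W.Bbar \<phi>l \<in> DB \<and> \<psi>l \<in> DB \<and> q = T.coupled.Q lam \<zeta>\<psi> \<and> \<phi>0 = \<phi>l + W.K (W.C q) \<and>
      \<psi>0 = \<psi>l + (BC q - W.C2bar (W.K (W.C q))) \<and>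
      ((\<lambda>\<nu>. \<tau> (T.Jbar \<nu> \<phi>0)) \<longlongrightarrow> \<Theta> \<zeta>\<phi>) (at_right 0))"
      unfolding trace[symmetric] Bbar Cbar2 BbarCinv Hbar2 H1 BCQ unfolding GQ by auto
  qed
  have N\<Theta>: "N\<Theta> = T.constraint"
    unfolding N\<Theta>_def T.constraint_def Hbar2 H1 by auto
  have W\<Theta>_iff: "(x, y) \<in> W\<Theta> \<longleftrightarrow> (T.coords x, T.coords y) \<in> T.coupled.W" for x y
    unfolding W\<Theta> by (rule T.extension_iff[OF \<open>lam \<noteq> 0\<close>])

  have kre_ipT: "kre (ipT x y) = T.coupled.form (T.coords x) (T.coords y)" for x y
    by (cases x, cases y)
      (simp add: ipT_def T.coords_def T.coupled.form_def kre_add h0.kre_ip hh.kre_ip BbarC Cbar2)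
  have ipT_scale: "ipT x (scaleT c y) = c * ipT x y" for x y c
    by (cases x, cases y)
      (simp add: ipT_def scaleT_def BbarC Cbar2 Sbar_sc C2bar_sc h0.ip_scale_right hh.ip_scale_right
        algebra_simps flip: h0.scale_right_distrib)
  have W_scale: "(x, y) \<in> W\<Theta> \<Longrightarrow> (scaleT c x, scaleT c y) \<in> W\<Theta>" for x y c
  proof -
    assume xy: "(x, y) \<in> W\<Theta>"
    obtain \<phi> \<psi> \<zeta> \<phi>' \<psi>' \<zeta>' where x: "x = (\<phi>, \<psi>, \<zeta>)" "y = (\<phi>', \<psi>', \<zeta>')" by (metis surj_pair)
    define u v u' v' where "u = W.Sbar \<phi>" "v = \<psi> + W.C2bar \<phi>" "u' = W.Sbar \<phi>'" "v' = \<psi>' + W.C2bar \<phi>'"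
    note uv = this
    have c: "T.coords x = (u, v, \<zeta>)" "T.coords y = (u', v', \<zeta>')"
      "T.coords (scaleT c x) = (scale0 c u, scale0 c v, scaleh c \<zeta>)"
      "T.coords (scaleT c y) = (scale0 c u', scale0 c v', scaleh c \<zeta>')"
      by (simp_all add: x T.coords_def scaleT_def uv Sbar_sc C2bar_sc h0.scale_right_distrib)
    have W: "\<And>w. w \<in> DB \<Longrightarrow> inner u' w = inner v (BC w) - inner \<zeta>' (\<tau> (W.K w))"
      "\<And>w. w \<in> DB \<Longrightarrow> inner v' w = - inner v (W.C w) - inner u (BC w)"
      "((\<lambda>\<nu>. \<tau> (W.K (J \<nu> u))) \<longlongrightarrow> \<Theta> \<zeta>) (at_right 0)"
      using xy unfolding W\<Theta>_iff c T.coupled.W_def by auto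
    have "inner (scale0 c u') w = inner (scale0 c v) (BC w) - inner (scaleh c \<zeta>') (\<tau> (W.K w))" if "w \<in> DB" for w
      using W(1)[OF BC_sc(1)[OF that]] by (simp add: h0.inner_sc_left hh.inner_sc_left BC_sc that T_sc)
    moreover have "inner (scale0 c v') w = - inner (scale0 c v) (W.C w) - inner (scale0 c u) (BC w)" if "w \<in> DB" for w
      using W(2)[OF BC_sc(1)[OF that]]
      by (simp add: h0.inner_sc_left BC_sc that C1(3) C2(3) h0.scale_right_distrib)
    moreover have "((\<lambda>\<nu>. \<tau> (W.K (J \<nu> (scale0 c u)))) \<longlongrightarrow> \<Theta> (scaleh c \<zeta>)) (at_right 0)"
    proof -
      have "((\<lambda>\<nu>. scaleh c (\<tau> (W.K (J \<nu> u)))) \<longlongrightarrow> \<Theta> (scaleh c \<zeta>)) (at_right 0)"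
        using bounded_linear.tendsto[OF hh.sc_bl W(3), of c] \<Theta>(3) by simp
      moreover have "eventually (\<lambda>\<nu>. scaleh c (\<tau> (W.K (J \<nu> u))) = \<tau> (W.K (J \<nu> (scale0 c u)))) (at_right 0)"
        using T.coupled.eventually_pos by eventually_elim (simp add: J_sc T_sc T.J_D)
      ultimately show ?thesis by (rule Lim_transform_eventually)
    qed
    ultimately show "(scaleT c x, scaleT c y) \<in> W\<Theta>"
      unfolding W\<Theta>_iff c T.coupled.W_def by auto
  qed
  have subW: "subspace W\<Theta>"
    unfolding subspace_def
  proof (intro conjI ballI allI)
    note sW = T.coupled.subspace_W
    show "0 \<in> W\<Theta>"
      using subspace_0[OF sW] by (simp add: zero_prod_def[where 'a = "'b \<times> 'a \<times> 'h"] W\<Theta>_iff T.coords_simps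
          zero_prod_def[where 'a = "'a \<times> 'a \<times> 'h"])
    show "X + Y \<in> W\<Theta>" if XY: "X \<in> W\<Theta>" "Y \<in> W\<Theta>" for X Y
    proof -
      obtain x y p r where X: "X = (x, y)" "Y = (p, r)" by (metis surj_pair)
      then show ?thesis
        using XY subspace_add[OF sW, of "(T.coords x, T.coords y)" "(T.coords p, T.coords r)"]
        by (simp add: W\<Theta>_iff T.coords_simps)
    qed
    show "c *\<^sub>R X \<in> W\<Theta>" if "X \<in> W\<Theta>" for X c
    proof -
      obtain x y where X: "X = (x, y)" by (metis surj_pair)
      then show ?thesis
        using that subspace_scale[OF sW, of "(T.coords x, T.coords y)" c]
        by (simp add: W\<Theta>_iff T.coords_simps)
    qed
  qed
  have linear: "linear_graph scaleT W\<Theta>"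
    unfolding linear_graph_def
  proof (intro conjI)
    show "single_valued W\<Theta>"
      unfolding single_valued_def W\<Theta>_iff
    proof (intro allI impI)
      fix x y z assume "(T.coords x, T.coords y) \<in> T.coupled.W" "(T.coords x, T.coords z) \<in> T.coupled.W"
      then have "T.coords y = T.coords z" by (rule T.coupled.W_single_valued)
      then show "y = z" by (simp only: T.coords_inj)
    qed
    show "(0, 0) \<in> W\<Theta>" using subspace_0[OF subW] by (simp add: zero_prod_def)
    show "\<forall>(x, y)\<in>W\<Theta>. \<forall>(x', y')\<in>W\<Theta>. (x + x', y + y') \<in> W\<Theta>"
    proof (intro ballI, clarify)
      fix x y x' y' assume "(x, y) \<in> W\<Theta>" "(x', y') \<in> W\<Theta>"
      from subspace_add[OF subW this] show "(x + x', y + y') \<in> W\<Theta>" by simp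
    qed
    show "\<forall>c. \<forall>(x, y)\<in>W\<Theta>. (scaleT c x, scaleT c y) \<in> W\<Theta>" using W_scale by blast
  qed
  have dense: "dense_wrt ipT N\<Theta>"
    unfolding dense_wrt_def N\<Theta> ip_norm_def kre_ipT
  proof (intro allI impI)
    fix x and e :: real assume e: "e > 0"
    then obtain y where "y \<in> T.constraint" "T.coupled.form (T.coords (x - y)) (T.coords (x - y)) < e\<^sup>2"
      using T.constraint_dense[of "e\<^sup>2" x] by auto
    then show "\<exists>y\<in>T.constraint. sqrt (T.coupled.form (T.coords (x - y)) (T.coords (x - y))) < e"
      using e real_less_lsqrt by (intro bexI[of _ y]) (auto simp: real_sqrt_less_iff intro: real_less_lsqrt)
  qed
  have subset: "op_graph N\<Theta> Wg \<subseteq> W\<Theta>"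
  proof
    fix X assume "X \<in> op_graph N\<Theta> Wg"
    then obtain \<phi> \<psi> z where X: "X = ((\<phi>, \<psi>, z), Wg (\<phi>, \<psi>, z))" "(\<phi>, \<psi>, z) \<in> T.constraint"
      unfolding op_graph_def N\<Theta> by auto
    show "X \<in> W\<Theta>"
      unfolding X(1) W\<Theta> Wg_def Cbar2 Bbar using T.restriction_subset[OF \<open>lam \<noteq> 0\<close> X(2)] by simp
  qed
  have "N\<Theta> \<subseteq> Domain W\<Theta>" using subset unfolding op_graph_def by blast
  then have dom: "dense_wrt ipT (Domain W\<Theta>)" using dense unfolding dense_wrt_def by blast
  have adj: "adjoint_graph ipT W\<Theta> = {(x, - y) |x y. (x, y) \<in> W\<Theta>}"
  proof (intro set_eqI iffI)
    fix X assume X: "X \<in> adjoint_graph ipT W\<Theta>"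
    obtain x y where xy: "X = (x, y)" by (cases X)
    have "(T.coords x, - T.coords y) \<in> T.coupled.W"
    proof (rule T.coupled.W_maximal)
      fix p r assume pr: "(p, r) \<in> T.coupled.W"
      obtain p' r' where pr': "p = T.coords p'" "r = T.coords r'"
        by (metis T.coords_surj surj_pair)
      then have "(p', r') \<in> W\<Theta>" using pr by (simp add: W\<Theta>_iff)
      then have "ipT x r' = ipT y p'" using X by (auto simp: adjoint_graph_def xy)
      then show "T.coupled.form (T.coords x) r = T.coupled.form (T.coords y) p"
        by (simp add: pr' flip: kre_ipT)
    qed
    then have "(x, - y) \<in> W\<Theta>" by (simp add: W\<Theta>_iff T.coords_simps)
    then show "X \<in> {(x, - y) |x y. (x, y) \<in> W\<Theta>}" unfolding xy by (intro CollectI exI[of _ x] exI[of _ "- y"]) simp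
  next
    fix X assume "X \<in> {(x, - y) |x y. (x, y) \<in> W\<Theta>}"
    then obtain x y where xy: "X = (x, - y)" "(x, y) \<in> W\<Theta>" by blast
    have "ipT x r = ipT (- y) p" if pr: "(p, r) \<in> W\<Theta>" for p r
    proof (rule kre_mult_eqI)
      fix c
      interpret f: nonneg_form T.coupled.form by (rule T.coupled.nonneg_form)
      have "T.coupled.form (T.coords y) (T.coords (scaleT c p)) + T.coupled.form (T.coords x) (T.coords (scaleT c r)) = 0"
        using T.coupled.W_skew xy(2) W_scale[OF pr] unfolding W\<Theta>_iff by blast
      then show "kre (c * ipT x r) = kre (c * ipT (- y) p)"
        by (simp add: kre_ipT T.coords_simps f.minus_left flip: ipT_scale)
    qed
    then show "X \<in> adjoint_graph ipT W\<Theta>" by (auto simp: adjoint_graph_def xy)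
  qed
  show ?thesis
    unfolding skew_adjoint_def using dense linear dom adj subset by blast
qed

end
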